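(* Suppose $w$ is a weight on the unit circle $\mathbb T$ with $[w]_{A_2(\mathbb T)}<\infty$ and $\|\frac{w}{2\pi}\|_{L^1(\mathbb T)}=1$ (i.e. $\int_{\mathbb T}\frac{w}{2\pi}d\theta=1$). Then $$\lim_{n\to\infty}\|\phi_n^*-D^{-1}\|_{L^p_w(\mathbb T)}=0$$ for every $p\in\big[2,\ \min\big(p_{\rm cr}([w]_{A_2(\mathbb T)}),\,2(1+q_{\rm cr}(w))\big)\big)$.
   Context: $[w]_{A_2(\mathbb T)}:=\sup_I \langle w\rangle_I\langle w^{-1}\rangle_I$, supremum over arcs $I\subseteq\mathbb T$, $\langle g\rangle_I:=\frac1{|I|}\int_I g\,d\theta$. $L^p_w(\mathbb T)$ is $L^p$ with respect to $w\frac{d\theta}{2\pi}$. $\phi_n=\phi_n(z,w)$ are the polynomials orthonormal with respect to $d\mu=\frac{w}{2\pi}d\theta$, $\deg\phi_n=n$, with positive leading coefficient; $\phi_n^*(z)=z^n\overline{\phi_n(1/\bar z)}$. $D$ is the Szegő function, the outer function in the unit disc $D(z)=\exp\Big(\frac1{2\pi}\int_{\mathbb T}\frac{1+\bar\xi z}{1-\bar\xi z}\log\sqrt{w(\theta)}\,d\theta\Big)$, $\xi=e^{i\theta}$, whose boundary values satisfy $|D|^2=w$ a.e. on $\mathbb T$ (it is well defined since $w\in A_2$ gives $\log w\in L^1(\mathbb T)$). $q_{\rm cr}(w)=\sup\{q:\|w^{-1}\|_{L^q(\mathbb T)}<\infty\}$. For $t\ge1$, $p_{\rm cr}(t)$ is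 the supremum of all $p$ such that $\sup_n\|\phi_n(\cdot,v)\|_{L^p_v(\mathbb T)}<\infty$ for every weight $v$ with $\int_{\mathbb T}\frac{v}{2\pi}d\theta=1$ and $[v]_{A_2(\mathbb T)}\le t$. *)

theory Defs
  imports "HOL-Analysis.Analysis" "HOL-Computational_Algebra.Polynomial"
begin

(* A function g on the unit circle is given by a function on the complex plane of which
   only the values g (cis \<theta>) matter. *)

definition circ :: "real measure" where
  "circ = lebesgue_on {0..2*pi}"

definition weight :: "(complex \<Rightarrow> real) \<Rightarrow> bool" where
  "weight w \<longleftrightarrow> (\<lambda>\<theta>. w (cis \<theta>)) \<in> borel_measurable lebesgue \<and> (\<forall>\<theta>. 0 \<le> w (cis \<theta>))"

definition weighted_circ :: "(complex \<Rightarrow> real) \<Rightarrow> real measure" where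
  "weighted_circ w = density circ (\<lambda>\<theta>. ennreal (w (cis \<theta>) / (2*pi)))"

definition normalized :: "(complex \<Rightarrow> real) \<Rightarrow> bool" where
  "normalized w \<longleftrightarrow> (\<integral>\<^sup>+\<theta>. ennreal (w (cis \<theta>) / (2*pi)) \<partial>circ) = 1"

definition arc_average :: "real \<Rightarrow> real \<Rightarrow> (complex \<Rightarrow> ennreal) \<Rightarrow> ennreal" where
  "arc_average a b g = (\<integral>\<^sup>+\<theta>. g (cis \<theta>) \<partial>lebesgue_on {a..b}) / ennreal (b - a)"

(* The inverse is taken in ennreal, where inverse 0 = \<infinity>: a normalized weight that
   vanishes on a set of positive measure has A2 characteristic \<infinity> (take the whole circle). *)
definition A2_char :: "(complex \<Rightarrow> real) \<Rightarrow> ennreal" where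
  "A2_char w = (SUP (a, b) \<in> {(a, b). a < b \<and> b \<le> a + 2*pi}.
     arc_average a b (\<lambda>z. ennreal (w z)) * arc_average a b (\<lambda>z. inverse (ennreal (w z))))"

(* x to the power p, for exponents p > 0 *)
definition ennpow :: "ennreal \<Rightarrow> real \<Rightarrow> ennreal" where
  "ennpow x p = (if x = \<infinity> then \<infinity> else ennreal (enn2real x powr p))"

(* The L^p norm of |f|, given the function |f|, which may take the value \<infinity>;
   the norm is \<infinity> when |f| is not p-integrable. *)
definition Lp_norm :: "'a measure \<Rightarrow> real \<Rightarrow> ('a \<Rightarrow> ennreal) \<Rightarrow> ennreal" where
  "Lp_norm M p f = ennpow (\<integral>\<^sup>+x. ennpow (f x) p \<partial>M) (1 / p)"

definition is_orthonormal_polys :: "(complex \<Rightarrow> real) \<Rightarrow> (nat \<Rightarrow> complex poly) \<Rightarrow> bool" where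
  "is_orthonormal_polys w \<phi> \<longleftrightarrow>
     (\<forall>n. degree (\<phi> n) = n \<and> lead_coeff (\<phi> n) \<in> \<real> \<and> 0 < Re (lead_coeff (\<phi> n))) \<and>
     (\<forall>m n. (\<integral>\<theta>. poly (\<phi> m) (cis \<theta>) * cnj (poly (\<phi> n) (cis \<theta>)) \<partial>weighted_circ w)
        = (if m = n then 1 else 0))"

(* Well defined (by Gram-Schmidt) when w is normalized and has finite A2 characteristic. *)
definition orthonormal_poly :: "(complex \<Rightarrow> real) \<Rightarrow> nat \<Rightarrow> complex poly" where
  "orthonormal_poly w = (THE \<phi>. is_orthonormal_polys w \<phi>)"

(* \<phi>_n^* (z) for z \<noteq> 0 *)
definition reversed_poly :: "(complex \<Rightarrow> real) \<Rightarrow> nat \<Rightarrow> complex \<Rightarrow> complex" where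
  "reversed_poly w n z = z ^ n * cnj (poly (orthonormal_poly w n) (1 / cnj z))"

definition szego :: "(complex \<Rightarrow> real) \<Rightarrow> complex \<Rightarrow> complex" where
  "szego w z = exp (1 / (2*pi) *
     (\<integral>\<theta>. (1 + cnj (cis \<theta>) * z) / (1 - cnj (cis \<theta>) * z) * of_real (ln (sqrt (w (cis \<theta>)))) \<partial>circ))"

(* Boundary values of the Szego function are radial limits, which exist almost everywhere. *)
definition szego_boundary :: "(complex \<Rightarrow> real) \<Rightarrow> complex \<Rightarrow> complex" where
  "szego_boundary w \<zeta> = Lim (at_left 1) (\<lambda>r::real. szego w (of_real r * \<zeta>))"

definition q_cr :: "(complex \<Rightarrow> real) \<Rightarrow> ennreal" where
  "q_cr w = Sup {ennreal q | q. 0 < q \<and> Lp_norm circ q (\<lambda>\<theta>. inverse (ennreal (w (cis \<theta>)))) < \<infinity>}"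

definition p_cr :: "ennreal \<Rightarrow> ennreal" where
  "p_cr t = Sup {ennreal p | p. 0 < p \<and>
     (\<forall>v. weight v \<and> normalized v \<and> A2_char v \<le> t \<longrightarrow>
        (SUP n. Lp_norm (weighted_circ v) p
           (\<lambda>\<theta>. ennreal (cmod (poly (orthonormal_poly v n) (cis \<theta>))))) < \<infinity>)}"

end

theory Submission
  imports Defs "HOL-Complex_Analysis.Complex_Analysis"
begin

text \<open>
  Put \<open>G = log (sqrt w)\<close> and let \<open>h\<close> be its Herglotz integral, so that \<open>D = exp h\<close>. Since \<open>w\<close> and \<open>1/w\<close>
  are integrable, \<open>G\<close> is square integrable. Choose polynomials \<open>Q\<^sub>n\<close> whose real parts approximate \<open>G\<close>
  in \<open>L\<^sup>2\<close>. By Bessel's inequality the Taylor coefficients of \<open>h - Q\<^sub>n\<close> are small in \<open>l\<^sup>2\<close>, and the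
  Hardy-Littlewood maximal inequality bounds the radial supremum of \<open>\<bar>h - Q\<^sub>n\<bar>\<close> in measure. Hence \<open>h\<close>
  has radial limits \<open>H\<close> almost everywhere, with \<open>Re H = G\<close>. If the \<open>Q\<^sub>n\<close> come from truncations of \<open>G\<close>,
  the functions \<open>exp Q\<^sub>n\<close> are bounded in \<open>L\<^sup>2\<close>, and the mean value property passes from them to \<open>exp H\<close>.

  With \<open>\<kappa>\<^sub>n\<close> the leading coefficient of \<open>\<phi>\<^sub>n\<close>, expanding the square and using \<open>\<bar>D\<bar>\<^sup>2 = w\<close> gives
  \<open>2 - 2 \<kappa>\<^sub>n D(0)\<close> for the square of the distance of \<open>\<phi>\<^sub>n\<^sup>*\<close> and \<open>1/D\<close> in \<open>L\<^sup>2\<^sub>w\<close>. Now \<open>\<kappa>\<^sub>n\<^sup>-\<^sup>2\<close> is a lower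
  bound for the mean of \<open>\<bar>P\<bar>\<^sup>2 w\<close> over the circle, for all polynomials \<open>P\<close> of degree at most \<open>n\<close> with \<open>P(0) = 1\<close>, and
  Taylor polynomials of \<open>exp (Q\<^sub>m(0) - Q\<^sub>m)\<close> bring this mean close to \<open>D(0)\<^sup>2\<close>; so the distance
  tends to 0. For \<open>p > 2\<close> interpolate between \<open>L\<^sup>2\<close> and some \<open>L\<^sup>s\<close> with \<open>s > p\<close>, in which \<open>\<phi>\<^sub>n\<^sup>*\<close> is
  bounded because \<open>p < p\<^sub>c\<^sub>r\<close> and \<open>1/D\<close> is finite because \<open>p < 2 (1 + q\<^sub>c\<^sub>r)\<close>.
\<close>

section \<open>The radial maximal inequality\<close>

lemma has_integral_Cauchy_cis:
  fixes f :: "complex \<Rightarrow> complex"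
  assumes "continuous_on (cball 0 1) f" "f holomorphic_on ball 0 1" "norm a < 1"
  shows "((\<lambda>t. f (cis t) * cis t / (cis t - a)) has_integral (2 * pi * f a)) {0..2*pi}"
proof -
  have "((\<lambda>u. f u / (u - a)) has_contour_integral (2 * of_real pi * \<i> * f a)) (part_circlepath 0 1 0 (2*pi))"
    using Cauchy_integral_circlepath[OF assms(1,2)] assms(3) by (simp add: circlepath_def)
  hence "((\<lambda>t. f (cis t) / (cis t - a) * \<i> * cis t) has_integral (2 * of_real pi * \<i> * f a)) {0..2*pi}"
    by (simp add: has_contour_integral_part_circlepath_iff)
  from has_integral_mult_right[OF this, of "-\<i>"] show ?thesis
    by (simp add: field_simps)
qed

lemma has_integral_mean_value_cis:
  fixes f :: "complex \<Rightarrow> complex"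
  assumes "continuous_on (cball 0 1) f" "f holomorphic_on ball 0 1"
  shows "((\<lambda>t. f (cis t)) has_integral (2 * pi * f 0)) {0..2*pi}"
  using has_integral_Cauchy_cis[OF assms, of 0] by simp

text \<open>The Poisson kernel without the factor 1/(2 pi), so that its integral over a period is 2
  pi.\<close>

definition poisson :: "real \<Rightarrow> real \<Rightarrow> real" where
  "poisson r t = (1 - r\<^sup>2) / (1 - 2 * r * cos t + r\<^sup>2)"

lemma poisson_denom_pos:
  fixes r t :: real
  assumes "0 \<le> r" "r < 1"
  shows "0 < 1 - 2 * r * cos t + r\<^sup>2"
proof -
  have "0 < (1 - r)\<^sup>2" using assms by simp
  also have "\<dots> = 1 - 2 * r * 1 + r\<^sup>2" by (simp add: power2_eq_square algebra_simps)
  also have "\<dots> \<le> 1 - 2 * r * cos t + r\<^sup>2"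
    using assms by (intro add_mono diff_mono mult_left_mono) auto
  finally show ?thesis .
qed

text \<open>On the circle the Poisson kernel is the Cauchy kernel z / (z - r) plus r z / (1 - r z).
  The second summand is holomorphic near the closed disc and vanishes at 0, so its product with
  \<open>f\<close> has mean 0 and Cauchy's formula for \<open>f\<close> at \<open>r\<close>
  remains.\<close>

lemma has_integral_poisson:
  fixes f :: "complex \<Rightarrow> complex"
  assumes f: "continuous_on (cball 0 1) f" "f holomorphic_on ball 0 1" and r: "0 \<le> r" "r < 1"
  shows "((\<lambda>t. f (cis t) * of_real (poisson r t)) has_integral (2 * pi * f (of_real r))) {0..2*pi}"
proof -
  define g where "g z = f z * (of_real r * z) / (1 - of_real r * z)" for z :: complex
  have nz: "1 - of_real r * z \<noteq> 0" if "norm z \<le> 1" for z :: complex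
  proof
    assume "1 - of_real r * z = 0"
    hence "norm (of_real r * z) = 1" by (metis eq_iff_diff_eq_0 norm_one)
    hence "r * norm z = 1" using r by (simp add: norm_mult)
    moreover have "r * norm z \<le> r * 1" using that r by (intro mult_left_mono) auto
    ultimately show False using r by simp
  qed
  have "continuous_on (cball 0 1) g" unfolding g_def
    using f(1) nz by (intro continuous_intros) auto
  moreover have "g holomorphic_on ball 0 1" unfolding g_def
    using f(2) nz by (intro holomorphic_intros) auto
  ultimately have g: "((\<lambda>t. g (cis t)) has_integral 0) {0..2*pi}"
    using has_integral_mean_value_cis[of g] by (simp add: g_def)
  have eq: "f (cis t) * cis t / (cis t - of_real r) + g (cis t) = f (cis t) * of_real (poisson r t)" for t
  proof -
    have n1: "1 - of_real r * cis t \<noteq> 0" by (rule nz) simp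
    have n2: "cis t - of_real r \<noteq> 0"
    proof
      assume "cis t - of_real r = 0"
      hence "norm (complex_of_real r) = 1" by (metis eq_iff_diff_eq_0 norm_cis)
      thus False using r by simp
    qed
    have n3: "(1 - 2 * r * cos t + r\<^sup>2) \<noteq> 0" using poisson_denom_pos[OF r] by (metis less_irrefl)
    \<comment> \<open>Since cis t - r = cis t * (1 - r * cis (-t)), this product is cis t times the
      squared modulus of 1 - r * cis t, the denominator of the Poisson kernel.\<close>
    have "(cis t - of_real r) * (1 - of_real r * cis t) = cis t * of_real (1 - 2 * r * cos t + r\<^sup>2)"
    proof -
      have s: "sin t * sin t = 1 - cos t * cos t"
        using sin_cos_squared_add[of t] by (simp add: power2_eq_square algebra_simps)
      have "r * (sin t * sin t) = r - r * (cos t * cos t)" unfolding s by (simp add: algebra_simps)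
      then show ?thesis
        by (simp add: complex_eq_iff power2_eq_square algebra_simps)
    qed
    moreover have "cis t / (cis t - of_real r) + (of_real r * cis t) / (1 - of_real r * cis t)
       = cis t * of_real (1 - r\<^sup>2) / ((cis t - of_real r) * (1 - of_real r * cis t))"
      using n1 n2 by (simp add: field_simps power2_eq_square)
    ultimately have "cis t / (cis t - of_real r) + (of_real r * cis t) / (1 - of_real r * cis t)
        = of_real (poisson r t)"
      using n3 by (simp add: poisson_def)
    from arg_cong[OF this, of "\<lambda>x. f (cis t) * x"] show ?thesis
      by (simp add: g_def distrib_left)
  qed
  show ?thesis
    using has_integral_add[OF has_integral_Cauchy_cis[OF f, of "of_real r"] g] r by (simp add: eq)
qed

text \<open>Integration by parts turns the decreasing kernel \<open>P\<close> into an average of the means of \<open>k\<close> over \<open>[0, t]\<close>.\<close>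

lemma integral_decreasing_kernel_le:
  fixes P P' k :: "real \<Rightarrow> real"
  assumes P: "\<And>t. (P has_real_derivative P' t) (at t)" and cP: "continuous_on UNIV P'"
    and dec: "\<And>t. t \<in> {0..b} \<Longrightarrow> P' t \<le> 0" and Pb: "0 \<le> P b" and b: "0 \<le> b"
    and k: "continuous_on {0..b} k"
    and av: "\<And>t. t \<in> {0<..b} \<Longrightarrow> integral {0..t} k \<le> c * t"
  shows "integral {0..b} (\<lambda>t. P t * k t) \<le> c * integral {0..b} P"
proof -
  \<comment> \<open>\<open>A\<close> vanishes at 0 and is at most 0 by the hypothesis on the means.
    In the integrated product rule for \<open>P t * A t\<close> the boundary term is therefore at
    most 0, while \<open>P' t * A t\<close> is at least 0, which leaves the claimed sign.\<close>
  define A where "A t = integral {0..t} k - c * t" for t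
  have A': "(A has_real_derivative (k t - c)) (at t within {0..b})" if "t \<in> {0..b}" for t
    unfolding A_def using integral_has_real_derivative[OF k that]
    by (auto intro!: derivative_eq_intros)
  have A0: "A t \<le> 0" if "t \<in> {0..b}" for t
    using av[of t] that by (cases "t = 0") (auto simp: A_def)
  have contP: "continuous_on S P" for S
    by (meson P DERIV_isCont continuous_at_imp_continuous_on)
  have contP': "continuous_on S P'" for S using cP continuous_on_subset by blast
  have contA: "continuous_on {0..b} A"
    using A' by (meson DERIV_continuous_on)
  have "((\<lambda>t. P' t * A t + (k t - c) * P t) has_integral (P b * A b - P 0 * A 0)) {0..b}"
  proof (rule fundamental_theorem_of_calculus[OF b])
    fix t assume t: "t \<in> {0..b}"
    have "((\<lambda>t. P t * A t) has_real_derivative (P' t * A t + (k t - c) * P t)) (at t within {0..b})"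
      using DERIV_mult'[OF has_field_derivative_at_within[OF P] A'[OF t]] by (simp add: algebra_simps)
    thus "((\<lambda>t. P t * A t) has_vector_derivative (P' t * A t + (k t - c) * P t)) (at t within {0..b})"
      by (simp add: has_real_derivative_iff_has_vector_derivative)
  qed
  hence I: "integral {0..b} (\<lambda>t. P' t * A t + (k t - c) * P t) = P b * A b"
    by (simp add: integral_unique A_def)
  have i1: "(\<lambda>t. P' t * A t) integrable_on {0..b}"
    by (intro integrable_continuous_interval continuous_intros contP' contA)
  have i2: "(\<lambda>t. P t * k t) integrable_on {0..b}"
    by (intro integrable_continuous_interval continuous_intros contP k)
  have i3: "(\<lambda>t. c * P t) integrable_on {0..b}"
    by (intro integrable_continuous_interval continuous_intros contP)
  have "integral {0..b} (\<lambda>t. P' t * A t) \<ge> 0"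
    using dec A0 by (intro integral_nonneg i1) (auto simp: mult_nonpos_nonpos)
  moreover have "integral {0..b} (\<lambda>t. P' t * A t + (k t - c) * P t)
     = integral {0..b} (\<lambda>t. P' t * A t) + (integral {0..b} (\<lambda>t. P t * k t) - integral {0..b} (\<lambda>t. c * P t))"
  proof -
    have "(\<lambda>t. P' t * A t + (k t - c) * P t) = (\<lambda>t. P' t * A t + (P t * k t - c * P t))"
      by (simp add: algebra_simps)
    then show ?thesis
      using Henstock_Kurzweil_Integration.integral_add[OF i1 integrable_diff[OF i2 i3]]
        Henstock_Kurzweil_Integration.integral_diff[OF i2 i3] by simp
  qed
  moreover have "P b * A b \<le> 0" using Pb A0[of b] b by (simp add: mult_nonneg_nonpos)
  ultimately show ?thesis using I by simp
qed

section \<open>Domination by arc averages and the weak type estimate\<close>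

lemma integral_sym_interval:
  fixes g :: "real \<Rightarrow> real"
  assumes g: "continuous_on UNIV g" and t: "0 \<le> t"
  shows "integral {\<theta> - t..\<theta> + t} g = integral {0..t} (\<lambda>s. g (\<theta> + s) + g (\<theta> - s))"
proof -
  have cs: "continuous_on S g" for S using g continuous_on_subset by blast
  have gi: "g integrable_on {a..b}" for a b by (intro integrable_continuous_interval cs)
  have c1: "continuous_on S (\<lambda>s. g (\<theta> + s))" "continuous_on S (\<lambda>s. g (\<theta> - s))" for S
    by (rule continuous_on_compose2[OF g]; auto intro!: continuous_intros)+
  have "(g has_integral integral {\<theta>..\<theta>+t} g) (cbox \<theta> (\<theta>+t))"
    using gi by (simp add: integrable_integral)
  from has_integral_affinity[OF this, of 1 "\<theta>"]
  have 1: "((\<lambda>s. g (\<theta> + s)) has_integral integral {\<theta>..\<theta>+t} g) {0..t}"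
    using t by (simp add: add.commute algebra_simps)
  have "(g has_integral integral {\<theta>-t..\<theta>} g) (cbox (\<theta>-t) \<theta>)"
    using gi by (simp add: integrable_integral)
  from has_integral_affinity[OF this, of "-1" "\<theta>"]
  have 2: "((\<lambda>s. g (\<theta> - s)) has_integral integral {\<theta>-t..\<theta>} g) {0..t}"
    using t by (simp add: add.commute algebra_simps)
  show ?thesis
    using integral_unique[OF has_integral_add[OF 1 2]]
      Henstock_Kurzweil_Integration.integral_combine[OF _ _ gi, of "\<theta>-t" \<theta> "\<theta>+t"] t by simp
qed

text \<open>After a rotation the point lies on the positive real axis. The Poisson integral, folded
  about pi, lives on [0, pi], where the kernel decreases; it is then at most the bound 2 c for the
  means of the folded function times the integral pi of the kernel.\<close>

lemma norm_le_of_arc_averages: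
  fixes f :: "complex \<Rightarrow> complex"
  assumes f: "continuous_on (cball 0 1) f" "f holomorphic_on ball 0 1" and r: "0 \<le> r" "r < 1"
    and av: "\<And>t. t \<in> {0<..pi} \<Longrightarrow> integral {\<theta> - t..\<theta> + t} (\<lambda>s. norm (f (cis s))) \<le> 2 * t * c"
  shows "norm (f (of_real r * cis \<theta>)) \<le> c"
proof -
  define P where "P = poisson r"
  define P' where "P' t = - ((1 - r\<^sup>2) * (2 * r * sin t)) / (1 - 2 * r * cos t + r\<^sup>2)\<^sup>2" for t
  define g where "g s = norm (f (cis s))" for s
  have dpos: "1 - 2 * r * cos t + r\<^sup>2 > 0" for t by (rule poisson_denom_pos[OF r])
  have r2: "r\<^sup>2 < 1" using r by (simp add: power_less_one_iff)
  have dP: "(P has_real_derivative P' t) (at t)" for t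
    unfolding P_def P'_def poisson_def using dpos[of t]
    by (auto intro!: derivative_eq_intros simp: power2_eq_square field_simps)
  have contP: "continuous_on S P" for S
    by (meson dP DERIV_isCont continuous_at_imp_continuous_on)
  have contP': "continuous_on UNIV P'" unfolding P'_def using dpos
    by (intro continuous_intros) (metis less_irrefl zero_eq_power2)
  have Pnn: "0 \<le> P t" for t using dpos[of t] r2 by (simp add: P_def poisson_def)
  have dec: "P' t \<le> 0" if "t \<in> {0..pi}" for t
    using that r r2 sin_ge_zero[of t] by (auto simp: P'_def intro!: divide_nonneg_nonneg)
  have contg: "continuous_on UNIV g" unfolding g_def
    by (intro continuous_intros continuous_on_compose2[OF f(1)]) auto
  define k where "k s = g (\<theta> + s) + g (\<theta> - s)" for s
  have contgs: "continuous_on S (\<lambda>s. g (\<theta> + s))" "continuous_on S (\<lambda>s. g (\<theta> - s))" for S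
    by (rule continuous_on_compose2[OF contg]; auto intro!: continuous_intros)+
  have contk: "continuous_on {0..pi} k" unfolding k_def by (intro continuous_intros contgs)
  \<comment> \<open>Folding about pi uses only that the kernel takes the same value at t and at 2 pi
    - t.\<close>
  have sym: "integral {0..2*pi} (\<lambda>t. u t * P t) = integral {0..pi} (\<lambda>t. P t * (u t + u (2*pi - t)))"
    if u: "continuous_on UNIV u" for u :: "real \<Rightarrow> real"
  proof -
    have "integral {0..2*pi} (\<lambda>t. u t * P t) = integral {pi - pi..pi + pi} (\<lambda>t. u t * P t)" by simp
    also have "\<dots> = integral {0..pi} (\<lambda>s. u (pi + s) * P (pi + s) + u (pi - s) * P (pi - s))"
      by (rule integral_sym_interval) (auto intro!: continuous_intros u contP)
    also have "\<dots> = integral {0..pi} (\<lambda>s. P (pi - s) * (u (pi - s) + u (2 * pi - (pi - s))))"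
    proof (rule integral_cong)
      fix s
      have "P (pi + s) = P (pi - s)" "2 * pi - (pi - s) = pi + s" by (simp_all add: P_def poisson_def)
      then show "u (pi + s) * P (pi + s) + u (pi - s) * P (pi - s)
        = P (pi - s) * (u (pi - s) + u (2 * pi - (pi - s)))" by (simp add: algebra_simps)
    qed
    also have "\<dots> = integral {0..pi} (\<lambda>t. P t * (u t + u (2*pi - t)))"
    proof -
      define v where "v t = P t * (u t + u (2*pi - t))" for t
      have cv: "continuous_on {0..pi} v" unfolding v_def
        by (intro continuous_intros contP continuous_on_compose2[OF u]) auto
      have "(v has_integral integral {0..pi} v) (cbox 0 pi)"
        using integrable_continuous_interval[OF cv] by (simp add: integrable_integral)
      from has_integral_affinity[OF this, of "-1" pi]
      have "((\<lambda>s. v (pi - s)) has_integral integral {0..pi} v) {0..pi}" by simp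
      hence "integral {0..pi} (\<lambda>s. v (pi - s)) = integral {0..pi} v" by (rule integral_unique)
      thus ?thesis unfolding v_def .
    qed
    finally show ?thesis .
  qed
  have "integral {0..pi} P = pi"
  proof -
    have "((\<lambda>t. of_real (P t)) has_integral (complex_of_real (2 * pi))) {0..2*pi}"
      using has_integral_poisson[of "\<lambda>_. 1" r] r by (simp add: P_def)
    from has_integral_Re[OF this] have "integral {0..2*pi} P = 2 * pi"
      by (simp add: integral_unique)
    with sym[of "\<lambda>_. 1"] show ?thesis by simp
  qed
  moreover have "integral {0..pi} (\<lambda>t. P t * k t) \<le> (2 * c) * integral {0..pi} P"
  proof (rule integral_decreasing_kernel_le[OF dP contP' dec Pnn _ contk])
    fix t assume t: "t \<in> {0<..pi}"
    show "integral {0..t} k \<le> 2 * c * t"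
      using av[OF t] integral_sym_interval[OF contg, of t \<theta>] t
      by (simp add: k_def[abs_def] g_def[abs_def] mult.commute mult.left_commute)
  qed auto
  moreover have "2 * pi * norm (f (of_real r * cis \<theta>)) \<le> integral {0..pi} (\<lambda>t. P t * k t)"
  proof -
    \<comment> \<open>The rotation by \<theta>, which moves the point under study to
      \<open>of_real r\<close>.\<close>
    define F where "F z = f (cis \<theta> * z)" for z
    have "continuous_on (cball 0 1) F" unfolding F_def
      by (rule continuous_on_compose2[OF f(1)]) (auto intro!: continuous_intros simp: norm_mult)
    moreover have "F holomorphic_on ball 0 1"
      unfolding F_def
      by (rule holomorphic_on_compose_gen[OF _ f(2), unfolded o_def])
         (auto intro!: holomorphic_intros simp: norm_mult)
    ultimately have hF: "((\<lambda>t. F (cis t) * of_real (P t)) has_integral (2 * pi * F (of_real r))) {0..2*pi}"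
      using has_integral_poisson r by (simp add: P_def)
    have Fc: "norm (F (cis t)) = g (\<theta> + t)" for t by (simp add: F_def g_def cis_mult)
    have "norm (integral {0..2*pi} (\<lambda>t. F (cis t) * of_real (P t))) \<le> integral {0..2*pi} (\<lambda>t. g (\<theta> + t) * P t)"
    proof (rule integral_norm_bound_integral)
      show "(\<lambda>t. F (cis t) * of_real (P t)) integrable_on {0..2*pi}" using hF by blast
      show "(\<lambda>t. g (\<theta> + t) * P t) integrable_on {0..2*pi}"
        by (intro integrable_continuous_interval continuous_intros contP contgs)
    qed (use Pnn in \<open>simp add: norm_mult Fc\<close>)
    also have "\<dots> = integral {0..pi} (\<lambda>t. P t * k t)"
    proof -
      have "g (\<theta> + (2*pi - t)) = g (\<theta> - t)" for t
      proof -
        have "cis (\<theta> + (2*pi - t)) = cis (\<theta> - t) * cis (2 * pi)" by (simp add: cis_mult algebra_simps)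
        thus ?thesis by (simp add: g_def)
      qed
      with sym[OF contgs(1)] show ?thesis by (simp add: k_def)
    qed
    finally show ?thesis using hF by (simp add: integral_unique norm_mult F_def mult.commute)
  qed
  ultimately have "2 * pi * norm (f (of_real r * cis \<theta>)) \<le> 2 * pi * c" by (simp only: mult_ac)
  thus ?thesis by (rule mult_left_le_imp_le) simp
qed

text \<open>Vitali covering: among the intervals that witness membership in \<open>E\<close> there
  are disjoint ones whose fivefold enlargements cover \<open>E\<close>. An enlargement has length 10
  r, at most 5 / c times the integral of \<open>k\<close> over the original interval. These
  intervals lie in [-pi, 3 pi], two periods of \<open>k\<close>, which turns 5 / c into 10 / c.
  Measurability of \<open>E\<close> itself is bypassed by the measurable cover
  \<open>B\<close>.\<close>

lemma maximal_weak_type: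
  fixes k :: "real \<Rightarrow> real"
  assumes k: "continuous_on UNIV k" "\<And>s. 0 \<le> k s" "\<And>s. k (s + 2 * pi) = k s" and c: "0 < c"
  defines "E \<equiv> {\<theta> \<in> {0..2*pi}. \<exists>t\<in>{0<..pi}. 2 * t * c < integral {\<theta> - t..\<theta> + t} k}"
  obtains B where "B \<in> lmeasurable" "E \<subseteq> B" "measure lebesgue B \<le> 10 / c * integral {0..2*pi} k"
proof -
  have ki: "k integrable_on {a..b}" for a b
    by (intro integrable_continuous_interval continuous_on_subset[OF k(1)]) auto
  obtain r where r: "\<And>\<theta>. \<theta> \<in> E \<Longrightarrow> r \<theta> \<in> {0<..pi} \<and> 2 * r \<theta> * c < integral {\<theta> - r \<theta>..\<theta> + r \<theta>} k"
  proof -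
    have "\<forall>\<theta>\<in>E. \<exists>t. t \<in> {0<..pi} \<and> 2 * t * c < integral {\<theta> - t..\<theta> + t} k"
      unfolding E_def by blast
    then show thesis using that by metis
  qed
  obtain C where C: "countable C" "C \<subseteq> E"
    "pairwise (\<lambda>i j. disjnt (cball i (r i)) (cball j (r j))) C"
    "E \<subseteq> (\<Union>i\<in>C. cball i (5 * r i))"
  proof (rule Vitali_covering_lemma_cballs[of E "\<lambda>x. x" r E pi])
    show "E \<subseteq> (\<Union>i\<in>E. cball i (r i))" using r by force
  qed (use r in auto)
  have period: "integral {a + 2 * pi..b + 2 * pi} k = integral {a..b} k" for a b
  proof -
    have "(k has_integral integral {a + 2*pi..b + 2*pi} k) (cbox (a + 2*pi) (b + 2*pi))"
      using ki by (simp add: integrable_integral)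
    from has_integral_affinity[OF this, of 1 "2*pi"] show ?thesis
      by (simp add: k(3) integral_unique)
  qed
  have tot: "integral {-pi..3*pi} k = 2 * integral {0..2*pi} k"
  proof -
    have "integral {-pi..3*pi} k = integral {-pi..0} k + integral {0..3*pi} k"
      using Henstock_Kurzweil_Integration.integral_combine[OF _ _ ki, of "-pi" 0 "3*pi"] by simp
    also have "integral {0..3*pi} k = integral {0..2*pi} k + integral {2*pi..3*pi} k"
      using Henstock_Kurzweil_Integration.integral_combine[OF _ _ ki, of 0 "2*pi" "3*pi"] by simp
    also have "integral {2*pi..3*pi} k = integral {0..pi} k" using period[of 0 pi] by simp
    also have "integral {-pi..0} k = integral {pi..2*pi} k" using period[of "-pi" 0] by simp
    finally show ?thesis
      using Henstock_Kurzweil_Integration.integral_combine[OF _ _ ki, of 0 pi "2*pi"] by simp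
  qed
  \<comment> \<open>A bound that is uniform over finite subfamilies carries over to the countable
    union.\<close>
  have bound: "measure lebesgue (\<Union>i\<in>F. cball i (5 * r i)) \<le> 10 / c * integral {0..2*pi} k"
    if F: "F \<subseteq> C" "finite F" for F
  proof -
    have rF: "r i > 0" "r i \<le> pi" "2 * r i * c \<le> integral {i - r i..i + r i} k" "i \<in> {0..2*pi}" if "i \<in> F" for i
    proof -
      have "i \<in> E" using that F C(2) by blast
      with r[OF this] show "r i > 0" "r i \<le> pi" "2 * r i * c \<le> integral {i - r i..i + r i} k" "i \<in> {0..2*pi}"
        by (simp_all add: E_def)
    qed
    have cb: "cball i (r i) = {i - r i..i + r i}" for i by (simp add: cball_eq_atLeastAtMost)
    have kU: "(\<Sum>i\<in>F. integral {i - r i..i + r i} k) = integral (\<Union>i\<in>F. {i - r i..i + r i}) k"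
       "k integrable_on (\<Union>i\<in>F. {i - r i..i + r i})"
    proof -
      have "(k has_integral (\<Sum>i\<in>F. integral {i - r i..i + r i} k)) (\<Union>i\<in>F. {i - r i..i + r i})"
      proof (rule has_integral_UN[OF F(2)])
        show "pairwise (\<lambda>i j. negligible ({i - r i..i + r i} \<inter> {j - r j..j + r j})) F"
          using pairwise_subset[OF C(3) F(1)] by (auto simp: pairwise_def disjnt_def cb)
      qed (use ki in \<open>auto simp: integrable_integral\<close>)
      thus "(\<Sum>i\<in>F. integral {i - r i..i + r i} k) = integral (\<Union>i\<in>F. {i - r i..i + r i}) k"
       "k integrable_on (\<Union>i\<in>F. {i - r i..i + r i})" by (simp_all add: integral_unique has_integral_integrable)
    qed
    have "measure lebesgue (\<Union>i\<in>F. cball i (5 * r i)) \<le> (\<Sum>i\<in>F. measure lebesgue (cball i (5 * r i)))"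
      using F(2) by (intro measure_UNION_le) auto
    also have "\<dots> = (\<Sum>i\<in>F. 10 * r i)"
      using rF by (intro sum.cong) (auto simp: cball_eq_atLeastAtMost less_imp_le)
    also have "\<dots> \<le> (\<Sum>i\<in>F. 5 / c * integral {i - r i..i + r i} k)"
      using rF(3) c by (intro sum_mono) (simp add: field_simps)
    also have "\<dots> = 5 / c * (\<Sum>i\<in>F. integral {i - r i..i + r i} k)"
      by (simp add: sum_distrib_left)
    also have "\<dots> \<le> 5 / c * integral {-pi..3*pi} k"
    proof (rule mult_left_mono)
      have "(\<Union>i\<in>F. {i - r i..i + r i}) \<subseteq> {- pi..3 * pi}"
        using rF by fastforce
      thus "(\<Sum>i\<in>F. integral {i - r i..i + r i} k) \<le> integral {-pi..3*pi} k"
        unfolding kU(1) using k ki kU(2) by (intro integral_subset_le) auto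
    qed (use c in auto)
    finally show ?thesis by (simp add: tot)
  qed
  show ?thesis
  proof
    show "(\<Union>i\<in>C. cball i (5 * r i)) \<in> lmeasurable"
      by (rule fmeasurable_UN_bound[OF C(1) _ bound]) auto
    show "measure lebesgue (\<Union>i\<in>C. cball i (5 * r i)) \<le> 10 / c * integral {0..2*pi} k"
      by (rule measure_UN_bound[OF C(1) _ bound]) auto
  qed (use C in auto)
qed

text \<open>If |f| exceeds \<open>c\<close> somewhere on a radius, then by
  \<open>norm_le_of_arc_averages\<close> some symmetric arc around its end point has mean above
  \<open>c\<close>.\<close>

lemma radial_maximal_weak_type:
  fixes f :: "complex \<Rightarrow> complex"
  assumes f: "continuous_on (cball 0 1) f" "f holomorphic_on ball 0 1" and c: "0 < c"
  obtains B where "B \<in> lmeasurable"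
    "{\<theta> \<in> {0..2*pi}. \<exists>r\<in>{0..<1}. c < norm (f (of_real r * cis \<theta>))} \<subseteq> B"
    "measure lebesgue B \<le> 10 / c * integral {0..2*pi} (\<lambda>s. norm (f (cis s)))"
proof -
  have "continuous_on UNIV (\<lambda>s. norm (f (cis s)))"
    by (intro continuous_intros continuous_on_compose2[OF f(1)]) auto
  moreover have "norm (f (cis (s + 2 * pi))) = norm (f (cis s))" for s
  proof -
    have "cis (s + 2 * pi) = cis s * cis (2 * pi)" by (rule cis_mult[symmetric])
    thus ?thesis by simp
  qed
  ultimately obtain B where B: "B \<in> lmeasurable"
    "{\<theta> \<in> {0..2*pi}. \<exists>t\<in>{0<..pi}. 2 * t * c < integral {\<theta> - t..\<theta> + t} (\<lambda>s. norm (f (cis s)))} \<subseteq> B"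
    "measure lebesgue B \<le> 10 / c * integral {0..2*pi} (\<lambda>s. norm (f (cis s)))"
    using maximal_weak_type[of "\<lambda>s. norm (f (cis s))" c, OF _ norm_ge_zero _ c] by blast
  show ?thesis
  proof (rule that[OF B(1) order.trans[OF _ B(2)] B(3)], safe)
    fix \<theta> r assume "\<theta> \<in> {0..2*pi}" "r \<in> {0..<1::real}" "c < norm (f (of_real r * cis \<theta>))"
    thus "\<exists>t\<in>{0<..pi}. 2 * t * c < integral {\<theta> - t..\<theta> + t} (\<lambda>s. norm (f (cis s)))"
      using norm_le_of_arc_averages[OF f, of r \<theta> c] by force
  qed
qed

section \<open>Herglotz integrals of square integrable functions\<close>

lemma space_circ [simp]: "space circ = {0..2*pi}"
  by (simp add: circ_def)

lemma finite_measure_circ: "finite_measure circ"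
  unfolding circ_def by (intro finite_measureI) (simp add: emeasure_restrict_space)

interpretation circ: finite_measure circ
  by (rule finite_measure_circ)

lemma measure_circ: "measure circ (space circ) = 2 * pi"
  by (simp add: circ_def measure_restrict_space)

lemma continuous_circ:
  fixes f :: "real \<Rightarrow> 'a::euclidean_space"
  assumes "continuous_on {0..2*pi} f"
  shows "integrable circ f" "integral\<^sup>L circ f = integral {0..2*pi} f"
proof -
  show 1: "integrable circ f"
    using continuous_imp_integrable[of 0 "2*pi" f] assms by (simp add: circ_def)
  show "integral\<^sup>L circ f = integral {0..2*pi} f"
    using lebesgue_integral_eq_integral[of "{0..2*pi}" f] 1 by (simp add: circ_def)
qed

lemma integral_circ_cis_power: "integral\<^sup>L circ (\<lambda>t. cis t ^ n) = (if n = 0 then 2 * pi else 0)"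
proof -
  have "((\<lambda>t. cis t ^ n) has_integral (2 * pi * (0::complex) ^ n)) {0..2*pi}"
    by (rule has_integral_mean_value_cis) (auto intro!: continuous_intros holomorphic_intros)
  thus ?thesis
    by (subst continuous_circ) (auto intro!: continuous_intros simp: integral_unique power_0_left)
qed

lemma integral_circ_cis_power_cnj:
  "integral\<^sup>L circ (\<lambda>t. cis t ^ j * cnj (cis t ^ k)) = (if j = k then 2 * pi else 0)"
proof -
  have *: "integral\<^sup>L circ (\<lambda>t. cis t ^ j * cnj (cis t ^ k)) = (if j = k then 2 * pi else 0)" if "k \<le> j" for j k
  proof -
    have "cis t ^ j * cnj (cis t ^ k) = cis t ^ (j - k)" for t
    proof -
      have "cis t ^ j * cnj (cis t ^ k) = cis t ^ (j - k) * (cis t ^ k * cnj (cis t ^ k))"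
        using that by (simp add: power_add[symmetric] mult.assoc[symmetric])
      also have "cis t ^ k * cnj (cis t ^ k) = 1"
        by (simp add: cis_cnj power_mult_distrib[symmetric] cis_mult)
      finally show ?thesis by simp
    qed
    thus ?thesis using integral_circ_cis_power[of "j - k"] that by auto
  qed
  show ?thesis
  proof (cases "k \<le> j")
    case False
    have "integral\<^sup>L circ (\<lambda>t. cis t ^ j * cnj (cis t ^ k)) = integral\<^sup>L circ (\<lambda>t. cnj (cis t ^ k * cnj (cis t ^ j)))"
      by (simp add: mult.commute)
    also have "\<dots> = cnj (integral\<^sup>L circ (\<lambda>t. cis t ^ k * cnj (cis t ^ j)))"
      by (rule Bochner_Integration.integral_cnj)
    finally show ?thesis using *[of j k] False by simp
  qed (rule *)
qed

text \<open>Parseval's identity for finite sums: expand the square and use the orthogonality of the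
  powers of \<open>cis t\<close>.\<close>

lemma integral_norm_sum_cis:
  "integral\<^sup>L circ (\<lambda>t. (norm (\<Sum>k<N. a k * cis t ^ k))\<^sup>2) = 2 * pi * (\<Sum>k<N. (norm (a k))\<^sup>2)"
proof -
  have int: "integrable circ (\<lambda>t. (a j * cnj (a k)) * (cis t ^ j * cnj (cis t ^ k)))" for j k
    by (intro continuous_circ continuous_intros)
  have "of_real (integral\<^sup>L circ (\<lambda>t. (norm (\<Sum>k<N. a k * cis t ^ k))\<^sup>2))
     = integral\<^sup>L circ (\<lambda>t. complex_of_real ((norm (\<Sum>k<N. a k * cis t ^ k))\<^sup>2))"
    by (rule integral_complex_of_real[symmetric])
  also have "\<dots> = integral\<^sup>L circ (\<lambda>t. \<Sum>j<N. \<Sum>k<N. (a j * cnj (a k)) * (cis t ^ j * cnj (cis t ^ k)))"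
    by (intro Bochner_Integration.integral_cong refl, simp only: complex_norm_square cnj_sum sum_product complex_cnj_mult)
      (intro sum.cong refl, simp)
  also have "\<dots> = (\<Sum>j<N. \<Sum>k<N. (a j * cnj (a k)) * integral\<^sup>L circ (\<lambda>t. cis t ^ j * cnj (cis t ^ k)))"
    by (simp only: Bochner_Integration.integral_sum[OF Bochner_Integration.integrable_sum[OF int]]
        Bochner_Integration.integral_sum[OF int] Bochner_Integration.integral_mult_right_zero)
  also have "\<dots> = (\<Sum>j<N. 2 * pi * (a j * cnj (a j)))"
    unfolding integral_circ_cis_power_cnj
    by (intro sum.cong refl) (simp add: if_distrib sum.delta' cong: if_cong)
  also have "\<dots> = of_real (2 * pi * (\<Sum>k<N. (norm (a k))\<^sup>2))"
    by (simp add: sum_distrib_left complex_norm_square[symmetric])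
  finally show ?thesis by (simp only: of_real_eq_iff)
qed

text \<open>The weak type bound involves the integral of |f|. The inequality x \<le> \<sigma> / 2 +
  x^2 / (2 \<sigma>) together with Parseval bounds this integral by 2 pi \<sigma>.\<close>

lemma radial_maximal_polynomial:
  fixes a :: "nat \<Rightarrow> complex"
  assumes a: "(\<Sum>k<N. (norm (a k))\<^sup>2) \<le> \<sigma>\<^sup>2" and \<sigma>: "0 < \<sigma>" and c: "0 < c"
  obtains B where "B \<in> lmeasurable"
    "{\<theta> \<in> {0..2*pi}. \<exists>r\<in>{0..<1}. c < norm (\<Sum>k<N. a k * (of_real r * cis \<theta>) ^ k)} \<subseteq> B"
    "measure lebesgue B \<le> 20 * pi * \<sigma> / c"
proof -
  define f where "f z = (\<Sum>k<N. a k * z ^ k)" for z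
  have f: "continuous_on S f" "f holomorphic_on S" for S
    unfolding f_def by (auto intro!: continuous_intros holomorphic_intros)
  obtain B where B: "B \<in> lmeasurable"
    "{\<theta> \<in> {0..2*pi}. \<exists>r\<in>{0..<1}. c < norm (f (of_real r * cis \<theta>))} \<subseteq> B"
    "measure lebesgue B \<le> 10 / c * integral {0..2*pi} (\<lambda>s. norm (f (cis s)))"
    using radial_maximal_weak_type[OF f(1) f(2) c] .
  have cf: "continuous_on S (\<lambda>s. f (cis s))" for S
    unfolding f_def by (auto intro!: continuous_intros)
  have "integral {0..2*pi} (\<lambda>s. norm (f (cis s))) = integral\<^sup>L circ (\<lambda>s. norm (f (cis s)))"
    by (intro continuous_circ(2)[symmetric] continuous_intros cf)
  also have "\<dots> \<le> integral\<^sup>L circ (\<lambda>s. \<sigma> / 2 + (norm (f (cis s)))\<^sup>2 / (2 * \<sigma>))"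
  proof (rule integral_mono)
    fix s
    have "0 \<le> (norm (f (cis s)) - \<sigma>)\<^sup>2" by simp
    thus "norm (f (cis s)) \<le> \<sigma> / 2 + (norm (f (cis s)))\<^sup>2 / (2 * \<sigma>)"
      using \<sigma> by (simp add: field_simps power2_eq_square)
  qed (use \<sigma> in \<open>auto intro!: continuous_circ(1) continuous_intros cf\<close>)
  also have "\<dots> = integral\<^sup>L circ (\<lambda>s. \<sigma> / 2) + integral\<^sup>L circ (\<lambda>s. (norm (f (cis s)))\<^sup>2 / (2 * \<sigma>))"
    by (intro Bochner_Integration.integral_add continuous_circ(1) continuous_intros cf)
       (use \<sigma> in auto)
  also have "\<dots> = pi * \<sigma> + 2 * pi * (\<Sum>k<N. (norm (a k))\<^sup>2) / (2 * \<sigma>)"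
    using integral_norm_sum_cis[where a = a and N = N] measure_circ by (simp add: f_def)
  also have "\<dots> \<le> pi * \<sigma> + 2 * pi * \<sigma>\<^sup>2 / (2 * \<sigma>)"
    using a \<sigma> by (intro add_left_mono divide_right_mono mult_left_mono) auto
  also have "\<dots> = 2 * pi * \<sigma>" using \<sigma> by (simp add: power2_eq_square)
  finally have "10 / c * integral {0..2*pi} (\<lambda>s. norm (f (cis s))) \<le> 10 / c * (2 * pi * \<sigma>)"
    using c by (intro mult_left_mono) auto
  with B(3) have "measure lebesgue B \<le> 20 * pi * \<sigma> / c" by simp
  from that[OF B(1) B(2)[unfolded f_def] this] show ?thesis .
qed

text \<open>Covering by the lower limit of the exceptional sets of the partial sums avoids any maximal
  inequality for infinite series.\<close>

lemma radial_maximal_series: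
  fixes a :: "nat \<Rightarrow> complex"
  assumes a: "\<And>N. (\<Sum>k<N. (norm (a k))\<^sup>2) \<le> \<sigma>\<^sup>2" and \<sigma>: "0 < \<sigma>" and c: "0 < c"
    and f: "\<And>z. norm z < 1 \<Longrightarrow> (\<lambda>k. a k * z ^ k) sums f z"
  obtains B where "B \<in> lmeasurable"
    "{\<theta> \<in> {0..2*pi}. \<exists>r\<in>{0..<1}. c < norm (f (of_real r * cis \<theta>))} \<subseteq> B"
    "measure lebesgue B \<le> 20 * pi * \<sigma> / c"
proof -
  define P where "P N B \<longleftrightarrow> B \<in> lmeasurable \<and>
      {\<theta> \<in> {0..2*pi}. \<exists>r\<in>{0..<1}. c < norm (\<Sum>k<N. a k * (of_real r * cis \<theta>) ^ k)} \<subseteq> B \<and>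
      measure lebesgue B \<le> 20 * pi * \<sigma> / c" for N B
  define B where "B N = (SOME B. P N B)" for N
  have "P N (B N)" for N
    unfolding B_def P_def
    by (rule someI_ex, rule radial_maximal_polynomial[OF a \<sigma> c, of N]) blast
  then have B: "\<And>N. B N \<in> lmeasurable"
    "\<And>N. {\<theta> \<in> {0..2*pi}. \<exists>r\<in>{0..<1}. c < norm (\<Sum>k<N. a k * (of_real r * cis \<theta>) ^ k)} \<subseteq> B N"
    "\<And>N. measure lebesgue (B N) \<le> 20 * pi * \<sigma> / c"
    by (simp_all only: P_def)
  \<comment> \<open>The increasing union of the \<open>D m\<close> is the lower limit of the
    exceptional sets. As \<open>D 0\<close>, ..., \<open>D m\<close> all lie inside
    \<open>B m\<close>, finite unions inherit the bound for a single set.\<close>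
  define D where "D m = (\<Inter>N\<in>{m..}. B N)" for m
  have D: "D m \<in> lmeasurable" for m
    unfolding D_def by (rule fmeasurable_INT[of _ m]) (use B(1) in \<open>auto simp: fmeasurableD\<close>)
  have "(\<Union>i\<le>m. D i) \<subseteq> B m" for m by (auto simp: D_def)
  hence "measure lebesgue (\<Union>i\<le>m. D i) \<le> measure lebesgue (B m)" for m
    using B(1) D by (intro measure_mono_fmeasurable sets.finite_UN) (auto simp: fmeasurableD)
  hence mD: "measure lebesgue (\<Union>i\<le>m. D i) \<le> 20 * pi * \<sigma> / c" for m using B(3) order.trans by blast
  show ?thesis
  proof
    show "(\<Union>m. D m) \<in> lmeasurable" by (rule fmeasurable_countable_Union[OF D mD])
    show "measure lebesgue (\<Union>m. D m) \<le> 20 * pi * \<sigma> / c" by (rule measure_countable_Union_le[OF D mD])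
    show "{\<theta> \<in> {0..2*pi}. \<exists>r\<in>{0..<1}. c < norm (f (of_real r * cis \<theta>))} \<subseteq> (\<Union>m. D m)"
    proof safe
      fix \<theta> r assume \<theta>: "\<theta> \<in> {0..2*pi}" and r: "r \<in> {0..<1::real}" and gt: "c < norm (f (of_real r * cis \<theta>))"
      have "(\<lambda>N. norm (\<Sum>k<N. a k * (of_real r * cis \<theta>) ^ k)) \<longlonglongrightarrow> norm (f (of_real r * cis \<theta>))"
        using f[of "of_real r * cis \<theta>"] r by (intro tendsto_norm) (simp add: sums_def norm_mult)
      from order_tendstoD(1)[OF this gt] obtain m where
        "\<And>N. N \<ge> m \<Longrightarrow> c < norm (\<Sum>k<N. a k * (of_real r * cis \<theta>) ^ k)"
        by (auto simp: eventually_sequentially)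
      hence "\<theta> \<in> B N" if "N \<ge> m" for N using B(2)[of N] \<theta> r that by blast
      hence "\<theta> \<in> D m" by (simp add: D_def)
      thus "\<theta> \<in> (\<Union>m. D m)" by blast
    qed
  qed
qed

text \<open>For unimodular \<xi> the kernel equals (\<xi> + z) / (\<xi> - z), whose real part is the
  Poisson kernel. With log (sqrt w) as \<open>G\<close> this is the exponent of the Szego
  function.\<close>

definition herglotz :: "(real \<Rightarrow> real) \<Rightarrow> complex \<Rightarrow> complex" where
  "herglotz G z = 1 / (2 * pi) *
     (\<integral>\<theta>. (1 + cnj (cis \<theta>) * z) / (1 - cnj (cis \<theta>) * z) * of_real (G \<theta>) \<partial>circ)"

text \<open>These are the Taylor coefficients of \<open>herglotz G\<close> at 0: the expansion (1 +
  u) / (1 - u) = 1 + 2 u + 2 u^2 + ... produces the mean of \<open>G\<close> for k = 0 and twice a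
  Fourier coefficient for k > 0.\<close>

definition herglotz_coeff :: "(real \<Rightarrow> real) \<Rightarrow> nat \<Rightarrow> complex" where
  "herglotz_coeff G k = (if k = 0 then 1 else 2) / (2 * pi) * (\<integral>\<theta>. cnj (cis \<theta> ^ k) * of_real (G \<theta>) \<partial>circ)"

lemma borel_measurable_circ_continuous:
  fixes f :: "real \<Rightarrow> 'a::euclidean_space"
  shows "continuous_on UNIV f \<Longrightarrow> f \<in> borel_measurable circ"
  by (rule borel_measurable_integrable, rule continuous_circ(1), rule continuous_on_subset) auto

lemma integrable_circ_mult_bounded:
  fixes f :: "real \<Rightarrow> complex"
  assumes "continuous_on UNIV f" "\<And>t. norm (f t) \<le> C" "integrable circ G"
  shows "integrable circ (\<lambda>t. f t * of_real (G t))"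
proof (rule Bochner_Integration.integrable_bound)
  show "integrable circ (\<lambda>t. C * norm (G t))" using assms(3) by simp
  show "(\<lambda>t. f t * of_real (G t)) \<in> borel_measurable circ"
    using borel_measurable_circ_continuous[OF assms(1)] assms(3) by measurable
  have "0 \<le> C" using assms(2) norm_ge_zero order.trans by blast
  thus "AE t in circ. norm (f t * of_real (G t)) \<le> norm (C * norm (G t))"
    using assms(2) by (auto simp: norm_mult abs_mult intro!: mult_right_mono)
qed

text \<open>The kernel is expanded in a geometric series and integrated term by term; the k-th term
  is dominated by 2 * |z|^k * |G|, which is summable in L1.\<close>

lemma herglotz_sums:
  assumes G: "integrable circ G" and z: "norm z < 1"
  shows "(\<lambda>k. herglotz_coeff G k * z ^ k) sums herglotz G z"
proof -
  define e where "e k = (if k = 0 then 1 else 2 :: complex)" for k :: nat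
  define f where "f k t = e k * (cnj (cis t) * z) ^ k * of_real (G t)" for k t
  have int: "integrable circ (f k)" for k
    unfolding f_def
  proof (rule integrable_circ_mult_bounded[OF _ _ G])
    show "norm (e k * (cnj (cis t) * z) ^ k) \<le> norm (e k * z ^ k)" for t
      by (simp add: norm_mult norm_power)
  qed (intro continuous_intros)
  have nf: "norm (f k t) \<le> 2 * norm z ^ k * \<bar>G t\<bar>" for k t
    by (simp add: f_def e_def norm_mult norm_power mult_right_mono)
  have sums: "(\<lambda>k. f k t) sums ((1 + cnj (cis t) * z) / (1 - cnj (cis t) * z) * of_real (G t))" for t
  proof -
    define u where "u = cnj (cis t) * z"
    have u: "norm u < 1" using z by (simp add: u_def norm_mult)
    hence u1: "1 - u \<noteq> 0" by auto
    have "(\<lambda>k. 2 * u ^ k - (if k = 0 then 1 else 0)) sums (2 * (1 / (1 - u)) - 1)"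
      by (intro sums_diff sums_mult geometric_sums u sums_single)
    also have "(\<lambda>k. 2 * u ^ k - (if k = 0 then 1 else 0)) = (\<lambda>k. e k * u ^ k)" by (auto simp: e_def)
    also have "2 * (1 / (1 - u)) - 1 = (1 + u) / (1 - u)" using u1 by (simp add: field_simps)
    finally show ?thesis unfolding f_def u_def by (rule sums_mult2)
  qed
  have sn: "summable (\<lambda>k. 2 * norm z ^ k * c)" for c :: real
    using z by (intro summable_mult summable_mult2 summable_geometric) simp
  have "(\<lambda>k. integral\<^sup>L circ (f k)) sums (\<integral>t. (\<Sum>k. f k t) \<partial>circ)"
  proof (rule sums_integral[OF int])
    show "AE t in circ. summable (\<lambda>k. norm (f k t))"
      by (intro always_eventually allI summable_comparison_test'[OF sn, of 0]) (use nf in auto)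
    show "summable (\<lambda>k. \<integral>t. norm (f k t) \<partial>circ)"
    proof (rule summable_comparison_test'[OF sn[of "\<integral>t. \<bar>G t\<bar> \<partial>circ"], of 0])
      fix k :: nat
      have "(\<integral>t. norm (f k t) \<partial>circ) \<le> (\<integral>t. 2 * norm z ^ k * \<bar>G t\<bar> \<partial>circ)"
        by (intro integral_mono nf integrable_norm int integrable_mult_right integrable_abs G)
      thus "norm (\<integral>t. norm (f k t) \<partial>circ) \<le> 2 * norm z ^ k * (\<integral>t. \<bar>G t\<bar> \<partial>circ)" by simp
    qed
  qed
  hence "(\<lambda>k. 1 / (2 * pi) * integral\<^sup>L circ (f k)) sums (1 / (2 * pi) * (\<integral>t. (\<Sum>k. f k t) \<partial>circ))"
    by (rule sums_mult)
  also have "(\<lambda>k. 1 / (2 * pi) * integral\<^sup>L circ (f k)) = (\<lambda>k. herglotz_coeff G k * z ^ k)"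
  proof
    fix k
    have "integral\<^sup>L circ (f k) = integral\<^sup>L circ (\<lambda>t. (e k * z ^ k) * (cnj (cis t ^ k) * of_real (G t)))"
      by (simp add: f_def[abs_def] power_mult_distrib mult_ac)
    also have "\<dots> = (e k * z ^ k) * integral\<^sup>L circ (\<lambda>t. cnj (cis t ^ k) * of_real (G t))" by simp
    finally show "1 / (2 * pi) * integral\<^sup>L circ (f k) = herglotz_coeff G k * z ^ k"
      by (simp add: herglotz_coeff_def e_def)
  qed
  also have "1 / (2 * pi) * (\<integral>t. (\<Sum>k. f k t) \<partial>circ) = herglotz G z"
    using sums by (simp add: herglotz_def sums_iff)
  finally show ?thesis .
qed

lemma integrable_circ_of_square:
  fixes G :: "real \<Rightarrow> real"
  assumes "G \<in> borel_measurable circ" "integrable circ (\<lambda>t. (G t)\<^sup>2)"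
  shows "integrable circ G"
proof (rule Bochner_Integration.integrable_bound)
  show "integrable circ (\<lambda>t. 1 + (G t)\<^sup>2)" using assms(2) by simp
  show "AE t in circ. norm (G t) \<le> norm (1 + (G t)\<^sup>2)"
  proof (intro always_eventually allI)
    fix t
    have "2 * \<bar>G t\<bar> \<le> 1 + (G t)\<^sup>2"
      using sum_squares_bound[of 1 "\<bar>G t\<bar>"] by simp
    thus "norm (G t) \<le> norm (1 + (G t)\<^sup>2)" by simp
  qed
qed (rule assms(1))

text \<open>Bessel's inequality for the Fourier coefficients \<open>c k\<close> bounds 2 pi times
  the sum of their squares. Passing to the Herglotz coefficients costs at most a factor 4, which 2
  pi absorbs.\<close>

lemma herglotz_coeff_bessel:
  assumes G: "G \<in> borel_measurable circ" "integrable circ (\<lambda>t. (G t)\<^sup>2)"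
  shows "(\<Sum>k<N. (norm (herglotz_coeff G k))\<^sup>2) \<le> (\<integral>t. (G t)\<^sup>2 \<partial>circ)"
proof -
  define c where "c k = 1 / (2 * pi) * (\<integral>t. cnj (cis t ^ k) * of_real (G t) \<partial>circ)" for k
  define S where "S t = (\<Sum>k<N. c k * cis t ^ k)" for t
  define s where "s = (\<Sum>k<N. (norm (c k))\<^sup>2)"
  have G1: "integrable circ G" by (rule integrable_circ_of_square[OF G])
  have contS: "continuous_on A S" for A unfolding S_def by (intro continuous_intros)
  have intk: "integrable circ (\<lambda>t. cnj (c k) * (cnj (cis t ^ k) * of_real (G t)))" for k
    by (intro integrable_mult_right integrable_circ_mult_bounded[OF _ _ G1, of _ 1])
       (auto intro!: continuous_intros simp: norm_power)
  have eqS: "cnj (S t) * of_real (G t) = (\<Sum>k<N. cnj (c k) * (cnj (cis t ^ k) * of_real (G t)))" for t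
    by (simp add: S_def cnj_sum sum_distrib_right mult.assoc)
  have intS: "integrable circ (\<lambda>t. cnj (S t) * of_real (G t))"
    unfolding eqS by (rule Bochner_Integration.integrable_sum) (rule intk)
  have "(\<integral>t. cnj (S t) * of_real (G t) \<partial>circ) = (\<Sum>k<N. cnj (c k) * (2 * pi * c k))"
    unfolding eqS by (subst Bochner_Integration.integral_sum[OF intk]) (simp add: c_def)
  also have "\<dots> = of_real (2 * pi * s)"
    unfolding s_def sum_distrib_left of_real_sum
    by (intro sum.cong refl) (simp add: complex_norm_square[symmetric] mult.commute)
  finally have IS: "(\<integral>t. cnj (S t) * of_real (G t) \<partial>circ) = of_real (2 * pi * s)" .
  have IRe: "integrable circ (\<lambda>t. Re (cnj (S t) * of_real (G t)))" "(\<integral>t. Re (cnj (S t) * of_real (G t)) \<partial>circ) = 2 * pi * s"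
    using integrable_Re[OF intS] integral_Re[OF intS] IS by (simp_all only: Re_complex_of_real)
  have In: "integrable circ (\<lambda>t. (norm (S t))\<^sup>2)" "(\<integral>t. (norm (S t))\<^sup>2 \<partial>circ) = 2 * pi * s"
    using integral_norm_sum_cis[where a = c and N = N]
    by (auto intro!: continuous_circ(1) continuous_intros contS simp: S_def[symmetric] s_def)
  have "0 \<le> (\<integral>t. (norm (of_real (G t) - S t))\<^sup>2 \<partial>circ)" by simp
  also have "\<dots> = (\<integral>t. (G t)\<^sup>2 - 2 * Re (cnj (S t) * of_real (G t)) + (norm (S t))\<^sup>2 \<partial>circ)"
    by (intro Bochner_Integration.integral_cong refl, simp only: cmod_power2)
      (simp add: power2_eq_square algebra_simps)
  also have "\<dots> = (\<integral>t. (G t)\<^sup>2 \<partial>circ) - 2 * (2 * pi * s) + 2 * pi * s"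
    using G(2) IRe In by simp
  finally have "2 * pi * s \<le> (\<integral>t. (G t)\<^sup>2 \<partial>circ)" by simp
  moreover have "(\<Sum>k<N. (norm (herglotz_coeff G k))\<^sup>2) \<le> 4 * s"
    unfolding s_def sum_distrib_left
  proof (rule sum_mono)
    fix k
    have "norm (herglotz_coeff G k) = (if k = 0 then 1 else 2) * norm (c k)"
      by (simp add: herglotz_coeff_def c_def norm_mult norm_divide)
    also have "\<dots> \<le> 2 * norm (c k)" by simp
    finally have "(norm (herglotz_coeff G k))\<^sup>2 \<le> (2 * norm (c k))\<^sup>2" by (rule power_mono) simp
    thus "(norm (herglotz_coeff G k))\<^sup>2 \<le> 4 * (norm (c k))\<^sup>2" by (simp add: power_mult_distrib)
  qed
  moreover have "4 * s \<le> 2 * pi * s"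
    using pi_ge_two by (intro mult_right_mono) (auto simp: s_def sum_nonneg)
  ultimately show ?thesis by linarith
qed

section \<open>Comparison with polynomials and radial limits\<close>

lemma herglotz_coeff_diff:
  assumes "integrable circ G" "integrable circ H"
  shows "herglotz_coeff (\<lambda>t. G t - H t) k = herglotz_coeff G k - herglotz_coeff H k"
proof -
  have "integrable circ (\<lambda>t. cnj (cis t ^ k) * complex_of_real (F t))" if "integrable circ F" for F
    by (rule integrable_circ_mult_bounded[OF _ _ that, of _ 1]) (auto intro!: continuous_intros simp: norm_power)
  from Bochner_Integration.integral_diff[OF this this, OF assms]
  show ?thesis by (simp add: herglotz_coeff_def right_diff_distrib diff_divide_distrib)
qed

lemma continuous_on_poly_cis [continuous_intros]: "continuous_on S (\<lambda>t. poly Q (cis t))"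
  by (intro continuous_intros)

lemma integral_circ_poly: "(\<integral>t. poly Q (cis t) \<partial>circ) = 2 * pi * poly Q 0"
proof -
  have "((\<lambda>t. poly Q (cis t)) has_integral (2 * pi * poly Q 0)) {0..2*pi}"
    by (rule has_integral_mean_value_cis) (auto intro!: continuous_intros holomorphic_intros)
  thus ?thesis
    by (subst continuous_circ) (auto intro!: continuous_intros simp: integral_unique)
qed

lemma integral_circ_poly_coeff: "(\<integral>t. cnj (cis t ^ k) * poly Q (cis t) \<partial>circ) = 2 * pi * coeff Q k"
proof -
  have int: "integrable circ (\<lambda>t. coeff Q j * (cis t ^ j * cnj (cis t ^ k)))" for j
    by (intro continuous_circ continuous_intros)
  have "(\<integral>t. cnj (cis t ^ k) * poly Q (cis t) \<partial>circ)
     = (\<integral>t. (\<Sum>j\<le>degree Q. coeff Q j * (cis t ^ j * cnj (cis t ^ k))) \<partial>circ)"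
    by (simp add: poly_altdef sum_distrib_left mult_ac)
  also have "\<dots> = (\<Sum>j\<le>degree Q. coeff Q j * (\<integral>t. cis t ^ j * cnj (cis t ^ k) \<partial>circ))"
    by (simp only: Bochner_Integration.integral_sum[OF int] Bochner_Integration.integral_mult_right_zero)
  also have "\<dots> = (\<Sum>j\<le>degree Q. if j = k then 2 * pi * coeff Q k else 0)"
    unfolding integral_circ_cis_power_cnj by (intro sum.cong) auto
  also have "\<dots> = 2 * pi * coeff Q k" by (simp add: coeff_eq_0)
  finally show ?thesis .
qed

text \<open>In Re Q = (Q + cnj Q) / 2 the conjugate part has no positive frequencies, so for k > 0
  only half of the coefficient of \<open>Q\<close> appears and the factor 2 restores it. For k = 0
  both halves contribute and add up because Q(0) is real.\<close>

lemma herglotz_coeff_poly: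
  assumes "Im (coeff Q 0) = 0"
  shows "herglotz_coeff (\<lambda>t. Re (poly Q (cis t))) k = coeff Q k"
proof -
  have q0: "cnj (coeff Q 0) = coeff Q 0" using assms by (simp add: complex_eq_iff)
  have "(\<integral>t. cnj (cis t ^ k) * of_real (Re (poly Q (cis t))) \<partial>circ)
     = (\<integral>t. cnj (cis t ^ k) * poly Q (cis t) / 2 + cnj (cis t ^ k * poly Q (cis t)) / 2 \<partial>circ)"
  proof (intro Bochner_Integration.integral_cong refl)
    fix t
    have "complex_of_real (Re (poly Q (cis t))) = (poly Q (cis t) + cnj (poly Q (cis t))) / 2"
      by (simp add: complex_add_cnj)
    thus "cnj (cis t ^ k) * of_real (Re (poly Q (cis t)))
        = cnj (cis t ^ k) * poly Q (cis t) / 2 + cnj (cis t ^ k * poly Q (cis t)) / 2"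
      by (simp add: distrib_left add_divide_distrib)
  qed
  also have "\<dots> = (\<integral>t. cnj (cis t ^ k) * poly Q (cis t) / 2 \<partial>circ) + (\<integral>t. cnj (cis t ^ k * poly Q (cis t)) / 2 \<partial>circ)"
    by (intro Bochner_Integration.integral_add continuous_circ(1) continuous_intros) auto
  \<comment> \<open>The conjugate turns into the mean of the polynomial z^k * Q, that is, its value
    at 0.\<close>
  also have "(\<integral>t. cnj (cis t ^ k * poly Q (cis t)) / 2 \<partial>circ) = cnj (\<integral>t. poly (monom 1 k * Q) (cis t) \<partial>circ) / 2"
    unfolding Bochner_Integration.integral_cnj[symmetric] by (simp add: poly_monom)
  also have "\<dots> = (if k = 0 then pi * coeff Q 0 else 0)"
    unfolding integral_circ_poly unfolding poly_mult poly_monom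
    by (simp add: poly_0_coeff_0 q0 power_0_left)
  also have "(\<integral>t. cnj (cis t ^ k) * poly Q (cis t) / 2 \<partial>circ) = pi * coeff Q k"
    using integral_circ_poly_coeff[of k Q] by simp
  finally show ?thesis by (auto simp: herglotz_coeff_def)
qed

lemma integrable_diff_square:
  assumes G: "G \<in> borel_measurable circ" "integrable circ (\<lambda>t. (G t)\<^sup>2)" and contR: "\<And>S. continuous_on S R"
  shows "integrable circ (\<lambda>t. (G t - R t :: real)\<^sup>2)"
proof (rule Bochner_Integration.integrable_bound)
  show "integrable circ (\<lambda>t. 2 * (G t)\<^sup>2 + 2 * (R t)\<^sup>2)"
    by (intro Bochner_Integration.integrable_add integrable_mult_right G continuous_circ(1) continuous_intros contR)
  show "AE t in circ. norm ((G t - R t)\<^sup>2) \<le> norm (2 * (G t)\<^sup>2 + 2 * (R t)\<^sup>2)"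
  proof (intro always_eventually allI)
    fix t
    have "0 \<le> (G t + R t)\<^sup>2" by simp
    hence "(G t - R t)\<^sup>2 \<le> 2 * (G t)\<^sup>2 + 2 * (R t)\<^sup>2"
      by (simp add: power2_eq_square algebra_simps)
    thus "norm ((G t - R t)\<^sup>2) \<le> norm (2 * (G t)\<^sup>2 + 2 * (R t)\<^sup>2)"
      by simp
  qed
qed (use G borel_measurable_circ_continuous[OF contR] in measurable)

text \<open>The Taylor coefficients of \<open>herglotz G\<close> minus \<open>Q\<close> are the
  Herglotz coefficients of G - Re Q. Bessel makes them smaller than \<sigma> in the l2 norm, and the
  maximal inequality for series applies.\<close>

lemma herglotz_maximal:
  assumes G: "G \<in> borel_measurable circ" "integrable circ (\<lambda>t. (G t)\<^sup>2)"
    and Q: "Im (coeff Q 0) = 0"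
    and \<sigma>: "(\<integral>t. (G t - Re (poly Q (cis t)))\<^sup>2 \<partial>circ) \<le> \<sigma>\<^sup>2" "0 < \<sigma>" and c: "0 < c"
  obtains B where "B \<in> lmeasurable"
    "{\<theta> \<in> {0..2*pi}. \<exists>r\<in>{0..<1}. c < norm (herglotz G (of_real r * cis \<theta>) - poly Q (of_real r * cis \<theta>))} \<subseteq> B"
    "measure lebesgue B \<le> 20 * pi * \<sigma> / c"
proof -
  define R where "R t = Re (poly Q (cis t))" for t
  have contR: "continuous_on S R" for S unfolding R_def by (intro continuous_intros)
  have R: "R \<in> borel_measurable circ" by (rule borel_measurable_circ_continuous[OF contR])
  have int: "integrable circ (\<lambda>t. (G t - R t)\<^sup>2)"
    by (rule integrable_diff_square[OF G contR])
  have GI: "integrable circ G" by (rule integrable_circ_of_square[OF G])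
  define a where "a k = herglotz_coeff G k - coeff Q k" for k
  have "a = herglotz_coeff (\<lambda>t. G t - R t)"
    unfolding fun_eq_iff herglotz_coeff_diff[OF GI continuous_circ(1)[OF contR]]
    unfolding R_def herglotz_coeff_poly[OF Q] by (simp add: a_def)
  hence "(\<Sum>k<N. (norm (a k))\<^sup>2) \<le> \<sigma>\<^sup>2" for N
    using herglotz_coeff_bessel[OF borel_measurable_diff[OF G(1) R] int, of N] \<sigma>(1) by (simp add: R_def)
  moreover have "(\<lambda>k. a k * z ^ k) sums (herglotz G z - poly Q z)" if "norm z < 1" for z
  proof -
    have "(\<lambda>k. coeff Q k * z ^ k) sums (\<Sum>k\<in>{..degree Q}. coeff Q k * z ^ k)"
      by (rule sums_finite) (auto simp: coeff_eq_0)
    from sums_diff[OF herglotz_sums[OF GI that] this] show ?thesis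
      by (simp add: a_def left_diff_distrib poly_altdef)
  qed
  ultimately show ?thesis
    using radial_maximal_series[of a \<sigma> c "\<lambda>z. herglotz G z - poly Q z"] \<sigma>(2) c that by blast
qed

text \<open>Interchange of two limits: uniform closeness on [0, 1) forces the boundary values
  \<open>q n 1\<close> to be Cauchy, and a three-epsilon argument shows that \<open>h\<close> tends
  to their limit.\<close>

lemma tendsto_at_left_of_uniform:
  fixes h :: "real \<Rightarrow> complex" and q :: "nat \<Rightarrow> real \<Rightarrow> complex"
  assumes q: "\<And>n. isCont (q n) 1" and e: "e \<longlonglongrightarrow> (0::real)"
    and un: "\<forall>\<^sub>F n in sequentially. \<forall>r\<in>{0..<1}. norm (h r - q n r) \<le> e n"
  obtains l where "(h \<longlongrightarrow> l) (at_left 1)" "(\<lambda>n. q n 1) \<longlonglongrightarrow> l"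
proof -
  have ql: "(q n \<longlongrightarrow> q n 1) (at_left 1)" for n
    using q[of n] by (meson isCont_def filterlim_at_split)
  have el: "\<forall>\<^sub>F r in at_left (1::real). r \<in> {0..<1}"
    using eventually_at_left_real[of 0 1] by (auto elim!: eventually_mono)
  have close: "norm (q m 1 - q n 1) \<le> e m + e n" if m: "\<forall>r\<in>{0..<1}. norm (h r - q m r) \<le> e m"
    and n: "\<forall>r\<in>{0..<1}. norm (h r - q n r) \<le> e n" for m n
  proof (rule tendsto_upperbound)
    show "((\<lambda>r. norm (q m r - q n r)) \<longlongrightarrow> norm (q m 1 - q n 1)) (at_left 1)"
      by (intro tendsto_intros ql)
    show "\<forall>\<^sub>F r in at_left 1. norm (q m r - q n r) \<le> e m + e n"
      using el
    proof eventually_elim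
      case (elim r)
      have "norm (q m r - q n r) = norm ((h r - q n r) - (h r - q m r))" by simp
      also have "\<dots> \<le> norm (h r - q n r) + norm (h r - q m r)" by (rule norm_triangle_ineq4)
      finally show ?case using elim m n by fastforce
    qed
  qed simp
  have "Cauchy (\<lambda>n. q n 1)"
  proof (rule CauchyI)
    fix \<epsilon> :: real assume "0 < \<epsilon>"
    hence "\<forall>\<^sub>F n in sequentially. e n < \<epsilon> / 2" using order_tendstoD(2)[OF e, of "\<epsilon> / 2"] by simp
    with un have "\<forall>\<^sub>F n in sequentially. e n < \<epsilon> / 2 \<and> (\<forall>r\<in>{0..<1}. norm (h r - q n r) \<le> e n)"
      by eventually_elim simp
    then obtain N where N: "\<And>n. n \<ge> N \<Longrightarrow> e n < \<epsilon> / 2" "\<And>n. n \<ge> N \<Longrightarrow> (\<forall>r\<in>{0..<1}. norm (h r - q n r) \<le> e n)"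
      by (auto simp: eventually_sequentially)
    have "norm (q m 1 - q n 1) < \<epsilon>" if "m \<ge> N" "n \<ge> N" for m n
      using close[OF N(2) N(2), OF that] N(1)[OF that(1)] N(1)[OF that(2)] by simp
    thus "\<exists>M. \<forall>m\<ge>M. \<forall>n\<ge>M. norm (q m 1 - q n 1) < \<epsilon>" by blast
  qed
  then obtain l where l: "(\<lambda>n. q n 1) \<longlonglongrightarrow> l"
    using Cauchy_convergent convergent_def by blast
  have "(h \<longlongrightarrow> l) (at_left 1)"
  proof (rule tendstoI)
    fix \<epsilon> :: real assume "0 < \<epsilon>"
    hence "\<forall>\<^sub>F n in sequentially. e n < \<epsilon> / 3" using order_tendstoD(2)[OF e, of "\<epsilon> / 3"] by simp
    moreover have "\<forall>\<^sub>F n in sequentially. dist (q n 1) l < \<epsilon> / 3"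
      using tendstoD[OF l, of "\<epsilon> / 3"] \<open>0 < \<epsilon>\<close> by simp
    ultimately have "\<forall>\<^sub>F n in sequentially. e n < \<epsilon> / 3 \<and> dist (q n 1) l < \<epsilon> / 3 \<and> (\<forall>r\<in>{0..<1}. norm (h r - q n r) \<le> e n)"
      using un by eventually_elim simp
    then obtain n where n: "e n < \<epsilon> / 3" "dist (q n 1) l < \<epsilon> / 3" "\<forall>r\<in>{0..<1}. norm (h r - q n r) \<le> e n"
      by (auto simp: eventually_sequentially)
    have "\<forall>\<^sub>F r in at_left 1. dist (q n r) (q n 1) < \<epsilon> / 3"
      using tendstoD[OF ql, of "\<epsilon> / 3"] \<open>0 < \<epsilon>\<close> by simp
    with el show "\<forall>\<^sub>F r in at_left 1. dist (h r) l < \<epsilon>"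
    proof eventually_elim
      case (elim r)
      have "dist (h r) l \<le> dist (h r) (q n r) + dist (q n r) (q n 1) + dist (q n 1) l"
        by (meson dist_triangle_le add_mono order.refl dist_triangle order.trans add_right_mono)
      moreover have "dist (h r) (q n r) \<le> e n" using n(3) elim by (simp add: dist_norm)
      ultimately show ?case using n elim by linarith
    qed
  qed
  from that[OF this l] show ?thesis .
qed

lemma AE_circI: "AE t in lebesgue. P t \<Longrightarrow> AE t in circ. P t"
  unfolding circ_def by (subst AE_restrict_space_iff) (auto elim!: eventually_mono)

text \<open>Along a fast subsequence the exceptional sets of \<open>herglotz_maximal\<close> have
  summable measures. By Borel-Cantelli almost every radius eventually avoids them, so on it the
  polynomials approximate the Herglotz integral uniformly, up to the boundary.\<close>

lemma herglotz_boundary: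
  assumes G: "G \<in> borel_measurable circ" "integrable circ (\<lambda>t. (G t)\<^sup>2)"
    and Q: "\<And>n. Im (coeff (Q n) 0) = 0"
    and lim: "(\<lambda>n. \<integral>t. (G t - Re (poly (Q n) (cis t)))\<^sup>2 \<partial>circ) \<longlonglongrightarrow> 0"
  obtains s :: "nat \<Rightarrow> nat" and H :: "real \<Rightarrow> complex" where "filterlim s at_top sequentially"
    "AE t in circ. (\<lambda>n. poly (Q (s n)) (cis t)) \<longlonglongrightarrow> H t"
    "AE t in circ. ((\<lambda>r. herglotz G (of_real r * cis t)) \<longlongrightarrow> H t) (at_left 1)"
    "AE t in circ. Re (H t) = G t" "H \<in> borel_measurable circ"
proof -
  \<comment> \<open>Chosen so that for the threshold (1/2)^n the maximal inequality leaves measure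
    at most (1/2)^n.\<close>
  define \<sigma> where "\<sigma> n = (1/4) ^ n / (20 * pi)" for n :: nat
  have \<sigma>: "0 < \<sigma> n" for n by (simp add: \<sigma>_def)
  have "\<exists>m\<ge>n. (\<integral>t. (G t - Re (poly (Q m) (cis t)))\<^sup>2 \<partial>circ) \<le> (\<sigma> n)\<^sup>2" for n
  proof -
    have "\<forall>\<^sub>F m in sequentially. (\<integral>t. (G t - Re (poly (Q m) (cis t)))\<^sup>2 \<partial>circ) < (\<sigma> n)\<^sup>2"
      using order_tendstoD(2)[OF lim, of "(\<sigma> n)\<^sup>2"] \<sigma>[of n] by simp
    with eventually_ge_at_top[of n]
    have "\<forall>\<^sub>F m in sequentially. m \<ge> n \<and> (\<integral>t. (G t - Re (poly (Q m) (cis t)))\<^sup>2 \<partial>circ) \<le> (\<sigma> n)\<^sup>2"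
      by eventually_elim simp
    then show ?thesis by (auto simp: eventually_sequentially)
  qed
  then obtain s where s: "\<And>n. s n \<ge> n" "\<And>n. (\<integral>t. (G t - Re (poly (Q (s n)) (cis t)))\<^sup>2 \<partial>circ) \<le> (\<sigma> n)\<^sup>2"
    by metis
  define E where "E n = {\<theta> \<in> {0..2*pi}. \<exists>r\<in>{0..<1}. (1/2) ^ n <
    norm (herglotz G (of_real r * cis \<theta>) - poly (Q (s n)) (of_real r * cis \<theta>))}" for n :: nat
  define P where "P n B \<longleftrightarrow> B \<in> lmeasurable \<and> E n \<subseteq> B \<and> measure lebesgue B \<le> (1/2) ^ n" for n B
  define B where "B n = (SOME B. P n B)" for n
  have "\<exists>B. P n B" for n
  proof -
    obtain B where B: "B \<in> lmeasurable" "E n \<subseteq> B" "measure lebesgue B \<le> 20 * pi * \<sigma> n / (1/2) ^ n"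
      unfolding E_def using herglotz_maximal[OF G Q s(2) \<sigma>, of "(1/2) ^ n" n] by force
    have "20 * pi * \<sigma> n / (1/2) ^ n = (1/2) ^ n"
      by (simp add: \<sigma>_def power_mult_distrib[symmetric] field_simps)
    with B show ?thesis unfolding P_def by auto
  qed
  hence "P n (B n)" for n unfolding B_def by (rule someI_ex)
  hence B: "\<And>n. B n \<in> lmeasurable" "\<And>n. E n \<subseteq> B n" "\<And>n. measure lebesgue (B n) \<le> (1/2) ^ n"
    by (simp_all only: P_def)
  have "AE t in lebesgue. \<forall>\<^sub>F n in sequentially. t \<in> space lebesgue - B n"
  proof (rule borel_cantelli_AE1)
    show "B n \<in> sets lebesgue" "emeasure lebesgue (B n) < \<infinity>" for n
      using B(1)[of n] by (auto simp: fmeasurable_def)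
    show "summable (\<lambda>n. measure lebesgue (B n))"
      by (rule summable_comparison_test'[OF summable_geometric[of "1/2"], of 0]) (use B(3) in auto)
  qed
  hence AE: "AE t in circ. \<forall>\<^sub>F n in sequentially. t \<notin> B n"
    by (intro AE_circI) simp
  \<comment> \<open>Taking \<open>H\<close> as the limit of a sequence of polynomials, instead of as
    a radial limit, makes its measurability immediate.\<close>
  define H where "H t = lim (\<lambda>n. poly (Q (s n)) (cis t))" for t
  have main: "((\<lambda>r. herglotz G (of_real r * cis t)) \<longlongrightarrow> H t) (at_left 1) \<and> (\<lambda>n. poly (Q (s n)) (cis t)) \<longlonglongrightarrow> H t"
    if t: "t \<in> {0..2*pi}" "\<forall>\<^sub>F n in sequentially. t \<notin> B n" for t
  proof -
    obtain l where l: "((\<lambda>r. herglotz G (of_real r * cis t)) \<longlongrightarrow> l) (at_left 1)"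
      "(\<lambda>n. poly (Q (s n)) (of_real 1 * cis t)) \<longlonglongrightarrow> l"
    proof (rule tendsto_at_left_of_uniform[of "\<lambda>n r. poly (Q (s n)) (of_real r * cis t)" "\<lambda>n. (1/2) ^ n"])
      show "isCont (\<lambda>r. poly (Q (s n)) (complex_of_real r * cis t)) 1" for n
        by (intro continuous_intros)
      show "(\<lambda>n. (1 / 2 :: real) ^ n) \<longlonglongrightarrow> 0" by (rule LIMSEQ_power_zero) simp
      show "\<forall>\<^sub>F n in sequentially. \<forall>r\<in>{0..<1}. norm (herglotz G (of_real r * cis t)
         - poly (Q (s n)) (of_real r * cis t)) \<le> (1/2) ^ n"
        using t(2)
      proof eventually_elim
        case (elim n)
        hence "t \<notin> E n" using B(2) by blast
        thus ?case using t(1) by (auto simp: E_def not_less)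
      qed
    qed
    have "H t = l" using l(2) by (simp add: H_def limI)
    with l show ?thesis by simp
  qed
  have ms: "(\<lambda>t. poly (Q n) (cis t)) \<in> borel_measurable circ" for n
    by (intro borel_measurable_circ_continuous continuous_intros)
  have AE1: "AE t in circ. (\<lambda>n. poly (Q (s n)) (cis t)) \<longlonglongrightarrow> H t"
    using AE AE_space by (eventually_elim, use main in simp)
  have filt: "filterlim s at_top sequentially"
    by (rule filterlim_at_top_mono[OF filterlim_ident]) (simp add: s(1))
  show ?thesis
  proof
    show "filterlim s at_top sequentially" by (rule filt)
    show "AE t in circ. (\<lambda>n. poly (Q (s n)) (cis t)) \<longlonglongrightarrow> H t" by (rule AE1)
    show "AE t in circ. ((\<lambda>r. herglotz G (of_real r * cis t)) \<longlongrightarrow> H t) (at_left 1)"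
      using AE AE_space by (eventually_elim, use main in simp)
    show "H \<in> borel_measurable circ"
      unfolding H_def by (rule borel_measurable_lim_metric) (rule ms)
    \<comment> \<open>L1 convergence of the squares to 0 yields almost everywhere convergence along
      a further subsequence, which identifies the real part of the limit.\<close>
    define x where "x n t = (G t - Re (poly (Q (s n)) (cis t)))\<^sup>2" for n t
    have "integrable circ (x n)" for n
      unfolding x_def by (rule integrable_diff_square[OF G]) (intro continuous_intros)
    moreover have "(\<lambda>n. \<integral>t. norm (x n t) \<partial>circ) \<longlonglongrightarrow> 0"
      using filterlim_compose[OF lim filt] by (simp add: x_def)
    ultimately obtain r where r: "strict_mono r" "AE t in circ. (\<lambda>n. x (r n) t) \<longlonglongrightarrow> 0"
      using tendsto_L1_AE_subseq[of circ x] by blast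
    show "AE t in circ. Re (H t) = G t"
      using r(2) AE1
    proof eventually_elim
      case (elim t)
      have "(\<lambda>n. x (r n) t) \<longlonglongrightarrow> (G t - Re (H t))\<^sup>2"
        unfolding x_def using LIMSEQ_subseq_LIMSEQ[OF elim(2) r(1)]
        by (intro tendsto_intros) (simp add: o_def)
      with elim(1) have "(G t - Re (H t))\<^sup>2 = 0" using LIMSEQ_unique by blast
      thus ?case by simp
    qed
  qed
qed

section \<open>Approximation by real parts of polynomials\<close>

text \<open>These are the real trigonometric polynomials, seen as functions on the plane of which
  only the values on the circle matter.\<close>

definition trig_real :: "(complex \<Rightarrow> real) \<Rightarrow> bool" where
  "trig_real f \<longleftrightarrow> (\<exists>Q. \<forall>z. norm z = 1 \<longrightarrow> f z = Re (poly Q z))"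

lemma trig_real_poly: "trig_real (\<lambda>z. Re (poly Q z))"
  by (auto simp: trig_real_def)

lemma trig_real_add: "trig_real f \<Longrightarrow> trig_real g \<Longrightarrow> trig_real (\<lambda>z. f z + g z)"
  unfolding trig_real_def by (metis poly_add plus_complex.sel(1))

lemma trig_real_sum: "finite A \<Longrightarrow> (\<And>i. i \<in> A \<Longrightarrow> trig_real (f i)) \<Longrightarrow> trig_real (\<lambda>z. \<Sum>i\<in>A. f i z)"
proof (induction A rule: finite_induct)
  case empty
  show ?case using trig_real_poly[of 0] by simp
qed (simp add: trig_real_add)

text \<open>On the circle z * cnj z = 1, so only a power of z or of cnj z survives. In the second
  case conjugation leaves the real part unchanged and produces a power of z.\<close>

lemma trig_real_monom: "trig_real (\<lambda>z. Re (c * (z ^ j * cnj z ^ k)))"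
proof -
  have *: "z ^ (m + d) * cnj z ^ m = z ^ d" if "norm z = 1" for z :: complex and m d
  proof -
    have "z * cnj z = 1" using that by (simp add: complex_norm_square[symmetric])
    hence "z ^ m * cnj z ^ m = 1" by (metis power_mult_distrib power_one)
    thus ?thesis by (simp add: power_add mult_ac)
  qed
  show ?thesis
  proof (cases "k \<le> j")
    case True
    then obtain d where d: "j = k + d" using le_Suc_ex by blast
    show ?thesis unfolding trig_real_def
      by (rule exI[of _ "monom c d"]) (auto simp: d * poly_monom)
  next
    case False
    then obtain d where d: "k = j + d" using le_Suc_ex nat_le_linear by blast
    have "Re (c * (z ^ j * cnj z ^ k)) = Re (poly (monom (cnj c) d) z)" if "norm z = 1" for z
    proof -
      have "Re (c * (z ^ j * cnj z ^ k)) = Re (cnj (c * (z ^ j * cnj z ^ k)))"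
        by (rule cnj.simps(1)[symmetric])
      also have "cnj (c * (z ^ j * cnj z ^ k)) = cnj c * (z ^ (j + d) * cnj z ^ j)"
        by (simp add: d mult_ac)
      finally show ?thesis using *[OF that, of j d] by (simp add: poly_monom)
    qed
    thus ?thesis unfolding trig_real_def by blast
  qed
qed

text \<open>Re a * Re b = (Re (a * b) + Re (a * cnj b)) / 2; the first term is again the real part
  of a polynomial, the second expands into the monomials of \<open>trig_real_monom\<close>.\<close>

lemma trig_real_mult:
  assumes "trig_real f" "trig_real g"
  shows "trig_real (\<lambda>z. f z * g z)"
proof -
  obtain P Q where PQ: "\<And>z. norm z = 1 \<Longrightarrow> f z = Re (poly P z)" "\<And>z. norm z = 1 \<Longrightarrow> g z = Re (poly Q z)"
    using assms unfolding trig_real_def by blast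
  define h where "h z = Re (poly (smult (1/2) (P * Q)) z) + (\<Sum>j\<le>degree P. \<Sum>k\<le>degree Q.
      Re (coeff P j * cnj (coeff Q k) / 2 * (z ^ j * cnj z ^ k)))" for z
  have "trig_real h" unfolding h_def
    by (intro trig_real_add trig_real_poly trig_real_sum trig_real_monom) auto
  moreover have "f z * g z = h z" if "norm z = 1" for z
  proof -
    have "poly P z * cnj (poly Q z) = (\<Sum>j\<le>degree P. \<Sum>k\<le>degree Q. (coeff P j * cnj (coeff Q k)) * (z ^ j * cnj z ^ k))"
      unfolding poly_altdef cnj_sum sum_product by (intro sum.cong refl) simp
    hence "Re (poly P z * cnj (poly Q z)) / 2 = (\<Sum>j\<le>degree P. \<Sum>k\<le>degree Q.
      Re (coeff P j * cnj (coeff Q k) / 2 * (z ^ j * cnj z ^ k)))"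
      by (simp add: Re_sum sum_divide_distrib)
    moreover have "Re (poly P z) * Re (poly Q z) = Re (poly (smult (1/2) (P * Q)) z) + Re (poly P z * cnj (poly Q z)) / 2"
      by (simp add: field_simps)
    ultimately show ?thesis using PQ[OF that] by (simp only: h_def)
  qed
  ultimately show ?thesis unfolding trig_real_def by simp
qed

lemma trig_real_polynomial_function: "real_polynomial_function f \<Longrightarrow> trig_real f"
proof (induction rule: real_polynomial_function.induct)
  case (linear f)
  interpret bounded_linear f by (rule linear)
  \<comment> \<open>A real linear functional a * Re z + b * Im z is the real part of (a - \<i> b) *
    z.\<close>
  have "f z = Re (poly [:0, Complex (f 1) (- f \<i>):] z)" for z
  proof -
    have "z = Re z *\<^sub>R 1 + Im z *\<^sub>R \<i>" by (simp add: complex_eq_iff)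
    hence "f z = f (Re z *\<^sub>R 1 + Im z *\<^sub>R \<i>)" by (rule arg_cong)
    also have "\<dots> = Re z * f 1 + Im z * f \<i>" unfolding add scaleR by simp
    finally show ?thesis by simp
  qed
  then show ?case unfolding trig_real_def by blast
next
  case (const c)
  have "c = Re (poly [:of_real c:] z)" for z by simp
  then show ?case unfolding trig_real_def by blast
qed (simp_all add: trig_real_add trig_real_mult)

text \<open>Equality at the end points lets \<open>c\<close> descend to a continuous function on the
  circle. Stone-Weierstrass approximates it by a real polynomial in Re z and Im z, which on the
  circle is the real part of a complex polynomial.\<close>

lemma continuous_trig_approx:
  fixes c :: "real \<Rightarrow> real"
  assumes c: "continuous_on {0..2*pi} c" "c 0 = c (2*pi)" and e: "0 < e"
  obtains Q where "\<And>t. t \<in> {0..2*pi} \<Longrightarrow> \<bar>c t - Re (poly Q (cis t))\<bar> < e"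
proof -
  define p where "p s = c (2 * pi * s)" for s
  have "path p" unfolding path_def p_def
    by (rule continuous_on_compose2[OF c(1)]) (auto intro!: continuous_intros mult_left_le)
  hence "homotopic_loops UNIV p p"
    using c(2) by (simp add: homotopic_loops_refl pathfinish_def pathstart_def p_def)
  \<comment> \<open>a loop seen as a function on the circle is continuous, also at the jump of the argument\<close>
  from homotopic_with_imp_continuous[OF homotopic_loops_imp_homotopic_circlemaps[OF this]]
  have cont: "continuous_on (sphere 0 1) (p \<circ> (\<lambda>z. Arg2pi z / (2*pi)))" by simp
  obtain g where g: "real_polynomial_function g"
    "\<And>z. z \<in> sphere 0 1 \<Longrightarrow> \<bar>(p \<circ> (\<lambda>z. Arg2pi z / (2*pi))) z - g z\<bar> < e"
    using Stone_Weierstrass_real_polynomial_function[OF _ cont e] by auto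
  obtain Q where Q: "\<And>z. norm z = 1 \<Longrightarrow> g z = Re (poly Q z)"
    using trig_real_polynomial_function[OF g(1)] unfolding trig_real_def by blast
  show ?thesis
  proof
    fix t assume t: "t \<in> {0..2*pi}"
    have "(p \<circ> (\<lambda>z. Arg2pi z / (2*pi))) (cis t) = c t"
    proof (cases "t = 2 * pi")
      case True
      hence "Arg2pi (cis t) = 0" by (simp add: Arg2pi_of_real[of 1, simplified])
      then show ?thesis using True c(2) by (simp add: p_def)
    next
      case False
      hence "Arg2pi (cis t) = t" using t
        by (intro Arg2pi_unique[of 1]) (auto simp: cis_conv_exp)
      then show ?thesis by (simp add: p_def)
    qed
    thus "\<bar>c t - Re (poly Q (cis t))\<bar> < e" using g(2)[of "cis t"] Q[of "cis t"] by simp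
  qed
qed

text \<open>Normalises the constant coefficient to be real without changing the real part, as
  required for \<open>herglotz_coeff_poly\<close>.\<close>

lemma Re_poly_shift_imaginary:
  assumes "norm z = 1"
  shows "Re (poly (Q - [: \<i> * of_real (Im (coeff Q 0)) :]) z) = Re (poly Q z)"
    "Im (coeff (Q - [: \<i> * of_real (Im (coeff Q 0)) :]) 0) = 0"
  by simp_all

text \<open>A measurable function is an almost everywhere limit of continuous ones. Clipping at
  \<open>M\<close> and cutting off near the end points makes these bounded and periodic; uniform
  trigonometric approximation within 1 / (n + 1) then costs at most the extra 1 in the
  bound.\<close>

lemma bounded_trig_approx:
  assumes u: "u \<in> borel_measurable circ" and M: "\<And>t. \<bar>u t\<bar> \<le> M"
  obtains Q where "\<And>n. Im (coeff (Q n) 0) = 0"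
    "\<And>n t. t \<in> {0..2*pi} \<Longrightarrow> \<bar>Re (poly (Q n) (cis t))\<bar> \<le> M + 1"
    "AE t in circ. (\<lambda>n. Re (poly (Q n) (cis t))) \<longlonglongrightarrow> u t"
proof -
  define v where "v t = (if t \<in> {0..2*pi} then u t else 0)" for t
  have "v \<in> borel_measurable lebesgue"
    using u unfolding v_def circ_def by (subst borel_measurable_if) auto
  hence "v measurable_on UNIV" by (intro lebesgue_measurable_imp_measurable_on_real) auto
  then obtain N g where N: "negligible N" and g: "\<And>n. continuous_on UNIV (g n)"
    "\<And>t. t \<notin> N \<Longrightarrow> (\<lambda>n. g n t) \<longlonglongrightarrow> v t"
    unfolding measurable_on_def by auto
  \<comment> \<open>A cutoff with values in [0, 1] that is 0 at both end points and eventually 1 at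
    every interior point.\<close>
  define \<eta> where "\<eta> n t = max 0 (min 1 (min (real n * t) (real n * (2 * pi - t))))" for n t
  define c where "c n t = max (-M) (min M (g n t)) * \<eta> n t" for n t
  have M0: "0 \<le> M" using M[of 0] by linarith
  have cont: "continuous_on {0..2*pi} (c n)" for n
    unfolding c_def \<eta>_def
    by (intro continuous_intros continuous_on_subset[OF g(1)]) auto
  have ends: "c n 0 = c n (2 * pi)" for n by (simp add: c_def \<eta>_def)
  have bound: "\<bar>c n t\<bar> \<le> M" for n t
  proof -
    have "\<bar>max (-M) (min M (g n t))\<bar> * \<bar>\<eta> n t\<bar> \<le> M * 1"
      using M0 by (intro mult_mono) (auto simp: \<eta>_def)
    thus ?thesis by (simp add: c_def abs_mult)
  qed
  have lim: "(\<lambda>n. c n t) \<longlonglongrightarrow> u t" if t: "t \<notin> N" "t \<in> {0<..<2*pi}" for t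
  proof -
    have "filterlim (\<lambda>n. real n * d) at_top sequentially" if "0 < d" for d :: real
      using filterlim_tendsto_pos_mult_at_top[OF tendsto_const that filterlim_real_sequentially]
      by (simp add: mult.commute)
    hence "\<forall>\<^sub>F n in sequentially. 1 \<le> real n * d" if "0 < d" for d :: real
      using that by (auto simp: filterlim_at_top)
    from this[of t] this[of "2*pi - t"] t(2)
    have "\<forall>\<^sub>F n in sequentially. 1 \<le> real n * t" "\<forall>\<^sub>F n in sequentially. 1 \<le> real n * (2*pi - t)"
      by auto
    hence "\<forall>\<^sub>F n in sequentially. \<eta> n t = 1"
      by eventually_elim (simp add: \<eta>_def)
    hence \<eta>: "(\<lambda>n. \<eta> n t) \<longlonglongrightarrow> 1" by (rule tendsto_eventually)
    have "(\<lambda>n. c n t) \<longlonglongrightarrow> max (-M) (min M (v t)) * 1"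
      unfolding c_def by (intro tendsto_intros g(2) t \<eta>)
    moreover have "max (-M) (min M (v t)) = u t" using M[of t] t(2) by (simp add: v_def)
    ultimately show ?thesis by simp
  qed
  have "\<exists>Q. Im (coeff Q 0) = 0 \<and> (\<forall>t\<in>{0..2*pi}. \<bar>c n t - Re (poly Q (cis t))\<bar> < 1 / real (Suc n))" for n
  proof -
    obtain Q where Q: "\<And>t. t \<in> {0..2*pi} \<Longrightarrow> \<bar>c n t - Re (poly Q (cis t))\<bar> < 1 / real (Suc n)"
      using continuous_trig_approx[OF cont ends, of "1 / real (Suc n)"] by auto
    have "Im (coeff (Q - [: \<i> * of_real (Im (coeff Q 0)) :]) 0) = 0 \<and>
      (\<forall>t\<in>{0..2*pi}. \<bar>c n t - Re (poly (Q - [: \<i> * of_real (Im (coeff Q 0)) :]) (cis t))\<bar> < 1 / real (Suc n))"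
      using Re_poly_shift_imaginary[of _ Q] Q by (metis norm_cis)
    then show ?thesis by blast
  qed
  then obtain Q where Q: "\<And>n. Im (coeff (Q n) 0) = 0"
    "\<And>n t. t \<in> {0..2*pi} \<Longrightarrow> \<bar>c n t - Re (poly (Q n) (cis t))\<bar> < 1 / real (Suc n)" by metis
  show ?thesis
  proof
    show "Im (coeff (Q n) 0) = 0" for n by (rule Q)
    show "\<bar>Re (poly (Q n) (cis t))\<bar> \<le> M + 1" if "t \<in> {0..2*pi}" for n t
    proof -
      have "1 / real (Suc n) \<le> 1" by simp
      thus ?thesis using Q(2)[OF that, of n] bound[of n t] by linarith
    qed
    have "AE t in lebesgue. t \<notin> N \<union> {0, 2 * pi}"
      using N by (intro AE_not_in) (auto simp: negligible_iff_null_sets[symmetric] negligible_Un_eq)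
    hence "AE t in circ. t \<notin> N \<union> {0, 2 * pi}"
      by (rule AE_circI)
    with AE_space show "AE t in circ. (\<lambda>n. Re (poly (Q n) (cis t))) \<longlonglongrightarrow> u t"
    proof eventually_elim
      case (elim t)
      hence t: "t \<notin> N" "t \<in> {0<..<2*pi}" "t \<in> {0..2*pi}" by auto
      have "(\<lambda>n. c n t - Re (poly (Q n) (cis t))) \<longlonglongrightarrow> 0"
      proof (rule Lim_null_comparison)
        show "\<forall>\<^sub>F n in sequentially. norm (c n t - Re (poly (Q n) (cis t))) \<le> 1 / real (Suc n)"
          using Q(2)[OF t(3)] by (intro always_eventually allI) (simp add: less_imp_le)
        show "(\<lambda>n. 1 / real (Suc n)) \<longlonglongrightarrow> 0"
          using LIMSEQ_inverse_real_of_nat by (simp add: inverse_eq_divide)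
      qed
      from tendsto_diff[OF lim[OF t(1,2)] this] show ?case by simp
    qed
  qed
qed

text \<open>The distance \<open>x\<close> of the functions satisfies \<open>x \<le> min x R + x\<^sup>2 / R\<close>, where the first term is
  dominated and the integral of the second is \<open>O(1/R)\<close>.\<close>

lemma tendsto_integral_of_L2_bounded:
  fixes f :: "nat \<Rightarrow> 'a \<Rightarrow> complex"
  assumes M: "finite_measure M"
    and f: "\<And>n. f n \<in> borel_measurable M" "\<And>n. integrable M (\<lambda>x. (norm (f n x))\<^sup>2)"
      "\<And>n. (\<integral>x. (norm (f n x))\<^sup>2 \<partial>M) \<le> C"
    and g: "g \<in> borel_measurable M" "integrable M (\<lambda>x. (norm (g x))\<^sup>2)"
    and lim: "AE x in M. (\<lambda>n. f n x) \<longlonglongrightarrow> g x"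
  shows "(\<lambda>n. \<integral>x. f n x \<partial>M) \<longlonglongrightarrow> (\<integral>x. g x \<partial>M)"
proof -
  interpret finite_measure M by fact
  define D where "D = 2 * C + 2 * (\<integral>x. (norm (g x))\<^sup>2 \<partial>M)"
  have int1: "integrable M u" if "u \<in> borel_measurable M" "integrable M (\<lambda>x. (norm (u x))\<^sup>2)" for u :: "'a \<Rightarrow> complex"
  proof (rule Bochner_Integration.integrable_bound)
    show "integrable M (\<lambda>x. 1 + (norm (u x))\<^sup>2)" using that(2) by simp
    show "AE x in M. norm (u x) \<le> norm (1 + (norm (u x))\<^sup>2)"
    proof (intro always_eventually allI)
      fix x
      have "2 * norm (u x) \<le> 1 + (norm (u x))\<^sup>2" using sum_squares_bound[of 1 "norm (u x)"] by simp
      thus "norm (u x) \<le> norm (1 + (norm (u x))\<^sup>2)" using norm_ge_zero[of "u x"] by (simp del: norm_ge_zero)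
    qed
  qed (rule that(1))
  define x where "x n t = norm (f n t - g t)" for n t
  have xm: "x n \<in> borel_measurable M" for n unfolding x_def using f(1) g(1) by measurable
  have sq: "(x n t)\<^sup>2 \<le> 2 * (norm (f n t))\<^sup>2 + 2 * (norm (g t))\<^sup>2" for n t
  proof -
    have "x n t \<le> norm (f n t) + norm (g t)" unfolding x_def by (rule norm_triangle_ineq4)
    hence "(x n t)\<^sup>2 \<le> (norm (f n t) + norm (g t))\<^sup>2" by (rule power_mono) (simp add: x_def)
    also have "\<dots> \<le> 2 * (norm (f n t))\<^sup>2 + 2 * (norm (g t))\<^sup>2"
      using sum_squares_bound[of "norm (f n t)" "norm (g t)"] by (simp add: power2_sum)
    finally show ?thesis .
  qed
  have x2: "integrable M (\<lambda>t. (x n t)\<^sup>2)" for n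
    by (rule Bochner_Integration.integrable_bound[of M "\<lambda>t. 2 * (norm (f n t))\<^sup>2 + 2 * (norm (g t))\<^sup>2"])
       (use f(2) g(2) xm sq in \<open>auto simp: borel_measurable_power\<close>)
  have x2le: "(\<integral>t. (x n t)\<^sup>2 \<partial>M) \<le> D" for n
  proof -
    have "(\<integral>t. (x n t)\<^sup>2 \<partial>M) \<le> (\<integral>t. 2 * (norm (f n t))\<^sup>2 + 2 * (norm (g t))\<^sup>2 \<partial>M)"
      by (rule integral_mono) (use x2 f(2) g(2) sq in auto)
    also have "\<dots> = 2 * (\<integral>t. (norm (f n t))\<^sup>2 \<partial>M) + 2 * (\<integral>t. (norm (g t))\<^sup>2 \<partial>M)"
      using f(2) g(2) by simp
    also have "\<dots> \<le> D" using f(3)[of n] by (simp add: D_def)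
    finally show ?thesis .
  qed
  have "0 \<le> (\<integral>t. (x 0 t)\<^sup>2 \<partial>M)" by simp
  hence D0: "0 \<le> D" using x2le[of 0] by linarith
  have xi: "integrable M (x n)" for n
    unfolding x_def by (intro integrable_norm Bochner_Integration.integrable_diff int1 f g)
  have "(\<lambda>n. \<integral>t. x n t \<partial>M) \<longlonglongrightarrow> 0"
  proof (rule LIMSEQ_I)
    fix e :: real assume e: "0 < e"
    \<comment> \<open>Large enough for D / R < e / 2; the summand 1 keeps \<open>R\<close> positive
      when \<open>D\<close> is 0.\<close>
    define R where "R = 2 * D / e + 1"
    have R: "0 < R" using D0 e by (simp add: R_def add_nonneg_pos)
    have "D / R < e / 2"
    proof -
      have "D < (e / 2) * R" using e by (simp add: R_def field_simps)
      thus ?thesis using R by (simp add: pos_divide_less_eq)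
    qed
    have "(\<lambda>n. \<integral>t. min (x n t) R \<partial>M) \<longlonglongrightarrow> (\<integral>t. 0 \<partial>M)"
    proof (rule integral_dominated_convergence[where w = "\<lambda>_. R"])
      show "AE t in M. (\<lambda>n. min (x n t) R) \<longlonglongrightarrow> 0"
        using lim
      proof eventually_elim
        case (elim t)
        have "(\<lambda>n. min (x n t) R) \<longlonglongrightarrow> min (norm (g t - g t)) R"
          unfolding x_def by (intro tendsto_intros elim)
        thus ?case using R by simp
      qed
      show "AE t in M. norm (min (x n t) R) \<le> R" for n
        using R by (intro always_eventually allI) (auto simp: x_def)
    qed (use xm in auto)
    from order_tendstoD(2)[OF this, of "e / 2"] e
    have "\<forall>\<^sub>F n in sequentially. (\<integral>t. min (x n t) R \<partial>M) < e / 2" by simp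
    then obtain N where N: "\<And>n. n \<ge> N \<Longrightarrow> (\<integral>t. min (x n t) R \<partial>M) < e / 2"
      by (auto simp: eventually_sequentially)
    have "norm ((\<integral>t. x n t \<partial>M) - 0) < e" if "n \<ge> N" for n
    proof -
      have mi: "integrable M (\<lambda>t. min (x n t) R)"
      proof (rule Bochner_Integration.integrable_bound[OF xi[of n]])
        show "(\<lambda>t. min (x n t) R) \<in> borel_measurable M" using xm by measurable
      qed (use R in \<open>auto simp: x_def\<close>)
      have "(\<integral>t. x n t \<partial>M) \<le> (\<integral>t. min (x n t) R + (x n t)\<^sup>2 / R \<partial>M)"
      proof (rule integral_mono)
        fix t
        show "x n t \<le> min (x n t) R + (x n t)\<^sup>2 / R"
        proof (cases "x n t \<le> R")
          case False
          hence "x n t * R \<le> x n t * x n t" by (intro mult_left_mono) (auto simp: x_def)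
          hence "x n t \<le> (x n t)\<^sup>2 / R" using R by (simp add: field_simps power2_eq_square)
          thus ?thesis using False R by simp
        qed (use R in simp)
      qed (use mi x2 xi in auto)
      also have "\<dots> = (\<integral>t. min (x n t) R \<partial>M) + (\<integral>t. (x n t)\<^sup>2 \<partial>M) / R"
        using mi x2 by simp
      also have "\<dots> \<le> (\<integral>t. min (x n t) R \<partial>M) + D / R"
        using x2le R by (intro add_left_mono divide_right_mono) auto
      also have "\<dots> < e" using N[OF that] \<open>D / R < e / 2\<close> by linarith
      finally have "(\<integral>t. x n t \<partial>M) < e" .
      moreover have "0 \<le> (\<integral>t. x n t \<partial>M)" by (simp add: x_def)
      ultimately show ?thesis by simp
    qed
    thus "\<exists>N. \<forall>n\<ge>N. norm ((\<integral>t. x n t \<partial>M) - 0) < e" by blast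
  qed
  hence "(\<lambda>n. (\<integral>t. f n t \<partial>M) - (\<integral>t. g t \<partial>M)) \<longlonglongrightarrow> 0"
  proof (rule Lim_null_comparison[rotated], intro always_eventually allI)
    fix n
    have "(\<integral>t. f n t \<partial>M) - (\<integral>t. g t \<partial>M) = (\<integral>t. f n t - g t \<partial>M)"
      by (intro Bochner_Integration.integral_diff[symmetric] int1 f g)
    thus "norm ((\<integral>t. f n t \<partial>M) - (\<integral>t. g t \<partial>M)) \<le> (\<integral>t. x n t \<partial>M)"
      unfolding x_def by (simp only: integral_norm_bound)
  qed
  thus ?thesis by (simp add: LIM_zero_iff)
qed

text \<open>Two limits combined: for a fixed truncation level the approximating polynomials have
  uniformly bounded real parts, so every integral converges by dominated convergence; as the level
  grows, the truncations are controlled by the square of \<open>G\<close> and by 1 + exp (2 * G). A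
  suitable polynomial is chosen at each level.\<close>

lemma exp_trig_approx:
  assumes G: "G \<in> borel_measurable circ" "integrable circ (\<lambda>t. (G t)\<^sup>2)" "integrable circ (\<lambda>t. exp (2 * G t))"
  obtains Q C where "\<And>n. Im (coeff (Q n) 0) = 0"
    "(\<lambda>n. \<integral>t. (G t - Re (poly (Q n) (cis t)))\<^sup>2 \<partial>circ) \<longlonglongrightarrow> 0"
    "\<And>n. (\<integral>t. exp (2 * Re (poly (Q n) (cis t))) \<partial>circ) \<le> C"
    "(\<lambda>n. \<integral>t. exp (2 * (G t - Re (poly (Q n) (cis t)))) \<partial>circ) \<longlonglongrightarrow> 2 * pi"
proof -
  define u where "u M t = max (- real M) (min (real M) (G t))" for M t
  have um [measurable]: "u M \<in> borel_measurable circ" for M unfolding u_def using G(1) by measurable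
  have G1 [measurable]: "G \<in> borel_measurable circ" by (rule G)
  have ub: "\<bar>u M t\<bar> \<le> real M" for M t by (auto simp: u_def)
  have ulim: "(\<lambda>M. u M t) \<longlonglongrightarrow> G t" for t
  proof (rule tendsto_eventually)
    have "\<forall>\<^sub>F M in sequentially. \<bar>G t\<bar> \<le> real M"
      using filterlim_real_sequentially by (auto simp: filterlim_at_top)
    thus "\<forall>\<^sub>F M in sequentially. u M t = G t" by eventually_elim (auto simp: u_def)
  qed
  have a1: "(\<lambda>M. \<integral>t. (G t - u M t)\<^sup>2 \<partial>circ) \<longlonglongrightarrow> (\<integral>t. 0 \<partial>circ)"
  proof (rule integral_dominated_convergence[where w = "\<lambda>t. (G t)\<^sup>2"])
    show "AE t in circ. (\<lambda>M. (G t - u M t)\<^sup>2) \<longlonglongrightarrow> 0"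
    proof (intro always_eventually allI)
      fix t
      have "(\<lambda>M. (G t - u M t)\<^sup>2) \<longlonglongrightarrow> (G t - G t)\<^sup>2"
        by (intro tendsto_intros ulim)
      thus "(\<lambda>M. (G t - u M t)\<^sup>2) \<longlonglongrightarrow> 0" by simp
    qed
    show "AE t in circ. norm ((G t - u M t)\<^sup>2) \<le> (G t)\<^sup>2" for M
    proof (intro always_eventually allI)
      fix t
      have "\<bar>G t - u M t\<bar> \<le> \<bar>G t\<bar>" by (auto simp: u_def)
      thus "norm ((G t - u M t)\<^sup>2) \<le> (G t)\<^sup>2" by (simp add: abs_le_square_iff)
    qed
  qed (use G in auto)
  have a2: "(\<lambda>M. \<integral>t. exp (2 * (G t - u M t)) \<partial>circ) \<longlonglongrightarrow> (\<integral>t. 1 \<partial>circ)"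
  proof (rule integral_dominated_convergence[where w = "\<lambda>t. 1 + exp (2 * G t)"])
    show "AE t in circ. (\<lambda>M. exp (2 * (G t - u M t))) \<longlonglongrightarrow> 1"
    proof (intro always_eventually allI)
      fix t
      have "(\<lambda>M. exp (2 * (G t - u M t))) \<longlonglongrightarrow> exp (2 * (G t - G t))"
        by (intro tendsto_intros ulim)
      thus "(\<lambda>M. exp (2 * (G t - u M t))) \<longlonglongrightarrow> 1" by simp
    qed
    show "AE t in circ. norm (exp (2 * (G t - u M t))) \<le> 1 + exp (2 * G t)" for M
    proof (intro always_eventually allI)
      fix t
      \<comment> \<open>Truncation moves \<open>G\<close> towards 0: above \<open>M\<close> the
        error is at most \<open>G\<close>, below -M it is negative, and in between it is 0.\<close>
      have "G t - u M t \<le> 0 \<or> G t - u M t \<le> G t" by (auto simp: u_def)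
      hence "exp (2 * (G t - u M t)) \<le> 1 \<or> exp (2 * (G t - u M t)) \<le> exp (2 * G t)" by auto
      moreover have "0 < exp (2 * G t)" by simp
      ultimately have "exp (2 * (G t - u M t)) \<le> 1 + exp (2 * G t)" by linarith
      thus "norm (exp (2 * (G t - u M t))) \<le> 1 + exp (2 * G t)" by simp
    qed
  qed (use G in auto)
  \<comment> \<open>The leading 1 leaves room for the error in replacing a truncation by a
    polynomial.\<close>
  define C where "C = 1 + (\<integral>t. 1 + exp (2 * G t) \<partial>circ)"
  have expu: "integrable circ (\<lambda>t. exp (2 * u M t))" for M
  proof (rule circ.integrable_const_bound)
    show "AE t in circ. norm (exp (2 * u M t)) \<le> exp (2 * real M)"
      using ub[of M] by (auto simp: abs_le_iff)
  qed measurable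
  have a3: "(\<integral>t. exp (2 * u M t) \<partial>circ) \<le> C - 1" for M
  proof -
    have "(\<integral>t. exp (2 * u M t) \<partial>circ) \<le> (\<integral>t. 1 + exp (2 * G t) \<partial>circ)"
    proof (rule integral_mono)
      fix t
      have "u M t \<le> 0 \<or> u M t \<le> G t" by (auto simp: u_def)
      hence "exp (2 * u M t) \<le> 1 \<or> exp (2 * u M t) \<le> exp (2 * G t)" by auto
      moreover have "0 < exp (2 * G t)" by simp
      ultimately show "exp (2 * u M t) \<le> 1 + exp (2 * G t)" by linarith
    qed (use G expu in auto)
    thus ?thesis by (simp add: C_def)
  qed
  define P where "P M Q \<longleftrightarrow> Im (coeff Q 0) = 0 \<and> (\<integral>t. (u M t - Re (poly Q (cis t)))\<^sup>2 \<partial>circ) < inverse (Suc M) \<and>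
      (\<integral>t. exp (2 * Re (poly Q (cis t))) \<partial>circ) < (\<integral>t. exp (2 * u M t) \<partial>circ) + 1 \<and>
      dist (\<integral>t. exp (2 * (G t - Re (poly Q (cis t)))) \<partial>circ) (\<integral>t. exp (2 * (G t - u M t)) \<partial>circ) < inverse (Suc M)"
    for M Q
  have "\<exists>Q. P M Q" for M
  proof -
    obtain Q where Q: "\<And>n. Im (coeff (Q n) 0) = 0"
      "\<And>n t. t \<in> {0..2*pi} \<Longrightarrow> \<bar>Re (poly (Q n) (cis t))\<bar> \<le> real M + 1"
      "AE t in circ. (\<lambda>n. Re (poly (Q n) (cis t))) \<longlonglongrightarrow> u M t"
      using bounded_trig_approx[of "u M" "real M"] ub um by blast
    have Qm [measurable]: "(\<lambda>t. Re (poly (Q n) (cis t))) \<in> borel_measurable circ" for n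
      by (intro borel_measurable_circ_continuous continuous_intros)
    have b1: "(\<lambda>n. \<integral>t. (u M t - Re (poly (Q n) (cis t)))\<^sup>2 \<partial>circ) \<longlonglongrightarrow> (\<integral>t. 0 \<partial>circ)"
    proof (rule integral_dominated_convergence[where w = "\<lambda>t. (2 * real M + 1)\<^sup>2"])
      show "AE t in circ. (\<lambda>n. (u M t - Re (poly (Q n) (cis t)))\<^sup>2) \<longlonglongrightarrow> 0"
        using Q(3)
      proof eventually_elim
        case (elim t)
        from tendsto_power[OF tendsto_diff[OF tendsto_const elim], of "u M t" 2] show ?case by simp
      qed
      show "AE t in circ. norm ((u M t - Re (poly (Q n) (cis t)))\<^sup>2) \<le> (2 * real M + 1)\<^sup>2" for n
        using AE_space
      proof eventually_elim
        case (elim t)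
        have "\<bar>u M t - Re (poly (Q n) (cis t))\<bar> \<le> 2 * real M + 1"
          using ub[of M t] Q(2)[of t n] elim by auto
        hence "\<bar>u M t - Re (poly (Q n) (cis t))\<bar>\<^sup>2 \<le> (2 * real M + 1)\<^sup>2"
          by (rule power_mono) simp
        thus ?case by (simp only: power2_abs real_norm_def abs_power2)
      qed
    qed auto
    have b2: "(\<lambda>n. \<integral>t. exp (2 * Re (poly (Q n) (cis t))) \<partial>circ) \<longlonglongrightarrow> (\<integral>t. exp (2 * u M t) \<partial>circ)"
    proof (rule integral_dominated_convergence[where w = "\<lambda>t. exp (2 * (real M + 1))"])
      show "AE t in circ. (\<lambda>n. exp (2 * Re (poly (Q n) (cis t)))) \<longlonglongrightarrow> exp (2 * u M t)"
        using Q(3) by eventually_elim (intro tendsto_intros)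
      show "AE t in circ. norm (exp (2 * Re (poly (Q n) (cis t)))) \<le> exp (2 * (real M + 1))" for n
        using AE_space
      proof eventually_elim
        case (elim t)
        thus ?case using Q(2)[of t n] by (simp add: abs_le_iff)
      qed
    qed auto
    have b3: "(\<lambda>n. \<integral>t. exp (2 * (G t - Re (poly (Q n) (cis t)))) \<partial>circ) \<longlonglongrightarrow> (\<integral>t. exp (2 * (G t - u M t)) \<partial>circ)"
    proof (rule integral_dominated_convergence[where w = "\<lambda>t. exp (2 * (real M + 1)) * exp (2 * G t)"])
      show "AE t in circ. (\<lambda>n. exp (2 * (G t - Re (poly (Q n) (cis t))))) \<longlonglongrightarrow> exp (2 * (G t - u M t))"
        using Q(3) by eventually_elim (intro tendsto_intros)
      show "AE t in circ. norm (exp (2 * (G t - Re (poly (Q n) (cis t))))) \<le> exp (2 * (real M + 1)) * exp (2 * G t)" for n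
        using AE_space
      proof eventually_elim
        case (elim t)
        thus ?case using Q(2)[of t n] by (simp add: abs_le_iff exp_add[symmetric])
      qed
      show "integrable circ (\<lambda>t. exp (2 * (real M + 1)) * exp (2 * G t))" using G(3) by simp
    qed auto
    have "\<forall>\<^sub>F n in sequentially. (\<integral>t. (u M t - Re (poly (Q n) (cis t)))\<^sup>2 \<partial>circ) < inverse (Suc M)"
      using order_tendstoD(2)[OF b1, of "inverse (Suc M)"] by simp
    moreover have "\<forall>\<^sub>F n in sequentially. (\<integral>t. exp (2 * Re (poly (Q n) (cis t))) \<partial>circ) < (\<integral>t. exp (2 * u M t) \<partial>circ) + 1"
      using order_tendstoD(2)[OF b2] by simp
    moreover have "\<forall>\<^sub>F n in sequentially. dist (\<integral>t. exp (2 * (G t - Re (poly (Q n) (cis t)))) \<partial>circ)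
        (\<integral>t. exp (2 * (G t - u M t)) \<partial>circ) < inverse (Suc M)"
      using tendstoD[OF b3, of "inverse (Suc M)"] by simp
    ultimately have "\<forall>\<^sub>F n in sequentially. P M (Q n)"
      unfolding P_def by eventually_elim (simp only: Q(1) simp_thms)
    from eventually_happens'[OF _ this] show ?thesis by auto
  qed
  then obtain Q where "\<And>M. P M (Q M)" by metis
  hence Q: "\<And>M. Im (coeff (Q M) 0) = 0"
    "\<And>M. (\<integral>t. (u M t - Re (poly (Q M) (cis t)))\<^sup>2 \<partial>circ) < inverse (Suc M)"
    "\<And>M. (\<integral>t. exp (2 * Re (poly (Q M) (cis t))) \<partial>circ) < (\<integral>t. exp (2 * u M t) \<partial>circ) + 1"
    "\<And>M. dist (\<integral>t. exp (2 * (G t - Re (poly (Q M) (cis t)))) \<partial>circ) (\<integral>t. exp (2 * (G t - u M t)) \<partial>circ) < inverse (Suc M)"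
    unfolding P_def by blast+
  have inv: "(\<lambda>M. inverse (real (Suc M))) \<longlonglongrightarrow> 0" by (rule LIMSEQ_inverse_real_of_nat)
  show ?thesis
  proof
    show "Im (coeff (Q n) 0) = 0" for n by (rule Q)
    show "(\<integral>t. exp (2 * Re (poly (Q n) (cis t))) \<partial>circ) \<le> C" for n using Q(3)[of n] a3[of n] by simp
    show "(\<lambda>n. \<integral>t. exp (2 * (G t - Re (poly (Q n) (cis t)))) \<partial>circ) \<longlonglongrightarrow> 2 * pi"
    proof -
      have "(\<lambda>n. (\<integral>t. exp (2 * (G t - Re (poly (Q n) (cis t)))) \<partial>circ) - (\<integral>t. exp (2 * (G t - u n t)) \<partial>circ)) \<longlonglongrightarrow> 0"
        by (rule Lim_null_comparison[OF _ inv], intro always_eventually allI)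
           (use Q(4) in \<open>simp add: dist_norm less_imp_le\<close>)
      from tendsto_add[OF this a2] measure_circ show ?thesis by simp
    qed
    show "(\<lambda>n. \<integral>t. (G t - Re (poly (Q n) (cis t)))\<^sup>2 \<partial>circ) \<longlonglongrightarrow> 0"
    proof (rule Lim_null_comparison)
      show "(\<lambda>n. 2 * (\<integral>t. (G t - u n t)\<^sup>2 \<partial>circ) + 2 * inverse (real (Suc n))) \<longlonglongrightarrow> 0"
        using tendsto_add[OF tendsto_mult[OF tendsto_const[of 2] a1] tendsto_mult[OF tendsto_const[of 2] inv]] by simp
      show "\<forall>\<^sub>F n in sequentially. norm (\<integral>t. (G t - Re (poly (Q n) (cis t)))\<^sup>2 \<partial>circ)
          \<le> 2 * (\<integral>t. (G t - u n t)\<^sup>2 \<partial>circ) + 2 * inverse (real (Suc n))"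
      proof (intro always_eventually allI)
        fix n
        have u2: "integrable circ (\<lambda>t. (u n t)\<^sup>2)"
        proof (rule circ.integrable_const_bound[where B = "(real n)\<^sup>2"])
          show "AE t in circ. norm ((u n t)\<^sup>2) \<le> (real n)\<^sup>2"
            using ub[of n] by (intro always_eventually allI) (simp add: abs_le_square_iff[symmetric])
        qed measurable
        have i1: "integrable circ (\<lambda>t. (u n t - Re (poly (Q n) (cis t)))\<^sup>2)"
          by (intro integrable_diff_square um u2 continuous_intros)
        have i0: "integrable circ (\<lambda>t. (G t - Re (poly (Q n) (cis t)))\<^sup>2)"
          by (intro integrable_diff_square G continuous_intros)
        have i2: "integrable circ (\<lambda>t. (G t - u n t)\<^sup>2)"
          by (rule Bochner_Integration.integrable_bound[OF G(2)])
             (auto intro!: always_eventually simp: abs_le_square_iff[symmetric] u_def)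
        have "(\<integral>t. (G t - Re (poly (Q n) (cis t)))\<^sup>2 \<partial>circ)
          \<le> (\<integral>t. 2 * (G t - u n t)\<^sup>2 + 2 * (u n t - Re (poly (Q n) (cis t)))\<^sup>2 \<partial>circ)"
        proof (rule integral_mono)
          fix t
          have "(a + b)\<^sup>2 \<le> 2 * a\<^sup>2 + 2 * b\<^sup>2" for a b :: real
            using sum_squares_bound[of a b] by (simp add: power2_sum)
          from this[of "G t - u n t" "u n t - Re (poly (Q n) (cis t))"]
          show "(G t - Re (poly (Q n) (cis t)))\<^sup>2 \<le> 2 * (G t - u n t)\<^sup>2 + 2 * (u n t - Re (poly (Q n) (cis t)))\<^sup>2"
            by simp
        qed (use i0 i1 i2 in auto)
        also have "\<dots> \<le> 2 * (\<integral>t. (G t - u n t)\<^sup>2 \<partial>circ) + 2 * inverse (real (Suc n))"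
          using i1 i2 Q(2)[of n] by simp
        finally show "norm (\<integral>t. (G t - Re (poly (Q n) (cis t)))\<^sup>2 \<partial>circ)
          \<le> 2 * (\<integral>t. (G t - u n t)\<^sup>2 \<partial>circ) + 2 * inverse (real (Suc n))" by simp
      qed
    qed
  qed
qed

section \<open>Outer functions and the polynomial extremal problem\<close>

lemma poly_cis_bounded:
  obtains K where "\<And>t. norm (poly P (cis t)) \<le> K"
proof -
  have "norm (poly P (cis t)) \<le> (\<Sum>k\<le>degree P. norm (coeff P k))" for t
    unfolding poly_altdef by (rule norm_sum[THEN order.trans]) (simp add: norm_mult norm_power)
  from that[OF this] show ?thesis .
qed

text \<open>The Taylor sums of exp R have constant coefficient 1 because R(0) = 0. On the circle
  they converge to exp R and stay below exp K, where \<open>K\<close> bounds |R| there, so dominated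
  convergence applies.\<close>

lemma exp_polynomial_approx:
  fixes R :: "complex poly"
  assumes R: "coeff R 0 = 0" and G: "integrable circ (\<lambda>t. exp (2 * G t))" "G \<in> borel_measurable circ" and e: "0 < e"
  obtains P where "coeff P 0 = 1"
    "(\<integral>t. (norm (poly P (cis t)))\<^sup>2 * exp (2 * G t) \<partial>circ) < (\<integral>t. exp (2 * (G t + Re (poly R (cis t)))) \<partial>circ) + e"
proof -
  define T where "T N = (\<Sum>i<N. smult (1 / fact i) (R ^ i))" for N
  have T: "poly (T N) z = (\<Sum>i<N. (poly R z) ^ i /\<^sub>R fact i)" for N z
    by (simp add: T_def poly_sum scaleR_conv_of_real field_simps)
  obtain K where K: "\<And>t. norm (poly R (cis t)) \<le> K" by (rule poly_cis_bounded) (rule that)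
  have "(\<lambda>N. \<integral>t. (norm (poly (T N) (cis t)))\<^sup>2 * exp (2 * G t) \<partial>circ)
     \<longlonglongrightarrow> (\<integral>t. exp (2 * (G t + Re (poly R (cis t)))) \<partial>circ)"
  proof (rule integral_dominated_convergence[where w = "\<lambda>t. (exp K)\<^sup>2 * exp (2 * G t)"])
    show "AE t in circ. (\<lambda>N. (norm (poly (T N) (cis t)))\<^sup>2 * exp (2 * G t))
        \<longlonglongrightarrow> exp (2 * (G t + Re (poly R (cis t))))"
    proof (intro always_eventually allI)
      fix t
      have "(\<lambda>N. poly (T N) (cis t)) \<longlonglongrightarrow> exp (poly R (cis t))"
        unfolding T using exp_converges[of "poly R (cis t)"] by (simp add: sums_def)
      hence "(\<lambda>N. (norm (poly (T N) (cis t)))\<^sup>2 * exp (2 * G t))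
         \<longlonglongrightarrow> (norm (exp (poly R (cis t))))\<^sup>2 * exp (2 * G t)"
        by (intro tendsto_intros)
      also have "(norm (exp (poly R (cis t))))\<^sup>2 * exp (2 * G t) = exp (2 * (G t + Re (poly R (cis t))))"
        by (simp add: power2_eq_square exp_add[symmetric])
      finally show "(\<lambda>N. (norm (poly (T N) (cis t)))\<^sup>2 * exp (2 * G t))
        \<longlonglongrightarrow> exp (2 * (G t + Re (poly R (cis t))))" .
    qed
    show "AE t in circ. norm ((norm (poly (T N) (cis t)))\<^sup>2 * exp (2 * G t)) \<le> (exp K)\<^sup>2 * exp (2 * G t)" for N
      using AE_space
    proof eventually_elim
      case (elim t)
      have "norm (poly (T N) (cis t)) \<le> (\<Sum>i<N. (norm (poly R (cis t))) ^ i /\<^sub>R fact i)"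
        unfolding T by (rule order.trans[OF norm_sum]) (simp add: norm_power)
      also have "\<dots> \<le> exp (norm (poly R (cis t)))"
        using exp_converges[of "norm (poly R (cis t))"]
        by (intro sum_le_suminf[THEN order.trans]) (auto simp: sums_iff)
      also have "\<dots> \<le> exp K" using K elim by simp
      finally have "(norm (poly (T N) (cis t)))\<^sup>2 \<le> (exp K)\<^sup>2" by (rule power_mono) simp
      thus ?case by (simp add: mult_right_mono abs_mult)
    qed
    have G2 [measurable]: "G \<in> borel_measurable circ" by (rule G)
    have m [measurable]: "(\<lambda>t. poly Q (cis t)) \<in> borel_measurable circ" for Q
      by (intro borel_measurable_circ_continuous continuous_intros)
    show "(\<lambda>t. exp (2 * (G t + Re (poly R (cis t))))) \<in> borel_measurable circ" by measurable
    show "(\<lambda>t. (norm (poly (T N) (cis t)))\<^sup>2 * exp (2 * G t)) \<in> borel_measurable circ" for N by measurable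
  qed (use G in simp)
  from order_tendstoD(2)[OF this, of "(\<integral>t. exp (2 * (G t + Re (poly R (cis t)))) \<partial>circ) + e"] e
  have "\<forall>\<^sub>F N in sequentially. (\<integral>t. (norm (poly (T N) (cis t)))\<^sup>2 * exp (2 * G t) \<partial>circ)
      < (\<integral>t. exp (2 * (G t + Re (poly R (cis t)))) \<partial>circ) + e" by simp
  with eventually_ge_at_top[of 1]
  have "\<forall>\<^sub>F N in sequentially. N \<ge> 1 \<and> (\<integral>t. (norm (poly (T N) (cis t)))\<^sup>2 * exp (2 * G t) \<partial>circ)
      < (\<integral>t. exp (2 * (G t + Re (poly R (cis t)))) \<partial>circ) + e" by eventually_elim simp
  from eventually_happens'[OF _ this] obtain N where N: "N \<ge> 1"
    "(\<integral>t. (norm (poly (T N) (cis t)))\<^sup>2 * exp (2 * G t) \<partial>circ)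
      < (\<integral>t. exp (2 * (G t + Re (poly R (cis t)))) \<partial>circ) + e" by auto
  have "coeff (T N) 0 = poly (T N) 0" by (simp add: poly_0_coeff_0)
  also have "\<dots> = (\<Sum>i<N. 0 ^ i /\<^sub>R fact i)" unfolding T by (simp add: poly_0_coeff_0 R)
  also have "\<dots> = (\<Sum>i<N. if i = 0 then 1 else 0)" by (intro sum.cong) auto
  also have "\<dots> = 1" using N(1) by simp
  finally show ?thesis using that N(2) by blast
qed

text \<open>exp H is the boundary function of the outer function with modulus exp G, and exp l is
  its value at 0. The fourth conclusion is the mean value property; the last says that polynomials
  with P(0) = 1 come arbitrarily close to 2 pi exp (2 l) in the weighted extremal problem.\<close>

lemma outer_function:
  assumes G: "G \<in> borel_measurable circ" "integrable circ (\<lambda>t. (G t)\<^sup>2)" "integrable circ (\<lambda>t. exp (2 * G t))"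
  obtains H l where "H \<in> borel_measurable circ"
    "AE t in circ. ((\<lambda>r. herglotz G (of_real r * cis t)) \<longlongrightarrow> H t) (at_left 1)"
    "AE t in circ. Re (H t) = G t"
    "\<And>P. (\<integral>t. poly P (cis t) * exp (H t) \<partial>circ) = 2 * pi * coeff P 0 * of_real (exp l)"
    "\<And>e. 0 < e \<Longrightarrow> \<exists>P. coeff P 0 = 1 \<and> (\<integral>t. (norm (poly P (cis t)))\<^sup>2 * exp (2 * G t) \<partial>circ) < 2 * pi * exp (2 * l) + e"
proof -
  obtain Q C where Q: "\<And>n. Im (coeff (Q n) 0) = 0"
    "(\<lambda>n. \<integral>t. (G t - Re (poly (Q n) (cis t)))\<^sup>2 \<partial>circ) \<longlonglongrightarrow> 0"
    "\<And>n. (\<integral>t. exp (2 * Re (poly (Q n) (cis t))) \<partial>circ) \<le> C"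
    "(\<lambda>n. \<integral>t. exp (2 * (G t - Re (poly (Q n) (cis t)))) \<partial>circ) \<longlonglongrightarrow> 2 * pi"
    using exp_trig_approx[OF G] by blast
  obtain s H where s: "filterlim s at_top sequentially"
    and H: "AE t in circ. (\<lambda>n. poly (Q (s n)) (cis t)) \<longlonglongrightarrow> H t"
    "AE t in circ. ((\<lambda>r. herglotz G (of_real r * cis t)) \<longlongrightarrow> H t) (at_left 1)"
    "AE t in circ. Re (H t) = G t" "H \<in> borel_measurable circ"
    using herglotz_boundary[OF G(1,2) Q(1,2)] by blast
  define q where "q n = Re (coeff (Q n) 0)" for n
  have q: "coeff (Q n) 0 = of_real (q n)" for n using Q(1)[of n] by (simp add: q_def complex_eq_iff)
  define l where "l = Re (herglotz_coeff G 0)"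
  \<comment> \<open>The constant coefficient of the difference is bounded by the L2 distance, by
    Bessel's inequality with a single term.\<close>
  have ql: "q \<longlonglongrightarrow> l"
  proof -
    have "(\<lambda>n. (l - q n)\<^sup>2) \<longlonglongrightarrow> 0"
    proof (rule tendsto_sandwich[OF _ _ tendsto_const Q(2)], goal_cases)
      case 2
      have "(l - q n)\<^sup>2 \<le> (\<integral>t. (G t - Re (poly (Q n) (cis t)))\<^sup>2 \<partial>circ)" for n
      proof -
        let ?D = "\<lambda>t. G t - Re (poly (Q n) (cis t))"
        have m: "(\<lambda>t. Re (poly (Q n) (cis t))) \<in> borel_measurable circ"
          by (intro borel_measurable_circ_continuous continuous_intros)
        have i: "integrable circ (\<lambda>t. Re (poly (Q n) (cis t)))"
          by (intro continuous_circ(1) continuous_intros)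
        have "herglotz_coeff ?D 0 = herglotz_coeff G 0 - coeff (Q n) 0"
          using herglotz_coeff_diff[OF integrable_circ_of_square[OF G(1,2)] i, of 0]
            herglotz_coeff_poly[OF Q(1), of n 0] by simp
        hence "l - q n = Re (herglotz_coeff ?D 0)" by (simp add: l_def q_def)
        hence "(l - q n)\<^sup>2 \<le> (norm (herglotz_coeff ?D 0))\<^sup>2"
          using abs_Re_le_cmod[of "herglotz_coeff ?D 0"] by (simp add: abs_le_square_iff[symmetric])
        also have "\<dots> \<le> (\<integral>t. (?D t)\<^sup>2 \<partial>circ)"
          using herglotz_coeff_bessel[OF borel_measurable_diff[OF G(1) m] integrable_diff_square[OF G(1,2)], of 1]
          by (simp add: continuous_intros)
        finally show ?thesis .
      qed
      thus ?case by (intro always_eventually allI)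
    qed simp
    from tendsto_real_sqrt[OF this] have "(\<lambda>n. l - q n) \<longlonglongrightarrow> 0"
      by (simp add: tendsto_rabs_zero_iff)
    from tendsto_diff[OF tendsto_const[of l] this] show ?thesis by simp
  qed
  show ?thesis
  proof
    show "H \<in> borel_measurable circ"
      "AE t in circ. ((\<lambda>r. herglotz G (of_real r * cis t)) \<longlongrightarrow> H t) (at_left 1)"
      "AE t in circ. Re (H t) = G t" by (fact H)+
    show "(\<integral>t. poly P (cis t) * exp (H t) \<partial>circ) = 2 * pi * coeff P 0 * of_real (exp l)" for P
    proof (rule LIMSEQ_unique)
      obtain K where K: "\<And>t. norm (poly P (cis t)) \<le> K" by (rule poly_cis_bounded) (rule that)
      have Pm [measurable]: "(\<lambda>t. poly P (cis t)) \<in> borel_measurable circ" for P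
        by (intro borel_measurable_circ_continuous continuous_intros)
      have Hm [measurable]: "H \<in> borel_measurable circ" by (rule H)
      have Gm [measurable]: "G \<in> borel_measurable circ" by (rule G)
      \<comment> \<open>The mean value property is evident for the entire functions P * exp Q. Their
        L2 norms on the circle are bounded because those of exp Q are, so the integrals pass to the
        limit.\<close>
      define f where "f n t = poly P (cis t) * exp (poly (Q (s n)) (cis t))" for n t
      have cf: "continuous_on S (f n)" for n S unfolding f_def by (intro continuous_intros)
      show "(\<lambda>n. \<integral>t. f n t \<partial>circ) \<longlonglongrightarrow> (\<integral>t. poly P (cis t) * exp (H t) \<partial>circ)"
      proof (rule tendsto_integral_of_L2_bounded[OF finite_measure_circ])
        show "f n \<in> borel_measurable circ" for n unfolding f_def by measurable
        show "(\<lambda>t. poly P (cis t) * exp (H t)) \<in> borel_measurable circ" by measurable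
        show i: "integrable circ (\<lambda>t. (norm (f n t))\<^sup>2)" for n
          by (intro continuous_circ(1) continuous_intros cf)
        show "AE t in circ. (\<lambda>n. f n t) \<longlonglongrightarrow> poly P (cis t) * exp (H t)"
          using H(1) unfolding f_def by eventually_elim (intro tendsto_intros)
        show "(\<integral>t. (norm (f n t))\<^sup>2 \<partial>circ) \<le> K\<^sup>2 * C" for n
        proof -
          have "(\<integral>t. (norm (f n t))\<^sup>2 \<partial>circ) \<le> (\<integral>t. K\<^sup>2 * exp (2 * Re (poly (Q (s n)) (cis t))) \<partial>circ)"
          proof (rule integral_mono[OF i])
            show "integrable circ (\<lambda>t. K\<^sup>2 * exp (2 * Re (poly (Q (s n)) (cis t))))"
              by (intro continuous_circ(1) continuous_intros)
            fix t assume "t \<in> space circ"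
            hence "(norm (poly P (cis t)))\<^sup>2 \<le> K\<^sup>2" using K by (intro power_mono) auto
            thus "(norm (f n t))\<^sup>2 \<le> K\<^sup>2 * exp (2 * Re (poly (Q (s n)) (cis t)))"
              by (simp add: f_def norm_mult power_mult_distrib exp_double mult_right_mono)
          qed
          also have "\<dots> = K\<^sup>2 * (\<integral>t. exp (2 * Re (poly (Q (s n)) (cis t))) \<partial>circ)" by simp
          also have "\<dots> \<le> K\<^sup>2 * C" by (intro mult_left_mono Q) auto
          finally show ?thesis .
        qed
        show "integrable circ (\<lambda>t. (norm (poly P (cis t) * exp (H t)))\<^sup>2)"
        proof (rule Bochner_Integration.integrable_bound)
          show "integrable circ (\<lambda>t. K\<^sup>2 * exp (2 * G t))" using G(3) by simp
          show "AE t in circ. norm ((norm (poly P (cis t) * exp (H t)))\<^sup>2) \<le> norm (K\<^sup>2 * exp (2 * G t))"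
            using AE_space H(3)
          proof eventually_elim
            case (elim t)
            hence "(norm (poly P (cis t)))\<^sup>2 \<le> K\<^sup>2" using K by (intro power_mono) auto
            thus ?case
              using elim by (simp add: norm_mult power_mult_distrib exp_double mult_right_mono abs_mult)
          qed
        qed measurable
      qed
      have "(\<integral>t. f n t \<partial>circ) = 2 * pi * coeff P 0 * of_real (exp (q (s n)))" for n
      proof -
        have "((\<lambda>t. poly P (cis t) * exp (poly (Q (s n)) (cis t))) has_integral
            (2 * pi * (poly P 0 * exp (poly (Q (s n)) 0)))) {0..2*pi}"
          by (rule has_integral_mean_value_cis) (auto intro!: continuous_intros holomorphic_intros)
        hence "integral {0..2*pi} (f n) = 2 * pi * (poly P 0 * exp (poly (Q (s n)) 0))"
          unfolding f_def by (rule integral_unique)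
        thus ?thesis unfolding continuous_circ(2)[OF cf]
          by (simp add: poly_0_coeff_0 q exp_of_real)
      qed
      moreover have "(\<lambda>n. 2 * pi * coeff P 0 * of_real (exp (q (s n)))) \<longlonglongrightarrow> 2 * pi * coeff P 0 * of_real (exp l)"
        by (intro tendsto_intros filterlim_compose[OF ql s])
      ultimately show "(\<lambda>n. \<integral>t. f n t \<partial>circ) \<longlonglongrightarrow> 2 * pi * coeff P 0 * of_real (exp l)" by simp
    qed
    fix e :: real assume e: "0 < e"
    have "(\<lambda>n. exp (2 * q n) * (\<integral>t. exp (2 * (G t - Re (poly (Q n) (cis t)))) \<partial>circ)) \<longlonglongrightarrow> exp (2 * l) * (2 * pi)"
      by (intro tendsto_intros ql Q)
    from order_tendstoD(2)[OF this, of "2 * pi * exp (2 * l) + e / 2"] e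
    have "\<forall>\<^sub>F n in sequentially. exp (2 * q n) * (\<integral>t. exp (2 * (G t - Re (poly (Q n) (cis t)))) \<partial>circ) < 2 * pi * exp (2 * l) + e / 2"
      by (simp add: mult.commute)
    from eventually_happens'[OF _ this] obtain n where
      n: "exp (2 * q n) * (\<integral>t. exp (2 * (G t - Re (poly (Q n) (cis t)))) \<partial>circ) < 2 * pi * exp (2 * l) + e / 2" by auto
    \<comment> \<open>exp R normalises exp (-Q) to the value 1 at 0 and is thus nearly extremal: its
      weighted mean square approaches that of exp (l - H).\<close>
    define R where "R = [: of_real (q n) :] - Q n"
    have R0: "coeff R 0 = 0" by (simp add: R_def q)
    obtain P where P: "coeff P 0 = 1"
      "(\<integral>t. (norm (poly P (cis t)))\<^sup>2 * exp (2 * G t) \<partial>circ) < (\<integral>t. exp (2 * (G t + Re (poly R (cis t)))) \<partial>circ) + e / 2"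
      using exp_polynomial_approx[OF R0 G(3) G(1), of "e / 2"] e by auto
    have "(\<integral>t. exp (2 * (G t + Re (poly R (cis t)))) \<partial>circ)
      = (\<integral>t. exp (2 * q n) * exp (2 * (G t - Re (poly (Q n) (cis t)))) \<partial>circ)"
      by (simp add: R_def exp_add[symmetric] algebra_simps)
    also have "\<dots> = exp (2 * q n) * (\<integral>t. exp (2 * (G t - Re (poly (Q n) (cis t)))) \<partial>circ)" by simp
    finally show "\<exists>P. coeff P 0 = 1 \<and> (\<integral>t. (norm (poly P (cis t)))\<^sup>2 * exp (2 * G t) \<partial>circ) < 2 * pi * exp (2 * l) + e"
      using P n by (intro exI[of _ P]) linarith
  qed
qed

section \<open>Orthonormal polynomials of an A2 weight\<close>

locale A2_weight =
  fixes w :: "complex \<Rightarrow> real"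
  assumes weight: "weight w" and normalized: "normalized w" and A2: "A2_char w < \<infinity>"
begin

section \<open>Integrability consequences of the A2 condition\<close>

abbreviation "v t \<equiv> w (cis t)"

lemma v_nonneg [simp]: "0 \<le> v t"
  using weight by (simp add: weight_def)

lemma v_measurable [measurable]: "(\<lambda>t. v t) \<in> borel_measurable circ"
  using weight unfolding weight_def circ_def by (auto intro: measurable_restrict_space1)

lemma v_integrable: "integrable circ (\<lambda>t. v t)" and v_integral: "(\<integral>t. v t \<partial>circ) = 2 * pi"
proof -
  have n: "(\<integral>\<^sup>+t. ennreal (v t / (2*pi)) \<partial>circ) = ennreal 1"
    using normalized by (simp add: normalized_def)
  have i: "integrable circ (\<lambda>t. v t / (2*pi))"
    by (rule integrableI_nn_integral_finite[OF _ _ n]) auto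
  have "(\<integral>t. v t / (2*pi) \<partial>circ) = 1"
    by (rule integral_eq_nn_integral[THEN trans]) (auto simp: n)
  thus "(\<integral>t. v t \<partial>circ) = 2 * pi" by simp
  from integrable_mult_left[OF i, of "2 * pi"] show "integrable circ (\<lambda>t. v t)" by simp
qed

text \<open>The whole circle is an admissible arc, and the normalisation makes the average of the
  weight over it 1. Hence the average of the inverse is at most the A2 characteristic.\<close>

lemma nn_integral_inverse_v: "(\<integral>\<^sup>+t. inverse (ennreal (v t)) \<partial>circ) < \<infinity>"
proof -
  have "arc_average 0 (2*pi) (\<lambda>z. ennreal (w z)) * arc_average 0 (2*pi) (\<lambda>z. inverse (ennreal (w z))) \<le> A2_char w"
    unfolding A2_char_def by (rule SUP_upper2[of "(0, 2*pi)"]) auto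
  moreover have "arc_average 0 (2*pi) (\<lambda>z. ennreal (w z)) = 1"
  proof -
    have "(\<integral>\<^sup>+t. ennreal (v t) \<partial>circ) = ennreal (2 * pi)"
      using nn_integral_eq_integral[OF v_integrable] v_integral by simp
    thus ?thesis by (simp add: arc_average_def circ_def[symmetric] ennreal_divide_self)
  qed
  ultimately have "(\<integral>\<^sup>+t. inverse (ennreal (v t)) \<partial>circ) / ennreal (2 * pi) < \<infinity>"
    using A2 by (simp add: arc_average_def circ_def[symmetric])
  thus ?thesis
    by (cases "(\<integral>\<^sup>+t. inverse (ennreal (v t)) \<partial>circ) = top") (auto simp: ennreal_top_divide less_top)
qed

lemma AE_v_pos: "AE t in circ. 0 < v t"
proof -
  have "AE t in circ. inverse (ennreal (v t)) \<noteq> \<infinity>"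
    by (rule nn_integral_noteq_infinite) (use nn_integral_inverse_v in auto)
  thus ?thesis
  proof eventually_elim
    case (elim t)
    hence "v t \<noteq> 0" by auto
    thus ?case using v_nonneg[of t] by linarith
  qed
qed

lemma inverse_v_integrable: "integrable circ (\<lambda>t. 1 / v t)"
proof (rule integrableI_nonneg)
  have "(\<integral>\<^sup>+t. ennreal (1 / v t) \<partial>circ) = (\<integral>\<^sup>+t. inverse (ennreal (v t)) \<partial>circ)"
    by (rule nn_integral_cong_AE, use AE_v_pos in eventually_elim) (simp add: inverse_ennreal inverse_eq_divide)
  thus "(\<integral>\<^sup>+t. ennreal (1 / v t) \<partial>circ) < \<infinity>" using nn_integral_inverse_v by simp
qed auto

text \<open>The function \<open>G\<close> to which the Herglotz results are applied. Where the
  weight vanishes its value is a mere convention, but this happens only on a null set.\<close>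

definition logv :: "real \<Rightarrow> real" where
  "logv t = ln (sqrt (v t))"

lemma logv_measurable [measurable]: "logv \<in> borel_measurable circ"
  unfolding logv_def by measurable

lemma exp_logv: "AE t in circ. exp (2 * logv t) = v t"
  using AE_v_pos by eventually_elim (simp add: logv_def ln_sqrt)

lemma integrable_exp_logv: "integrable circ (\<lambda>t. exp (2 * logv t))"
  by (rule integrable_cong_AE_imp[OF v_integrable])
    (measurable, use exp_logv in \<open>eventually_elim, simp\<close>)

text \<open>For x \<ge> 1 the square of ln (sqrt x) is at most x. Applied to \<open>v\<close> where
  it is at least 1 and to 1 / v elsewhere, this gives the integrable bound v + 1 / v.\<close>

lemma logv_square_integrable: "integrable circ (\<lambda>t. (logv t)\<^sup>2)"
proof (rule Bochner_Integration.integrable_bound)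
  show "integrable circ (\<lambda>t. v t + 1 / v t)"
    using v_integrable inverse_v_integrable by simp
  show "AE t in circ. norm ((logv t)\<^sup>2) \<le> norm (v t + 1 / v t)"
    using AE_v_pos
  proof eventually_elim
    case (elim t)
    have *: "0 \<le> ln (sqrt x) \<and> (ln (sqrt x))\<^sup>2 \<le> x" if "1 \<le> x" for x :: real
    proof -
      have "ln (sqrt x) \<le> sqrt x - 1" using that by (intro ln_le_minus_one) simp
      moreover have "0 \<le> ln (sqrt x)" using that by (simp add: ln_ge_zero)
      ultimately have "(ln (sqrt x))\<^sup>2 \<le> (sqrt x)\<^sup>2" by (intro power_mono) auto
      thus ?thesis using that \<open>0 \<le> ln (sqrt x)\<close> by simp
    qed
    have "(logv t)\<^sup>2 \<le> v t + 1 / v t"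
    proof (cases "1 \<le> v t")
      case True
      have "0 \<le> 1 / v t" by simp
      thus ?thesis using *[OF True] unfolding logv_def by linarith
    next
      case False
      hence "1 \<le> 1 / v t" using elim by simp
      moreover have "ln (sqrt (1 / v t)) = - logv t" using elim by (simp add: logv_def real_sqrt_divide ln_div)
      ultimately show ?thesis using *[of "1 / v t"] elim by simp
    qed
    thus ?case by simp
  qed
qed measurable

section \<open>The weighted measure and its inner product\<close>

abbreviation "\<mu> \<equiv> weighted_circ w"

lemma space_mu [simp]: "space \<mu> = {0..2*pi}" and sets_mu [measurable_cong, simp]: "sets \<mu> = sets circ"
  by (simp_all add: weighted_circ_def)

lemma integral_mu:
  fixes f :: "real \<Rightarrow> 'b::{banach, second_countable_topology}"
  assumes "f \<in> borel_measurable circ"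
  shows "(\<integral>t. f t \<partial>\<mu>) = (\<integral>t. (v t / (2*pi)) *\<^sub>R f t \<partial>circ)"
    "integrable \<mu> f \<longleftrightarrow> integrable circ (\<lambda>t. (v t / (2*pi)) *\<^sub>R f t)"
  using assms unfolding weighted_circ_def by (auto simp: integral_density integrable_density)

lemma nn_integral_mu:
  assumes "f \<in> borel_measurable circ"
  shows "(\<integral>\<^sup>+t. f t \<partial>\<mu>) = (\<integral>\<^sup>+t. ennreal (v t / (2*pi)) * f t \<partial>circ)"
  unfolding weighted_circ_def by (rule nn_integral_density) (use assms in measurable)

lemma AE_mu: "AE t in circ. P t \<Longrightarrow> AE t in \<mu>. P t"
  unfolding weighted_circ_def by (subst AE_density) (measurable, auto elim: eventually_mono)

lemma emeasure_mu_space: "emeasure \<mu> (space \<mu>) = 1"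
proof -
  have "emeasure \<mu> (space \<mu>) = (\<integral>\<^sup>+t. 1 \<partial>\<mu>)" by simp
  also have "\<dots> = 1"
    using normalized by (subst nn_integral_mu) (simp_all add: normalized_def)
  finally show ?thesis .
qed

sublocale mu: finite_measure \<mu> by (rule finite_measureI) (simp only: emeasure_mu_space, simp)

lemma poly_measurable [measurable]: "(\<lambda>t. poly P (cis t)) \<in> borel_measurable circ"
  by (intro borel_measurable_circ_continuous continuous_intros)

lemma cnj_poly_measurable [measurable]: "(\<lambda>t. cnj (poly P (cis t))) \<in> borel_measurable circ"
  by (intro borel_measurable_circ_continuous continuous_intros)

lemma integrable_poly_mult: "integrable \<mu> (\<lambda>t. poly P (cis t) * cnj (poly Q (cis t)))"
proof -
  obtain K L where K: "\<And>t. norm (poly P (cis t)) \<le> K" and L: "\<And>t. norm (poly Q (cis t)) \<le> L"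
    by (rule poly_cis_bounded[of P], rule poly_cis_bounded[of Q]) (rule that)
  show ?thesis
  proof (rule mu.integrable_const_bound[where B = "K * L"])
    show "AE t in \<mu>. norm (poly P (cis t) * cnj (poly Q (cis t))) \<le> K * L"
      using K L order.trans[OF norm_ge_zero K]
      by (intro always_eventually allI) (auto simp: norm_mult intro!: mult_mono)
  qed measurable
qed

definition ip :: "complex poly \<Rightarrow> complex poly \<Rightarrow> complex" where
  "ip P Q = (\<integral>t. poly P (cis t) * cnj (poly Q (cis t)) \<partial>\<mu>)"

lemma ip_add: "ip (P + Q) R = ip P R + ip Q R"
  unfolding ip_def by (simp add: integrable_poly_mult distrib_right)

lemma ip_diff: "ip (P - Q) R = ip P R - ip Q R"
  unfolding ip_def by (simp add: integrable_poly_mult left_diff_distrib)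

lemma ip_smult: "ip (smult c P) R = c * ip P R"
  unfolding ip_def by (simp add: mult.assoc)

lemma ip_0 [simp]: "ip 0 R = 0"
  by (simp add: ip_def)

lemma ip_sum: "ip (\<Sum>i\<in>A. f i) R = (\<Sum>i\<in>A. ip (f i) R)"
  by (induction A rule: infinite_finite_induct) (auto simp: ip_add)

lemma ip_cnj: "cnj (ip P Q) = ip Q P"
  unfolding ip_def Bochner_Integration.integral_cnj[symmetric] by (simp add: mult.commute)

lemma ip_diff_right: "ip R (P - Q) = ip R P - ip R Q"
  using arg_cong[OF ip_diff[of P Q R], of cnj] by (simp add: ip_cnj)

lemma ip_smult_right: "ip R (smult c P) = cnj c * ip R P"
  using arg_cong[OF ip_smult[of c P R], of cnj] by (simp add: ip_cnj)

lemma ip_self: "ip P P = of_real (\<integral>t. (norm (poly P (cis t)))\<^sup>2 \<partial>\<mu>)"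
proof -
  have "ip P P = (\<integral>t. of_real ((norm (poly P (cis t)))\<^sup>2) \<partial>\<mu>)"
    unfolding ip_def by (simp only: complex_norm_square)
  thus ?thesis by (simp only: integral_complex_of_real)
qed

lemma norm_poly_integrable: "integrable \<mu> (\<lambda>t. (norm (poly P (cis t)))\<^sup>2)"
  using integrable_norm[OF integrable_poly_mult[of P P]] by (simp add: norm_mult power2_eq_square)

text \<open>There are finitely many roots, and \<open>cis\<close> is injective on [0, 2 pi), so only
  finitely many parameters are excluded; 2 pi is added to them as the repeated end point.\<close>

lemma AE_poly_cis_nonzero:
  assumes "P \<noteq> (0::complex poly)"
  shows "AE t in circ. poly P (cis t) \<noteq> 0"
proof -
  define S where "S = {t\<in>{0..<2*pi}. poly P (cis t) = 0}"
  have "inj_on cis {0..<2*pi}"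
  proof (rule inj_on_inverseI)
    fix t assume "t \<in> {0..<2*pi}"
    thus "Arg2pi (cis t) = t" by (intro Arg2pi_unique[of 1]) (auto simp: cis_conv_exp)
  qed
  hence "finite S"
    using poly_roots_finite[OF assms]
    by (intro inj_on_finite[of cis S "{x. poly P x = 0}"]) (auto simp: S_def intro: inj_on_subset)
  hence "AE t in lebesgue. t \<notin> insert (2 * pi) S"
    by (intro AE_not_in) (auto simp flip: negligible_iff_null_sets)
  hence "AE t in circ. t \<notin> insert (2 * pi) S" by (rule AE_circI)
  with AE_space show ?thesis
    by eventually_elim (auto simp: S_def)
qed

text \<open>The weight is positive almost everywhere, so a polynomial of norm 0 would vanish at
  almost all points of the circle, whereas a nonzero one vanishes only on a null set.\<close>

lemma ip_self_eq_0: "ip P P = 0 \<Longrightarrow> P = 0"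
proof (rule ccontr)
  assume "ip P P = 0" "P \<noteq> 0"
  hence "(\<integral>t. (norm (poly P (cis t)))\<^sup>2 \<partial>\<mu>) = 0" by (simp add: ip_self)
  hence "AE t in \<mu>. (norm (poly P (cis t)))\<^sup>2 = 0"
    using integral_nonneg_eq_0_iff_AE[OF norm_poly_integrable[of P]] by simp
  hence "AE t in circ. 0 < ennreal (v t / (2*pi)) \<longrightarrow> (norm (poly P (cis t)))\<^sup>2 = 0"
    unfolding weighted_circ_def by (subst (asm) AE_density) measurable
  with AE_v_pos AE_poly_cis_nonzero[OF \<open>P \<noteq> 0\<close>] have "AE t in circ. False"
    by eventually_elim simp
  hence "emeasure circ (space circ) = 0" by (simp only: ae_filter_eq_bot_iff[symmetric] eventually_False)
  thus False using measure_circ by (simp add: measure_def)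
qed

section \<open>Existence and uniqueness of the orthonormal polynomials\<close>

lemma orthonormal_iff: "is_orthonormal_polys w \<phi> \<longleftrightarrow>
     (\<forall>n. degree (\<phi> n) = n \<and> lead_coeff (\<phi> n) \<in> \<real> \<and> 0 < Re (lead_coeff (\<phi> n))) \<and>
     (\<forall>m n. ip (\<phi> m) (\<phi> n) = (if m = n then 1 else 0))"
  by (simp add: is_orthonormal_polys_def ip_def)

text \<open>The alternative D = 0 is kept apart because the zero polynomial has degree 0, which is
  not below n when n = 0.\<close>

lemma eliminate_lead:
  fixes P Q :: "complex poly"
  assumes "degree P \<le> n" "degree Q = n" "Q \<noteq> 0"
  defines "D \<equiv> P - smult (coeff P n / lead_coeff Q) Q"
  shows "D = 0 \<or> degree D < n"
proof (cases "D = 0")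
  case False
  have "coeff Q n \<noteq> 0" using assms(2,3) by auto
  hence "coeff D n = 0" using assms(2) by (simp add: D_def)
  moreover have "degree D \<le> n" unfolding D_def
    using assms by (intro degree_diff_le order.trans[OF degree_smult_le]) auto
  ultimately show ?thesis using leading_coeff_0_iff[of D] by (cases "degree D = n") auto
qed simp

text \<open>The \<open>\<phi> k\<close> with k < n have degree exactly k, so subtracting multiples
  of them lowers the degree of \<open>P\<close> step by step down to the zero polynomial.\<close>

lemma orthogonal_lower_degree:
  assumes "\<And>k. k < n \<Longrightarrow> degree (\<phi> k) = k \<and> \<phi> k \<noteq> 0 \<and> ip (\<phi> k) \<psi> = 0"
    and "P = 0 \<or> degree P < n"
  shows "ip P \<psi> = 0"
  using assms(2)
proof (induction "degree P" arbitrary: P rule: less_induct)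
  case less
  show ?case
  proof (cases "P = 0")
    case False
    define d where "d = degree P"
    have d: "d < n" using less.prems False by (simp add: d_def)
    define D where "D = P - smult (coeff P d / lead_coeff (\<phi> d)) (\<phi> d)"
    have "D = 0 \<or> degree D < d" unfolding D_def
      using assms(1)[OF d] by (intro eliminate_lead) (auto simp: d_def)
    hence "ip D \<psi> = 0" using less.hyps[of D] d by (auto simp: d_def)
    thus ?thesis using assms(1)[OF d] by (simp add: D_def ip_diff ip_smult)
  qed simp
qed

fun gram_schmidt :: "nat \<Rightarrow> complex poly" where
  "gram_schmidt n = (let p = monom 1 n - (\<Sum>k<n. smult (ip (monom 1 n) (gram_schmidt k)) (gram_schmidt k))
     in smult (of_real (1 / sqrt (Re (ip p p)))) p)"

declare gram_schmidt.simps [simp del]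

lemma gram_schmidt_orthonormal:
  "degree (gram_schmidt n) = n \<and> lead_coeff (gram_schmidt n) \<in> \<real> \<and> 0 < Re (lead_coeff (gram_schmidt n)) \<and>
   ip (gram_schmidt n) (gram_schmidt n) = 1 \<and>
   (\<forall>k<n. ip (gram_schmidt n) (gram_schmidt k) = 0)"
proof (induction n rule: less_induct)
  case (less n)
  define p where "p = monom 1 n - (\<Sum>k<n. smult (ip (monom 1 n) (gram_schmidt k)) (gram_schmidt k))"
  \<comment> \<open>All subtracted terms have degree below n, so \<open>p\<close> is monic; after
    normalisation the leading coefficient is 1 / sqrt N, real and positive.\<close>
  have cp: "coeff p n = 1"
    using less by (auto simp: p_def coeff_sum coeff_eq_0 intro!: sum.neutral)
  have "degree p \<le> n" unfolding p_def
  proof (intro degree_diff_le degree_sum_le)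
    fix k assume "k \<in> {..<n}"
    thus "degree (smult (ip (monom 1 n) (gram_schmidt k)) (gram_schmidt k)) \<le> n"
      using less[of k] degree_smult_le[of _ "gram_schmidt k"] by (metis lessThan_iff less_imp_le order.trans)
  qed (auto simp: degree_monom_le)
  hence dp: "degree p = n" using cp by (metis le_antisym le_degree zero_neq_one)
  have pk: "ip p (gram_schmidt k) = 0" if "k < n" for k
  proof -
    have "ip (gram_schmidt j) (gram_schmidt k) = (if j = k then 1 else 0)" if "j < n" for j
    proof (cases j k rule: linorder_cases)
      case less
      hence "ip (gram_schmidt k) (gram_schmidt j) = 0" using less.IH[OF \<open>k < n\<close>] by blast
      thus ?thesis using less ip_cnj[of "gram_schmidt k" "gram_schmidt j"] by simp
    qed (use less.IH that in auto)
    hence "(\<Sum>j<n. ip (monom 1 n) (gram_schmidt j) * ip (gram_schmidt j) (gram_schmidt k))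
      = (\<Sum>j<n. if j = k then ip (monom 1 n) (gram_schmidt k) else 0)"
      by (intro sum.cong) auto
    also have "\<dots> = ip (monom 1 n) (gram_schmidt k)" using that by simp
    finally show ?thesis by (simp add: p_def ip_diff ip_sum ip_smult)
  qed
  define N where "N = Re (ip p p)"
  have pp: "ip p p = of_real N" by (simp add: N_def ip_self)
  have "p \<noteq> 0" using cp by auto
  hence "N \<noteq> 0" using ip_self_eq_0[of p] pp by auto
  moreover have "0 \<le> N" by (simp add: N_def ip_self)
  ultimately have N: "0 < N" by simp
  have g: "gram_schmidt n = smult (of_real (1 / sqrt N)) p"
    by (subst gram_schmidt.simps) (simp add: p_def N_def Let_def)
  show ?case
    using N cp dp pk pp
    by (auto simp: g ip_smult ip_smult_right simp flip: of_real_mult of_real_divide)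
qed

lemma is_orthonormal_gram_schmidt: "is_orthonormal_polys w gram_schmidt"
  unfolding orthonormal_iff
proof (intro conjI allI)
  fix m n
  show "ip (gram_schmidt m) (gram_schmidt n) = (if m = n then 1 else 0)"
  proof (cases m n rule: linorder_cases)
    case less
    hence "ip (gram_schmidt n) (gram_schmidt m) = 0" using gram_schmidt_orthonormal[of n] by blast
    thus ?thesis using less ip_cnj[of "gram_schmidt n" "gram_schmidt m"] by simp
  qed (use gram_schmidt_orthonormal in auto)
qed (use gram_schmidt_orthonormal in blast)+

lemma orthonormal_lower_degree:
  assumes "is_orthonormal_polys w \<phi>" "P = 0 \<or> degree P < n"
  shows "ip P (\<phi> n) = 0"
proof (rule orthogonal_lower_degree[of n \<phi>])
  show "degree (\<phi> k) = k \<and> \<phi> k \<noteq> 0 \<and> ip (\<phi> k) (\<phi> n) = 0" if "k < n" for k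
    using assms(1) that unfolding orthonormal_iff by (auto dest: spec[of _ k])
qed fact

text \<open>With \<open>c\<close> the quotient of the leading coefficients, \<psi> n - c * \<phi> n
  has degree below n. It is orthogonal to both polynomials, hence to itself, and vanishes. Unit
  norms and c > 0 then force c = 1.\<close>

lemma orthonormal_unique:
  assumes "is_orthonormal_polys w \<phi>" "is_orthonormal_polys w \<psi>"
  shows "\<phi> = \<psi>"
proof
  fix n
  have \<phi>: "degree (\<phi> n) = n" "lead_coeff (\<phi> n) \<in> \<real>" "0 < Re (lead_coeff (\<phi> n))" "ip (\<phi> n) (\<phi> n) = 1"
    and \<psi>: "degree (\<psi> n) = n" "lead_coeff (\<psi> n) \<in> \<real>" "0 < Re (lead_coeff (\<psi> n))" "ip (\<psi> n) (\<psi> n) = 1"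
  proof -
    have "degree (\<eta> n) = n \<and> lead_coeff (\<eta> n) \<in> \<real> \<and> 0 < Re (lead_coeff (\<eta> n))"
      "ip (\<eta> n) (\<eta> n) = (if n = n then 1 else 0)" if "is_orthonormal_polys w \<eta>" for \<eta>
      using that unfolding orthonormal_iff by blast+
    from this[OF assms(1)] this[OF assms(2)]
    show "degree (\<phi> n) = n" "lead_coeff (\<phi> n) \<in> \<real>" "0 < Re (lead_coeff (\<phi> n))" "ip (\<phi> n) (\<phi> n) = 1"
      "degree (\<psi> n) = n" "lead_coeff (\<psi> n) \<in> \<real>" "0 < Re (lead_coeff (\<psi> n))" "ip (\<psi> n) (\<psi> n) = 1"
      by (blast, blast, blast, simp only: simp_thms if_True, blast, blast, blast, simp only: simp_thms if_True)
  qed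
  have nz: "\<phi> n \<noteq> 0" using \<phi>(3) by auto
  define c where "c = lead_coeff (\<psi> n) / lead_coeff (\<phi> n)"
  define r where "r = Re (lead_coeff (\<psi> n)) / Re (lead_coeff (\<phi> n))"
  have c: "c = of_real r"
    unfolding c_def r_def of_real_divide using \<phi>(2) \<psi>(2) by (metis of_real_Re)
  have r: "0 < r" using \<phi>(3) \<psi>(3) by (simp add: r_def)
  define D where "D = \<psi> n - smult c (\<phi> n)"
  have D: "D = 0 \<or> degree D < n"
    using eliminate_lead[of "\<psi> n" n "\<phi> n"] \<phi>(1) \<psi>(1) nz by (simp add: D_def c_def)
  have "ip D D = ip D (\<psi> n) - cnj c * ip D (\<phi> n)"
    by (subst (2) D_def) (simp add: ip_diff_right ip_smult_right)
  also have "\<dots> = 0" using orthonormal_lower_degree[OF _ D] assms by simp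
  finally have "D = 0" by (rule ip_self_eq_0)
  hence eq: "\<psi> n = smult c (\<phi> n)" by (simp add: D_def)
  hence "1 = c * cnj c" using \<phi>(4) \<psi>(4) by (simp add: ip_smult ip_smult_right mult.commute)
  hence "complex_of_real (r * r) = of_real 1" by (simp add: c)
  hence "r * r = 1" by (simp only: of_real_eq_iff)
  hence "r = 1" using r square_eq_1_iff[of r] by auto
  thus "\<phi> n = \<psi> n" using eq c by simp
qed

text \<open>Existence by Gram-Schmidt and uniqueness give meaning to the definite description in
  \<open>orthonormal_poly\<close>.\<close>

lemma orthonormal_poly: "is_orthonormal_polys w (orthonormal_poly w)"
  unfolding orthonormal_poly_def
  by (rule theI[of "is_orthonormal_polys w" gram_schmidt, OF is_orthonormal_gram_schmidt]) (rule orthonormal_unique[OF _ is_orthonormal_gram_schmidt])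

section \<open>Leading coefficients and reversed polynomials\<close>

abbreviation "\<phi> \<equiv> orthonormal_poly w"

definition kappa :: "nat \<Rightarrow> real" where
  "kappa n = Re (lead_coeff (\<phi> n))"

lemma phi_props:
  shows "degree (\<phi> n) = n" "coeff (\<phi> n) n = of_real (kappa n)" "0 < kappa n" "ip (\<phi> n) (\<phi> n) = 1"
proof -
  have *: "degree (\<phi> n) = n \<and> lead_coeff (\<phi> n) \<in> \<real> \<and> 0 < Re (lead_coeff (\<phi> n))"
    "ip (\<phi> n) (\<phi> n) = (if n = n then 1 else 0)"
    using orthonormal_poly unfolding orthonormal_iff by blast+
  show d: "degree (\<phi> n) = n" and "0 < kappa n" "ip (\<phi> n) (\<phi> n) = 1"
    using * unfolding kappa_def by (blast, blast, simp only: simp_thms if_True)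
  have "lead_coeff (\<phi> n) \<in> \<real>" using * by blast
  thus "coeff (\<phi> n) n = of_real (kappa n)" using d by (simp add: kappa_def)
qed

text \<open>Modulo polynomials of degree below n, which are orthogonal to \<open>\<phi> n\<close>,
  \<open>Q\<close> equals \<open>c\<close> times \<open>\<phi> n\<close>. So \<open>c\<close> is the
  component of \<open>Q\<close> along a unit vector, and |c| is at most the norm of
  \<open>Q\<close>.\<close>

lemma leading_coeff_bound:
  assumes "degree Q \<le> n"
  shows "(norm (coeff Q n))\<^sup>2 / (kappa n)\<^sup>2 \<le> (\<integral>t. (norm (poly Q (cis t)))\<^sup>2 \<partial>\<mu>)"
proof -
  have nz: "\<phi> n \<noteq> 0" using phi_props(2,3)[of n] by auto
  define c where "c = coeff Q n / kappa n"
  define D where "D = Q - smult c (\<phi> n)"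
  have "D = 0 \<or> degree D < n"
    using eliminate_lead[OF assms phi_props(1) nz] by (simp add: D_def c_def phi_props)
  hence D: "ip D (\<phi> n) = 0" using orthonormal_lower_degree[OF orthonormal_poly] by blast
  hence Q: "ip Q (\<phi> n) = c" by (simp add: D_def ip_diff ip_smult phi_props)
  have "ip D D = ip D Q" using D by (subst (2) D_def) (simp add: ip_diff_right ip_smult_right)
  also have "\<dots> = ip Q Q - c * cnj c"
    using ip_cnj[of Q "\<phi> n"] by (simp add: D_def ip_diff ip_smult Q)
  finally have "Re (ip D D) = Re (ip Q Q) - (norm c)\<^sup>2"
    by (simp add: complex_norm_square[symmetric])
  moreover have "0 \<le> Re (ip D D)" by (simp add: ip_self)
  ultimately have "(norm c)\<^sup>2 \<le> (\<integral>t. (norm (poly Q (cis t)))\<^sup>2 \<partial>\<mu>)" by (simp add: ip_self)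
  thus ?thesis using phi_props(3)[of n] by (simp add: c_def norm_divide power_divide)
qed

text \<open>The star operation z^n * cnj (P (1 / cnj z)) in terms of coefficients, which also gives
  the value at 0. The reversal is relative to \<open>n\<close>, not to the degree of
  \<open>P\<close>.\<close>

definition conj_reverse :: "nat \<Rightarrow> complex poly \<Rightarrow> complex poly" where
  "conj_reverse n P = (\<Sum>k\<le>n. monom (cnj (coeff P (n - k))) k)"

lemma coeff_conj_reverse: "coeff (conj_reverse n P) k = (if k \<le> n then cnj (coeff P (n - k)) else 0)"
  by (auto simp: conj_reverse_def coeff_sum if_distrib cong: if_cong)

lemma poly_conj_reverse:
  assumes "degree P \<le> n" "norm z = 1"
  shows "poly (conj_reverse n P) z = z ^ n * cnj (poly P z)"
proof -
  have z: "z * cnj z = 1" using assms(2) by (simp add: complex_norm_square[symmetric])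
  have P: "poly P z = (\<Sum>k\<le>n. coeff P k * z ^ k)" 
    unfolding poly_altdef using assms(1) by (intro sum.mono_neutral_left) (auto simp: coeff_eq_0)
  have "poly (conj_reverse n P) z = (\<Sum>k\<le>n. cnj (coeff P (n - k)) * z ^ k)"
    by (simp add: conj_reverse_def poly_sum poly_monom)
  also have "\<dots> = (\<Sum>k\<le>n. cnj (coeff P k) * z ^ (n - k))"
    by (rule sum.reindex_bij_witness[of _ "\<lambda>k. n - k" "\<lambda>k. n - k"]) auto
  also have "\<dots> = (\<Sum>k\<le>n. z ^ n * cnj (coeff P k * z ^ k))"
  proof (rule sum.cong)
    fix k assume "k \<in> {..n}"
    hence "z ^ n * cnj z ^ k = z ^ (n - k) * (z * cnj z) ^ k"
      by (simp add: power_mult_distrib power_add[symmetric] mult.assoc[symmetric])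
    thus "cnj (coeff P k) * z ^ (n - k) = z ^ n * cnj (coeff P k * z ^ k)" by (simp add: z mult_ac)
  qed simp
  finally show ?thesis by (simp add: P cnj_sum sum_distrib_left)
qed

text \<open>Reversal keeps the modulus on the circle and moves the constant coefficient 1 to
  position n, where \<open>leading_coeff_bound\<close> applies.\<close>

lemma kappa_bound:
  assumes "coeff P 0 = 1" "degree P \<le> n"
  shows "1 / (kappa n)\<^sup>2 \<le> (\<integral>t. (norm (poly P (cis t)))\<^sup>2 \<partial>\<mu>)"
proof -
  have "degree (conj_reverse n P) \<le> n" by (rule degree_le) (auto simp: coeff_conj_reverse)
  from leading_coeff_bound[OF this] assms show ?thesis
    by (simp add: coeff_conj_reverse poly_conj_reverse norm_mult norm_power)
qed

lemma reversed_poly_cis: "reversed_poly w n (cis t) = poly (conj_reverse n (\<phi> n)) (cis t)"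
proof -
  have "1 / cnj (cis t) = inverse (cis (- t))" by (simp only: cis_cnj inverse_eq_divide)
  hence "1 / cnj (cis t) = cis t" by (simp only: cis_inverse minus_minus)
  thus ?thesis by (simp add: reversed_poly_def poly_conj_reverse phi_props)
qed

lemma norm_reversed_poly: "norm (poly (conj_reverse n (\<phi> n)) (cis t)) = norm (poly (\<phi> n) (cis t))"
  by (simp add: poly_conj_reverse phi_props norm_mult norm_power)

end

section \<open>Convergence in the weighted spaces\<close>

lemma ennpow_ennreal: "0 \<le> x \<Longrightarrow> ennpow (ennreal x) p = ennreal (x powr p)"
  by (simp add: ennpow_def)

lemma ennpow_tendsto_0:
  assumes "x \<longlonglongrightarrow> (0::ennreal)" "0 < q"
  shows "(\<lambda>n. ennpow (x n) q) \<longlonglongrightarrow> 0"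
proof -
  have "(\<lambda>n. enn2real (x n)) \<longlonglongrightarrow> enn2real 0"
    by (rule tendsto_enn2real) (use assms in auto)
  hence "(\<lambda>n. enn2real (x n) powr q) \<longlonglongrightarrow> 0"
    using assms(2) by (intro tendsto_zero_powrI[of _ _ "\<lambda>_. q" q]) auto
  hence "(\<lambda>n. ennreal (enn2real (x n) powr q)) \<longlonglongrightarrow> 0"
    using tendsto_ennrealI by fastforce
  moreover have "\<forall>\<^sub>F n in sequentially. x n < 1"
    using order_tendstoD(2)[OF assms(1), of 1] by simp
  hence "\<forall>\<^sub>F n in sequentially. ennreal (enn2real (x n) powr q) = ennpow (x n) q"
    by eventually_elim (auto simp: ennpow_def)
  ultimately show ?thesis by (rule Lim_transform_eventually)
qed

lemma ennpow_le_imp_le: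
  assumes "ennpow J (1 / p) \<le> L" "L < \<infinity>" "0 < p"
  shows "J \<le> ennreal (enn2real L powr p)"
proof -
  have "J \<noteq> \<infinity>" using assms by (auto simp: ennpow_def top_unique)
  then obtain j where j: "J = ennreal j" "0 \<le> j" by (cases J) auto
  have "ennreal (j powr (1 / p)) \<le> L" using assms(1) j by (simp add: ennpow_ennreal)
  from enn2real_mono[OF this] have "j powr (1 / p) \<le> enn2real L" using assms(2) by simp
  hence "(j powr (1 / p)) powr p \<le> enn2real L powr p" using assms(3) by (intro powr_mono2) auto
  thus ?thesis using j assms(3) by (simp add: powr_powr ennreal_leI)
qed

text \<open>One of the two summands suffices, depending on whether x is at most R. This replaces
  Hoelder interpolation: the L2 part will tend to 0, and the factor of the other part is small for
  large \<open>R\<close>.\<close>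

lemma powr_interpolation:
  fixes x p s R :: real
  assumes "0 \<le> x" "2 \<le> p" "p < s" "0 < R"
  shows "x powr p \<le> R powr (p - 2) * x\<^sup>2 + R powr (p - s) * x powr s"
proof (cases "x \<le> R")
  case True
  have "x powr p = x powr (p - 2) * x\<^sup>2"
    using assms by (cases "x = 0") (auto simp: powr_add[symmetric] simp flip: powr_numeral)
  also have "\<dots> \<le> R powr (p - 2) * x\<^sup>2"
    using True assms by (intro mult_right_mono powr_mono2) auto
  also have "\<dots> \<le> R powr (p - 2) * x\<^sup>2 + R powr (p - s) * x powr s" by simp
  finally show ?thesis .
next
  case False
  have "x powr p = x powr (p - s) * x powr s"
    using assms False by (simp add: powr_add[symmetric])
  also have "\<dots> \<le> R powr (p - s) * x powr s"
    using False assms by (intro mult_right_mono powr_mono2') auto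
  also have "\<dots> \<le> R powr (p - 2) * x\<^sup>2 + R powr (p - s) * x powr s" by simp
  finally show ?thesis .
qed

lemma powr_add_le:
  fixes a b s :: real
  assumes "0 \<le> a" "0 \<le> b" "0 \<le> s"
  shows "(a + b) powr s \<le> 2 powr s * (a powr s + b powr s)"
proof -
  have "(a + b) powr s \<le> (2 * max a b) powr s" using assms by (intro powr_mono2) auto
  also have "\<dots> = 2 powr s * (max a b) powr s" using assms by (simp add: powr_mult)
  also have "(max a b) powr s \<le> a powr s + b powr s" by (auto simp: max_def)
  finally show ?thesis by simp
qed

lemma powr_le_one_plus:
  fixes x s r :: real
  assumes "0 \<le> x" "0 \<le> s" "s \<le> r"
  shows "x powr s \<le> 1 + x powr r"
proof (cases "x \<le> 1")
  case True
  hence "x powr s \<le> 1 powr s" using assms by (intro powr_mono2) auto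
  thus ?thesis by (simp add: add_increasing2)
next
  case False
  hence "x powr s \<le> x powr r" using assms by (intro powr_mono) auto
  thus ?thesis by simp
qed

context A2_weight
begin

section \<open>The Szego function and the distance in the weighted L2 space\<close>

lemma szego_eq_exp_herglotz: "szego w z = exp (herglotz logv z)"
  by (simp add: szego_def herglotz_def logv_def)

lemma szego_boundary_eq:
  assumes "((\<lambda>r. herglotz logv (of_real r * cis t)) \<longlongrightarrow> h) (at_left 1)"
  shows "szego_boundary w (cis t) = exp h"
  unfolding szego_boundary_def szego_eq_exp_herglotz
  by (intro tendsto_Lim tendsto_exp assms) simp

lemma norm_exp_outer:
  assumes "AE t in circ. Re (H t) = logv t"
  shows "AE t in circ. (norm (exp (H t)))\<^sup>2 = v t"
  using assms exp_logv by eventually_elim (simp add: exp_double)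

text \<open>Write D for exp H, so that w = |D|^2. Then w * |R - 1/D|^2 = |R * D - 1|^2 for the
  reversed polynomial \<open>R\<close>. Expanding gives the norm 1 of \<open>\<phi> n\<close>, the
  mean 1 of the constant, and a cross term which the mean value property evaluates through R(0) =
  kappa n.\<close>

lemma L2_distance:
  assumes H [measurable]: "H \<in> borel_measurable circ" and Re: "AE t in circ. Re (H t) = logv t"
    and mean: "\<And>P. (\<integral>t. poly P (cis t) * exp (H t) \<partial>circ) = 2 * pi * coeff P 0 * of_real (exp l)"
  shows "integrable \<mu> (\<lambda>t. (norm (poly (conj_reverse n (\<phi> n)) (cis t) - exp (- H t)))\<^sup>2)"
    "(\<integral>t. (norm (poly (conj_reverse n (\<phi> n)) (cis t) - exp (- H t)))\<^sup>2 \<partial>\<mu>) = 2 - 2 * kappa n * exp l"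
proof -
  define R where "R = conj_reverse n (\<phi> n)"
  note vH = norm_exp_outer[OF Re]
  obtain K where K: "\<And>t. norm (poly R (cis t)) \<le> K" by (rule poly_cis_bounded) (rule that)
  have K0: "0 \<le> K" using K[of 0] norm_ge_zero order.trans by blast
  have i1: "integrable circ (\<lambda>t. poly R (cis t) * exp (H t))"
  proof (rule Bochner_Integration.integrable_bound)
    show "integrable circ (\<lambda>t. K * (1 + v t))" using v_integrable by simp
    show "AE t in circ. norm (poly R (cis t) * exp (H t)) \<le> norm (K * (1 + v t))"
      using vH
    proof eventually_elim
      case (elim t)
      have "2 * norm (exp (H t)) \<le> 1 + (norm (exp (H t)))\<^sup>2"
        using sum_squares_bound[of 1 "norm (exp (H t))"] by simp
      hence "norm (exp (H t)) \<le> 1 + v t" using norm_ge_zero[of "exp (H t)"] unfolding elim by linarith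
      hence "norm (poly R (cis t)) * norm (exp (H t)) \<le> K * (1 + v t)"
        using K K0 by (intro mult_mono) auto
      thus ?case using K0 by (simp add: norm_mult)
    qed
  qed measurable
  have "integrable \<mu> (\<lambda>t. (norm (poly R (cis t)))\<^sup>2)" by (rule norm_poly_integrable)
  hence i2: "integrable circ (\<lambda>t. v t / (2*pi) * (norm (poly R (cis t)))\<^sup>2)" by (subst (asm) integral_mu) auto
  have "(\<integral>t. (norm (poly R (cis t)))\<^sup>2 \<partial>\<mu>) = 1"
    using phi_props(4)[of n] unfolding ip_self R_def norm_reversed_poly by (simp only: of_real_eq_1_iff)
  hence I2: "(\<integral>t. v t / (2*pi) * (norm (poly R (cis t)))\<^sup>2 \<partial>circ) = 1" by (subst (asm) integral_mu) auto
  define h where "h t = Re (poly R (cis t) * exp (H t))" for t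
  have i3: "integrable circ h" and I3: "(\<integral>t. h t \<partial>circ) = 2 * pi * (kappa n * exp l)"
    unfolding h_def using integrable_Re[OF i1] integral_Re[OF i1] mean[of R]
    by (simp_all only:) (simp add: R_def coeff_conj_reverse phi_props)
  define k where "k t = v t / (2*pi) * (norm (poly R (cis t)))\<^sup>2" for t
  have k: "integrable circ k" "(\<integral>t. k t \<partial>circ) = 1" unfolding k_def by (fact i2, fact I2)
  define g where "g t = k t + 1 / (2*pi) - 1 / pi * h t" for t
  have ig: "integrable circ g" unfolding g_def using k i3 by simp
  have eq: "AE t in circ. v t / (2*pi) * (norm (poly R (cis t) - exp (- H t)))\<^sup>2 = g t"
    using vH
  proof eventually_elim
    case (elim t)
    have "v t * (norm (poly R (cis t) - exp (- H t)))\<^sup>2 = (norm (exp (H t) * (poly R (cis t) - exp (- H t))))\<^sup>2"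
      by (simp only: norm_mult power_mult_distrib elim)
    also have "exp (H t) * (poly R (cis t) - exp (- H t)) = poly R (cis t) * exp (H t) - 1"
      by (simp add: right_diff_distrib exp_minus mult.commute)
    also have "(norm (poly R (cis t) * exp (H t) - 1))\<^sup>2
       = (norm (poly R (cis t) * exp (H t)))\<^sup>2 + 1 - 2 * Re (poly R (cis t) * exp (H t))"
      by (simp only: cmod_power2) (simp add: power2_eq_square algebra_simps)
    also have "(norm (poly R (cis t) * exp (H t)))\<^sup>2 = v t * (norm (poly R (cis t)))\<^sup>2"
      by (simp only: norm_mult power_mult_distrib elim mult.commute)
    finally have *: "v t * (norm (poly R (cis t) - exp (- H t)))\<^sup>2 = v t * (norm (poly R (cis t)))\<^sup>2 + 1 - 2 * h t"
      unfolding h_def .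
    have "v t / (2*pi) * (norm (poly R (cis t) - exp (- H t)))\<^sup>2 = (v t * (norm (poly R (cis t) - exp (- H t)))\<^sup>2) / (2*pi)"
      by simp
    thus ?case unfolding * by (simp add: g_def k_def add_divide_distrib diff_divide_distrib)
  qed
  have m1 [measurable]: "(\<lambda>t. poly R (cis t) - exp (- H t)) \<in> borel_measurable circ" by measurable
  have "integrable circ (\<lambda>t. v t / (2*pi) * (norm (poly R (cis t) - exp (- H t)))\<^sup>2)"
    by (rule integrable_cong_AE_imp[OF ig]) (measurable, use eq in \<open>eventually_elim, simp\<close>)
  thus "integrable \<mu> (\<lambda>t. (norm (poly (conj_reverse n (\<phi> n)) (cis t) - exp (- H t)))\<^sup>2)"
    unfolding R_def[symmetric] by (subst integral_mu) auto
  have "(\<integral>t. (norm (poly R (cis t) - exp (- H t)))\<^sup>2 \<partial>\<mu>) = (\<integral>t. v t / (2*pi) * (norm (poly R (cis t) - exp (- H t)))\<^sup>2 \<partial>circ)"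
    by (subst integral_mu) auto
  also have "\<dots> = (\<integral>t. g t \<partial>circ)"
    by (rule integral_cong_AE) (use ig eq in \<open>auto simp: borel_measurable_integrable\<close>)
  also have "\<dots> = 1 + 1 - 1 / pi * (\<integral>t. h t \<partial>circ)"
    unfolding g_def using i3 k measure_circ by simp
  also have "\<dots> = 2 - 2 * kappa n * exp l" unfolding I3 by simp
  finally show "(\<integral>t. (norm (poly (conj_reverse n (\<phi> n)) (cis t) - exp (- H t)))\<^sup>2 \<partial>\<mu>) = 2 - 2 * kappa n * exp l"
    unfolding R_def .
qed

text \<open>A nearly extremal polynomial has mean square below exp (2 l) * (1 + d). With x = kappa n
  * exp l, \<open>kappa_bound\<close> yields 1 < x^2 * (1 + d), and x \<le> 1 bounds the right side
  by x + d.\<close>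

lemma kappa_exp_lower:
  assumes szego: "\<And>e. 0 < e \<Longrightarrow> \<exists>P. coeff P 0 = 1 \<and>
      (\<integral>t. (norm (poly P (cis t)))\<^sup>2 * exp (2 * logv t) \<partial>circ) < 2 * pi * exp (2 * l) + e"
    and le: "\<And>n. kappa n * exp l \<le> 1" and d: "0 < d"
  shows "\<forall>\<^sub>F n in sequentially. 1 - d < kappa n * exp l"
proof -
  \<comment> \<open>The error is taken relative to the limit value, so that division by 2 pi exp (2
    l) leaves 1 + d.\<close>
  obtain P where P: "coeff P 0 = 1"
    "(\<integral>t. (norm (poly P (cis t)))\<^sup>2 * exp (2 * logv t) \<partial>circ) < 2 * pi * exp (2 * l) + 2 * pi * exp (2 * l) * d"
    using szego[of "2 * pi * exp (2 * l) * d"] d by auto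
  have "(\<integral>t. (norm (poly P (cis t)))\<^sup>2 * exp (2 * logv t) \<partial>circ) = (\<integral>t. v t * (norm (poly P (cis t)))\<^sup>2 \<partial>circ)"
    by (rule integral_cong_AE) (measurable, use exp_logv in \<open>eventually_elim, simp\<close>)
  also have "\<dots> = 2 * pi * (\<integral>t. (norm (poly P (cis t)))\<^sup>2 \<partial>\<mu>)"
    by (subst integral_mu) auto
  finally have "2 * pi * (\<integral>t. (norm (poly P (cis t)))\<^sup>2 \<partial>\<mu>) < 2 * pi * (exp (2 * l) * (1 + d))"
    using P(2) by (simp add: algebra_simps)
  hence M: "(\<integral>t. (norm (poly P (cis t)))\<^sup>2 \<partial>\<mu>) < exp (2 * l) * (1 + d)" by simp
  have "1 - d < kappa n * exp l" if "n \<ge> degree P" for n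
  proof -
    define x where "x = kappa n * exp l"
    have x: "0 < x" "x \<le> 1" using phi_props(3) le by (auto simp: x_def)
    have "1 / (kappa n)\<^sup>2 < exp (2 * l) * (1 + d)" using kappa_bound[OF P(1) that] M by linarith
    hence "1 < (exp (2 * l) * (1 + d)) * (kappa n)\<^sup>2"
      using phi_props(3)[of n] by (simp add: pos_divide_less_eq)
    hence "1 < x\<^sup>2 * (1 + d)" 
      unfolding exp_double x_def power_mult_distrib by (simp only: mult_ac)
    also have "x\<^sup>2 * (1 + d) \<le> x * (1 + d)"
      using x d by (intro mult_right_mono) (auto simp: power2_eq_square)
    also have "\<dots> \<le> x + d" using x d by (simp add: distrib_left mult_right_le_one_le mult_left_le_one_le)
    finally show ?thesis by (simp add: x_def)
  qed
  thus ?thesis by (auto simp: eventually_sequentially)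
qed

text \<open>An exponent below the supremum lies below an admissible exponent \<open>r\<close>, and
  \<open>w\<close> itself is one of the weights over which admissibility at the level
  \<open>A2_char w\<close> quantifies.\<close>

lemma nn_integral_phi_bound:
  assumes "p < p_cr (A2_char w)"
  obtains r K where "p < ennreal r" "0 < r" "0 \<le> K"
    "\<And>n. (\<integral>\<^sup>+t. ennreal (norm (poly (\<phi> n) (cis t)) powr r) \<partial>\<mu>) \<le> ennreal K"
proof -
  obtain r where r: "p < ennreal r" "0 < r"
    "(SUP n. Lp_norm \<mu> r (\<lambda>t. ennreal (cmod (poly (\<phi> n) (cis t))))) < \<infinity>"
    using assms weight normalized unfolding p_cr_def less_Sup_iff by blast
  define L where "L = (SUP n. Lp_norm \<mu> r (\<lambda>t. ennreal (cmod (poly (\<phi> n) (cis t)))))"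
  have "(\<integral>\<^sup>+t. ennreal (norm (poly (\<phi> n) (cis t)) powr r) \<partial>\<mu>) \<le> ennreal (enn2real L powr r)" for n
  proof (rule ennpow_le_imp_le)
    have "Lp_norm \<mu> r (\<lambda>t. ennreal (cmod (poly (\<phi> n) (cis t)))) \<le> L"
      unfolding L_def by (rule SUP_upper) simp
    thus "ennpow (\<integral>\<^sup>+t. ennreal (norm (poly (\<phi> n) (cis t)) powr r) \<partial>\<mu>) (1 / r) \<le> L"
      by (simp add: Lp_norm_def ennpow_ennreal)
  qed (use r in \<open>auto simp: L_def\<close>)
  thus ?thesis using that[OF r(1,2), of "enn2real L powr r"] by simp
qed

text \<open>If every admissible q satisfied 2 (1 + q) \<le> p, then \<open>q_cr w\<close> would be
  at most p / 2 - 1, contradicting the hypothesis. Here p \<ge> 2 keeps p / 2 - 1 nonnegative in the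
  extended reals.\<close>

lemma nn_integral_inverse_powr:
  assumes "ennreal p < 2 * (1 + q_cr w)" "2 \<le> p"
  obtains q where "0 < q" "p < 2 * (1 + q)"
    "(\<integral>\<^sup>+t. ennreal ((1 / v t) powr q) \<partial>circ) < \<infinity>"
proof -
  have "\<exists>q. 0 < q \<and> Lp_norm circ q (\<lambda>t. inverse (ennreal (v t))) < \<infinity> \<and> p < 2 * (1 + q)"
  proof (rule ccontr)
    assume no: "\<not> ?thesis"
    have "q_cr w \<le> ennreal (p / 2 - 1)"
      unfolding q_cr_def
    proof (rule Sup_least, clarsimp)
      fix q assume "0 < q" "Lp_norm circ q (\<lambda>t. inverse (ennreal (v t))) < top"
      hence "\<not> p < 2 * (1 + q)" using no by auto
      thus "ennreal q \<le> ennreal (p / 2 - 1)" by (intro ennreal_leI) (simp add: not_less field_simps)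
    qed
    hence "2 * (1 + q_cr w) \<le> 2 * (1 + ennreal (p / 2 - 1))"
      by (intro mult_left_mono add_left_mono) auto
    also have "\<dots> = ennreal 2 * (ennreal 1 + ennreal (p / 2 - 1))" by simp
    also have "\<dots> = ennreal (2 * (1 + (p / 2 - 1)))"
      using assms(2) by (simp only: ennreal_plus[symmetric] ennreal_mult[symmetric])
    also have "2 * (1 + (p / 2 - 1)) = p" by simp
    finally show False using assms(1) by simp
  qed
  then obtain q where q: "0 < q" "Lp_norm circ q (\<lambda>t. inverse (ennreal (v t))) < \<infinity>" "p < 2 * (1 + q)"
    by blast
  have "(\<integral>\<^sup>+t. ennreal ((1 / v t) powr q) \<partial>circ) = (\<integral>\<^sup>+t. ennpow (inverse (ennreal (v t))) q \<partial>circ)"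
    by (rule nn_integral_cong_AE, use AE_v_pos in eventually_elim)
       (simp add: inverse_ennreal inverse_eq_divide ennpow_ennreal)
  also have "\<dots> < \<infinity>"
    using q(2) unfolding Lp_norm_def by (auto simp: ennpow_def less_top split: if_splits)
  finally show ?thesis using that q by blast
qed

text \<open>The weight times |exp (-H)|^s is (1/v)^(s/2 - 1), and s/2 - 1 \<le> q. The reversed
  polynomial has the modulus of \<open>\<phi> n\<close> and is controlled by the exponent r \<ge> s,
  as the measure is finite.\<close>

lemma nn_integral_distance_bound:
  assumes H [measurable]: "H \<in> borel_measurable circ" and Re: "AE t in circ. Re (H t) = logv t"
    and s: "2 \<le> s" "s \<le> r" "s \<le> 2 * (1 + q)"
    and K: "\<And>n. (\<integral>\<^sup>+t. ennreal (norm (poly (\<phi> n) (cis t)) powr r) \<partial>\<mu>) \<le> ennreal K" "0 \<le> K"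
    and q: "(\<integral>\<^sup>+t. ennreal ((1 / v t) powr q) \<partial>circ) < \<infinity>"
  obtains C where "0 \<le> C"
    "\<And>n. (\<integral>\<^sup>+t. ennreal (norm (poly (conj_reverse n (\<phi> n)) (cis t) - exp (- H t)) powr s) \<partial>\<mu>) \<le> ennreal C"
proof -
  define J where "J = (\<integral>\<^sup>+t. ennreal (norm (exp (- H t)) powr s) \<partial>\<mu>)"
  have "J = (\<integral>\<^sup>+t. ennreal (v t / (2*pi)) * ennreal (norm (exp (- H t)) powr s) \<partial>circ)"
    unfolding J_def by (rule nn_integral_mu) measurable
  also have "\<dots> \<le> (\<integral>\<^sup>+t. 1 + ennreal ((1 / v t) powr q) \<partial>circ)"
  proof (rule nn_integral_mono_AE, use AE_v_pos Re in eventually_elim)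
    case (elim t)
    have "norm (exp (- H t)) powr s = (1 / v t) powr (s / 2)"
      using elim by (simp add: logv_def powr_def ln_sqrt ln_div)
    hence "v t * norm (exp (- H t)) powr s = (1 / v t) powr (s / 2 - 1)"
      using elim by (simp add: powr_diff)
    also have "\<dots> \<le> 1 + (1 / v t) powr q"
      using elim s by (intro powr_le_one_plus) auto
    finally have "v t * norm (exp (- H t)) powr s \<le> 1 + (1 / v t) powr q" .
    moreover have "v t / (2*pi) * norm (exp (- H t)) powr s \<le> v t * norm (exp (- H t)) powr s"
      using elim pi_ge_two by (intro mult_right_mono) (auto simp: field_simps)
    ultimately have "v t / (2*pi) * norm (exp (- H t)) powr s \<le> 1 + (1 / v t) powr q" by linarith
    hence "ennreal (v t / (2*pi) * norm (exp (- H t)) powr s) \<le> ennreal (1 + (1 / v t) powr q)"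
      by (rule ennreal_leI)
    moreover have "ennreal (v t / (2*pi)) * ennreal (norm (exp (- H t)) powr s) = ennreal (v t / (2*pi) * norm (exp (- H t)) powr s)"
      by (intro ennreal_mult[symmetric]) auto
    moreover have "ennreal (1 + (1 / v t) powr q) = 1 + ennreal ((1 / v t) powr q)"
      by (subst ennreal_plus) auto
    ultimately show ?case by (simp only:)
  qed
  also have "\<dots> = (\<integral>\<^sup>+t. 1 \<partial>circ) + (\<integral>\<^sup>+t. ennreal ((1 / v t) powr q) \<partial>circ)"
    by (rule nn_integral_add) auto
  also have "\<dots> < \<infinity>" using q circ.emeasure_finite[of "{0..2*pi}"] by (auto simp: less_top[symmetric])
  finally have J: "J < \<infinity>" .
  define C where "C = 2 powr s * (1 + K + enn2real J)"
  show ?thesis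
  proof
    show "0 \<le> C" using K(2) by (simp add: C_def)
    fix n
    let ?a = "\<lambda>t. norm (poly (\<phi> n) (cis t))" and ?b = "\<lambda>t. norm (exp (- H t))"
    have "(\<integral>\<^sup>+t. ennreal (norm (poly (conj_reverse n (\<phi> n)) (cis t) - exp (- H t)) powr s) \<partial>\<mu>)
      \<le> (\<integral>\<^sup>+t. ennreal (2 powr s) * (1 + ennreal (?a t powr r) + ennreal (?b t powr s)) \<partial>\<mu>)"
    proof (rule nn_integral_mono)
      fix t
      have "norm (poly (conj_reverse n (\<phi> n)) (cis t) - exp (- H t)) powr s \<le> (?a t + ?b t) powr s"
        using norm_triangle_ineq4[of "poly (conj_reverse n (\<phi> n)) (cis t)" "exp (- H t)"] s
        by (intro powr_mono2) (auto simp: norm_reversed_poly)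
      also have "\<dots> \<le> 2 powr s * (?a t powr s + ?b t powr s)" using s by (intro powr_add_le) auto
      also have "\<dots> \<le> 2 powr s * (1 + ?a t powr r + ?b t powr s)"
        using powr_le_one_plus[of "?a t" s r] s by (intro mult_left_mono add_right_mono) auto
      finally have "ennreal (norm (poly (conj_reverse n (\<phi> n)) (cis t) - exp (- H t)) powr s)
        \<le> ennreal (2 powr s * (1 + ?a t powr r + ?b t powr s))" by (rule ennreal_leI)
      thus "ennreal (norm (poly (conj_reverse n (\<phi> n)) (cis t) - exp (- H t)) powr s)
        \<le> ennreal (2 powr s) * (1 + ennreal (?a t powr r) + ennreal (?b t powr s))"
        by (simp add: ennreal_mult)
    qed
    also have "\<dots> = ennreal (2 powr s) * (1 + (\<integral>\<^sup>+t. ennreal (?a t powr r) \<partial>\<mu>) + J)"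
      unfolding J_def using emeasure_mu_space
      by (simp add: nn_integral_cmult nn_integral_add)
    also have "\<dots> \<le> ennreal (2 powr s) * (1 + ennreal K + ennreal (enn2real J))"
      using K J by (intro mult_left_mono add_mono) auto
    also have "\<dots> = ennreal C" using K(2) by (simp add: C_def ennreal_mult)
    finally show "(\<integral>\<^sup>+t. ennreal (norm (poly (conj_reverse n (\<phi> n)) (cis t) - exp (- H t)) powr s) \<partial>\<mu>) \<le> ennreal C" .
  qed
qed

theorem Lp_convergence:
  assumes p: "2 \<le> p" "ennreal p < min (p_cr (A2_char w)) (2 * (1 + q_cr w))"
  shows "(\<lambda>n. Lp_norm \<mu> p
            (\<lambda>\<theta>. ennreal (cmod (reversed_poly w n (cis \<theta>) - inverse (szego_boundary w (cis \<theta>))))))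
         \<longlonglongrightarrow> 0"
proof -
  have p': "ennreal p < p_cr (A2_char w)" "ennreal p < 2 * (1 + q_cr w)"
    using p(2) by (simp_all only: min_less_iff_conj)
  obtain H l where H [measurable]: "H \<in> borel_measurable circ"
    and lim: "AE t in circ. ((\<lambda>r. herglotz logv (of_real r * cis t)) \<longlongrightarrow> H t) (at_left 1)"
    and Re: "AE t in circ. Re (H t) = logv t"
    and mean: "\<And>P. (\<integral>t. poly P (cis t) * exp (H t) \<partial>circ) = 2 * pi * coeff P 0 * of_real (exp l)"
    and szego: "\<And>e. 0 < e \<Longrightarrow> \<exists>P. coeff P 0 = 1 \<and>
      (\<integral>t. (norm (poly P (cis t)))\<^sup>2 * exp (2 * logv t) \<partial>circ) < 2 * pi * exp (2 * l) + e"
    by (rule outer_function[OF logv_measurable logv_square_integrable integrable_exp_logv]) (rule that)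
  define D where "D n t = norm (poly (conj_reverse n (\<phi> n)) (cis t) - exp (- H t))" for n t
  have Dm [measurable]: "D n \<in> borel_measurable circ" for n unfolding D_def by measurable
  have D0: "0 \<le> D n t" for n t by (simp add: D_def)
  have D2: "integrable \<mu> (\<lambda>t. (D n t)\<^sup>2)" "(\<integral>t. (D n t)\<^sup>2 \<partial>\<mu>) = 2 - 2 * kappa n * exp l" for n
    unfolding D_def by (rule L2_distance[OF H Re mean])+
  define E where "E n = 2 - 2 * kappa n * exp l" for n
  have "0 \<le> (\<integral>t. (D n t)\<^sup>2 \<partial>\<mu>)" for n by simp
  hence E0: "0 \<le> E n" for n unfolding D2 E_def .
  have E: "E \<longlonglongrightarrow> 0"
  proof (rule order_tendstoI)
    fix a :: real assume "0 < a"
    \<comment> \<open>Nonnegativity of the squared distance is already the upper bound.\<close>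
    have "kappa n * exp l \<le> 1" for n using E0[of n] by (simp add: E_def)
    from kappa_exp_lower[OF szego this, of "a / 2"] \<open>0 < a\<close>
    have "\<forall>\<^sub>F n in sequentially. 1 - a / 2 < kappa n * exp l" by simp
    thus "\<forall>\<^sub>F n in sequentially. E n < a" by eventually_elim (simp add: E_def)
  next
    fix a :: real assume "a < 0"
    thus "\<forall>\<^sub>F n in sequentially. a < E n"
      using E0 by (intro always_eventually allI) (rule order.strict_trans2)
  qed
  obtain r K where r: "ennreal p < ennreal r" "0 < r" "0 \<le> K"
    "\<And>n. (\<integral>\<^sup>+t. ennreal (norm (poly (\<phi> n) (cis t)) powr r) \<partial>\<mu>) \<le> ennreal K"
    by (rule nn_integral_phi_bound[OF p'(1)]) (rule that)
  obtain q where q: "0 < q" "p < 2 * (1 + q)" "(\<integral>\<^sup>+t. ennreal ((1 / v t) powr q) \<partial>circ) < \<infinity>"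
    by (rule nn_integral_inverse_powr[OF p'(2) p(1)]) (rule that)
  \<comment> \<open>An exponent strictly above p at which both the orthonormal polynomials and the
    inverse Szego function are controlled.\<close>
  define s where "s = min r (2 * (1 + q))"
  have "p < r" using r(1) p(1) by (simp add: ennreal_less_iff)
  hence s: "p < s" "2 \<le> s" "s \<le> r" "s \<le> 2 * (1 + q)" using q(2) p(1) by (auto simp: s_def)
  obtain C where C: "0 \<le> C" "\<And>n. (\<integral>\<^sup>+t. ennreal (D n t powr s) \<partial>\<mu>) \<le> ennreal C"
    by (rule nn_integral_distance_bound[OF H Re s(2-4) r(4,3) q(3), folded D_def]) (rule that)
  define I where "I n = (\<integral>\<^sup>+t. ennreal (D n t powr p) \<partial>\<mu>)" for n
  have I: "I n \<le> ennreal (R powr (p - 2) * E n + R powr (p - s) * C)" if R: "0 < R" for n R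
  proof -
    have "I n \<le> (\<integral>\<^sup>+t. ennreal (R powr (p - 2)) * ennreal ((D n t)\<^sup>2) + ennreal (R powr (p - s)) * ennreal (D n t powr s) \<partial>\<mu>)"
      unfolding I_def
    proof (rule nn_integral_mono)
      fix t
      have "ennreal (D n t powr p) \<le> ennreal (R powr (p - 2) * (D n t)\<^sup>2 + R powr (p - s) * D n t powr s)"
        by (intro ennreal_leI powr_interpolation D0 p s R)
      thus "ennreal (D n t powr p) \<le> ennreal (R powr (p - 2)) * ennreal ((D n t)\<^sup>2) + ennreal (R powr (p - s)) * ennreal (D n t powr s)"
        by (simp add: ennreal_mult)
    qed
    also have "\<dots> = (\<integral>\<^sup>+t. ennreal (R powr (p - 2)) * ennreal ((D n t)\<^sup>2) \<partial>\<mu>) + (\<integral>\<^sup>+t. ennreal (R powr (p - s)) * ennreal (D n t powr s) \<partial>\<mu>)"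
      by (rule nn_integral_add) measurable
    also have "\<dots> = ennreal (R powr (p - 2)) * (\<integral>\<^sup>+t. ennreal ((D n t)\<^sup>2) \<partial>\<mu>) + ennreal (R powr (p - s)) * (\<integral>\<^sup>+t. ennreal (D n t powr s) \<partial>\<mu>)"
      by (intro arg_cong2[of _ _ _ _ "(+)"] nn_integral_cmult) measurable
    also have "(\<integral>\<^sup>+t. ennreal ((D n t)\<^sup>2) \<partial>\<mu>) = ennreal (E n)"
      using nn_integral_eq_integral[OF D2(1)[of n]] D2(2)[of n] by (simp add: E_def)
    also have "ennreal (R powr (p - 2)) * ennreal (E n) + ennreal (R powr (p - s)) * (\<integral>\<^sup>+t. ennreal (D n t powr s) \<partial>\<mu>)
       \<le> ennreal (R powr (p - 2)) * ennreal (E n) + ennreal (R powr (p - s)) * ennreal C"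
      by (intro add_left_mono mult_left_mono C) auto
    also have "\<dots> = ennreal (R powr (p - 2) * E n + R powr (p - s) * C)"
      using E0 C(1) by (simp add: ennreal_mult)
    finally show ?thesis .
  qed
  have "(\<lambda>n. enn2real (I n)) \<longlonglongrightarrow> 0"
  proof (rule order_tendstoI)
    fix a :: real assume a: "0 < a"
    \<comment> \<open>The order of choices matters: as p < s, a large \<open>R\<close> makes the
      second term small uniformly in n, and with this \<open>R\<close> fixed the first term tends to
      0 with \<open>E n\<close>.\<close>
    have "((\<lambda>R. R powr (p - s) * C) \<longlongrightarrow> 0 * C) at_top"
      using s(1) by (intro tendsto_intros tendsto_neg_powr filterlim_ident) auto
    from order_tendstoD(2)[OF this, of "a / 2"] a
    have "\<forall>\<^sub>F R in at_top. R powr (p - s) * C < a / 2" by simp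
    with eventually_gt_at_top[of 0] have "\<forall>\<^sub>F R in at_top. 0 < R \<and> R powr (p - s) * C < a / 2"
      by eventually_elim simp
    from eventually_happens'[OF _ this] obtain R where R: "0 < R" "R powr (p - s) * C < a / 2" by auto
    have "(\<lambda>n. R powr (p - 2) * E n) \<longlonglongrightarrow> R powr (p - 2) * 0" by (intro tendsto_intros E)
    from order_tendstoD(2)[OF this, of "a / 2"] a
    have "\<forall>\<^sub>F n in sequentially. R powr (p - 2) * E n < a / 2" by simp
    thus "\<forall>\<^sub>F n in sequentially. enn2real (I n) < a"
    proof eventually_elim
      case (elim n)
      have "enn2real (I n) \<le> R powr (p - 2) * E n + R powr (p - s) * C"
        using I[OF R(1), of n] E0[of n] C(1) by (intro enn2real_leI) auto
      thus ?case using elim R(2) by linarith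
    qed
  next
    fix a :: real assume "a < 0"
    thus "\<forall>\<^sub>F n in sequentially. a < enn2real (I n)"
      by (intro always_eventually allI) (rule order.strict_trans2[OF _ enn2real_nonneg])
  qed
  hence "(\<lambda>n. ennreal (enn2real (I n))) \<longlonglongrightarrow> ennreal 0" by (rule tendsto_ennrealI)
  moreover have "ennreal (enn2real (I n)) = I n" for n
    by (rule ennreal_enn2real) (rule le_less_trans[OF I[OF zero_less_one] ennreal_less_top])
  ultimately have "I \<longlonglongrightarrow> 0" by simp
  hence "(\<lambda>n. ennpow (I n) (1 / p)) \<longlonglongrightarrow> 0" using p(1) by (intro ennpow_tendsto_0) auto
  moreover have "Lp_norm \<mu> p (\<lambda>\<theta>. ennreal (cmod (reversed_poly w n (cis \<theta>) - inverse (szego_boundary w (cis \<theta>)))))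
      = ennpow (I n) (1 / p)" for n
  proof -
    \<comment> \<open>Almost everywhere the radial limit exists, so the boundary value of the Szego
      function is exp H there.\<close>
    have "(\<integral>\<^sup>+\<theta>. ennpow (ennreal (cmod (reversed_poly w n (cis \<theta>) - inverse (szego_boundary w (cis \<theta>))))) p \<partial>\<mu>) = I n"
      unfolding I_def
    proof (rule nn_integral_cong_AE, rule AE_mu, use lim in eventually_elim)
      case (elim t)
      show ?case
        by (simp add: szego_boundary_eq[OF elim] reversed_poly_cis D_def exp_minus ennpow_ennreal)
    qed
    thus ?thesis by (simp add: Lp_norm_def)
  qed
  ultimately show ?thesis by simp
qed

end

theorem corollary1:
  fixes w :: "complex \<Rightarrow> real" and p :: real
  assumes "weight w"
    and "A2_char w < \<infinity>"
    and "normalized w"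
    and "2 \<le> p"
    and "ennreal p < min (p_cr (A2_char w)) (2 * (1 + q_cr w))"
  shows "(\<lambda>n. Lp_norm (weighted_circ w) p
            (\<lambda>\<theta>. ennreal (cmod (reversed_poly w n (cis \<theta>) - inverse (szego_boundary w (cis \<theta>))))))
         \<longlonglongrightarrow> 0"
proof -
  interpret A2_weight w by standard (fact assms)+
  show ?thesis by (rule Lp_convergence) (fact assms)+
qed

end
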